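(* Let $P:\mathcal{M}(\mathbb{C})^N\to\mathcal{M}(\mathbb{C})^N$ be a free polynomial map. The following are equivalent: (1) For every $n$ and every $X\in\mathcal{M}_n(\mathbb{C})^N$, the linear map $H\mapsto DP(X)[H]$ on $\mathcal{M}_n(\mathbb{C})^N$ is nonsingular (i.e. $DP(X)[H]=0$ implies $H=0$). (2) $P$ is injective. (3) $P$ is bijective. (4) $P^{-1}$ exists and, for each $n$, $P^{-1}|_{\mathcal{M}_n(\mathbb{C})^N}$ agrees with (the evaluation of) some free polynomial map.
   Context: $\mathcal{M}_n(\mathbb{C})$ denotes the $n\times n$ complex matrices and $\mathcal{M}(\mathbb{C})^N=\bigcup_{n\ge1}\mathcal{M}_n(\mathbb{C})^N$. A free polynomial map $P=(p_1,\dots,p_N)$ is an $N$-tuple of noncommutative polynomials in $N$ variables with complex coefficients, evaluated on matrix tuples by substitution; it maps $\mathcal{M}_n(\mathbb{C})^N$ to itself. The derivative $DP(X)[H]$, for $X,H\in\mathcal{M}_n(\mathbb{C})^N$, is defined by $P\begin{pmatrix}X&H\\0&X\end{pmatrix}=\begin{pmatrix}P(X)&DP(X)[H]\\0&P(X)\end{pmatrix}$ (block matrices formed coordinatewise); equivalently it is the evaluation of the formal derivative obtained from $D(x_i)[H]=H_i$, linearity, and the Leibniz rule $D(fg)[H]=Df[H]g+fDg[H]$. *)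

theory Defs
  imports Complex_Main "Jordan_Normal_Form.Matrix"
begin

text \<open>Noncommutative polynomials in the N variables x_0,...,x_{N-1} with complex
coefficients: finitely supported coefficient functions on words (lists of variable
indices, all indices below N).\<close>

definition ncpoly :: "nat \<Rightarrow> (nat list \<Rightarrow> complex) set" where
  "ncpoly N = {c. finite {w. c w \<noteq> 0} \<and> (\<forall>w. c w \<noteq> 0 \<longrightarrow> set w \<subseteq> {..<N})}"

definition fpmap :: "nat \<Rightarrow> (nat list \<Rightarrow> complex) list \<Rightarrow> bool" where
  "fpmap N P \<longleftrightarrow> length P = N \<and> (\<forall>p\<in>set P. p \<in> ncpoly N)"

definition tup :: "nat \<Rightarrow> nat \<Rightarrow> complex mat list set" where
  "tup N n = {X. length X = N \<and> (\<forall>i<N. X ! i \<in> carrier_mat n n)}"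

definition eval_word :: "nat \<Rightarrow> complex mat list \<Rightarrow> nat list \<Rightarrow> complex mat" where
  "eval_word n X w = foldr (\<lambda>i M. X ! i * M) w (1\<^sub>m n)"

definition eval_poly :: "nat \<Rightarrow> (nat list \<Rightarrow> complex) \<Rightarrow> complex mat list \<Rightarrow> complex mat" where
  "eval_poly n p X = mat n n (\<lambda>(i, j). \<Sum>w\<in>{w. p w \<noteq> 0}. p w * (eval_word n X w $$ (i, j)))"

definition eval_map :: "nat \<Rightarrow> (nat list \<Rightarrow> complex) list \<Rightarrow> complex mat list \<Rightarrow> complex mat list" where
  "eval_map n P X = map (\<lambda>p. eval_poly n p X) P"

text \<open>Derivative via block upper-triangular matrices:
  P [[X, H], [0, X]] = [[P(X), DP(X)[H]], [0, P(X)]].\<close>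

definition upper_right :: "nat \<Rightarrow> complex mat \<Rightarrow> complex mat" where
  "upper_right n M = mat n n (\<lambda>(i, j). M $$ (i, j + n))"

definition DP :: "nat \<Rightarrow> (nat list \<Rightarrow> complex) list \<Rightarrow> complex mat list \<Rightarrow> complex mat list \<Rightarrow> complex mat list" where
  "DP n P X H = map (upper_right n)
      (eval_map (2 * n) P (map2 (\<lambda>x h. four_block_mat x h (0\<^sub>m n n) x) X H))"

end

theory Submission
  imports Defs "HOL-Library.Poly_Mapping" "HOL-Computational_Algebra.Polynomial_FPS"
    "HOL-Computational_Algebra.Fraction_Field" "HOL-Computational_Algebra.Fundamental_Theorem_Algebra"
    "Jordan_Normal_Form.Determinant"
begin

text \<open>If all derivatives are nonsingular and \<open>P(X) = P(Y)\<close>, then for \<open>Z = X \<oplus> Y\<close> and the upper right block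
unit \<open>T\<close> one has \<open>DP(Z)[[Z, T]] = [P(Z), T] = 0\<close>, so \<open>[Z, T] = 0\<close>, that is \<open>X = Y\<close>. Conversely
\<open>DP(X)[H]\<close> is the corner of \<open>P\<close> at a block triangular tuple.

Suppose \<open>P\<close> is injective and fix the matrix size. The corner of \<open>P\<close> at triangular tuples with diagonal \<open>X, X'\<close> gives
\<open>F(x) - F(x') = J(x, x') (x - x')\<close> for the commutative polynomial map \<open>F\<close> in the matrix entries, and \<open>det J\<close> vanishes nowhere, so it is
constant and \<open>x - x' = N(x, x') (F(x) - F(x'))\<close> with \<open>N\<close> polynomial. Hence \<open>F\<close> is a monomorphism on
points in every commutative \<open>\<complex>\<close>-algebra, and such an \<open>F\<close> is an automorphism of affine space:

\<^item> If \<open>\<tau>\<close> is a \<open>\<complex>(F)\<close>-linear endomorphism of \<open>\<complex>(x)\<close>, substituting left multiplication for \<open>x\<close> and right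
  multiplication for \<open>x'\<close> shows that \<open>\<tau>\<close> commutes with \<open>x\<close>. Therefore \<open>x \<in> \<complex>(F)\<close>: the inverse is rational.

\<^item> For base point \<open>x\<^sub>0\<close> and a line \<open>x(s)\<close> consider the inverse on the segment from \<open>F(x\<^sub>0)\<close> to \<open>F(x(s))\<close>,
  with parameter \<open>t\<close>. Newton iteration expands it as a power series over \<open>\<complex>[s]\<close> at both ends, so its reduced
  denominator \<open>B(s, t)\<close> takes unit values, that is constants, at \<open>t = 0\<close> and \<open>t = 1\<close>. For end points of
  generic degree \<open>B(1) / B(0)\<close> thus does not depend on the end point; sliding the end point along the segment
  gives \<open>B(t) = B(1)\<close>. So there are no poles and the inverse is polynomial.

The Newton iteration for \<open>P\<close> started at the scalar root of \<open>P\<close> consists of noncommutative polynomials and converges to this inverse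
along \<open>tY\<close> in the \<open>t\<close>-adic sense; as the inverse has bounded degree in \<open>t\<close>, truncating the iteration
by word length yields a free polynomial.\<close>


subsection \<open>Polynomials in infinitely many commuting variables\<close>

text \<open>One variable for every natural number: the same type then serves all matrix sizes, and
  doubling the variables stays inside it.\<close>

type_synonym mp = "(nat \<Rightarrow>\<^sub>0 nat) \<Rightarrow>\<^sub>0 complex"

definition Const :: "complex \<Rightarrow> mp" where "Const c = Poly_Mapping.single 0 c"

definition Var :: "nat \<Rightarrow> mp" where "Var v = Poly_Mapping.single (Poly_Mapping.single v 1) 1"

definition monomial_eval :: "(nat \<Rightarrow> 'a::comm_ring_1) \<Rightarrow> (nat \<Rightarrow>\<^sub>0 nat) \<Rightarrow> 'a" where
  "monomial_eval x m = (\<Prod>v\<in>Poly_Mapping.keys m. x v ^ Poly_Mapping.lookup m v)"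

text \<open>The embedding \<open>k\<close> of the constants is a parameter because the target
  varies: complex numbers, polynomials, power series, a fraction field.\<close>

definition mp_eval :: "(complex \<Rightarrow> 'a::comm_ring_1) \<Rightarrow> (nat \<Rightarrow> 'a) \<Rightarrow> mp \<Rightarrow> 'a" where
  "mp_eval k x p = (\<Sum>m\<in>Poly_Mapping.keys p. k (Poly_Mapping.lookup p m) * monomial_eval x m)"

lemma monomial_eval_superset:
  assumes "finite S" "Poly_Mapping.keys m \<subseteq> S"
  shows "monomial_eval x m = (\<Prod>v\<in>S. x v ^ Poly_Mapping.lookup m v)"
  unfolding monomial_eval_def
  by (rule prod.mono_neutral_left[OF assms]) (auto simp: in_keys_iff)

lemma monomial_eval_0 [simp]: "monomial_eval x 0 = 1"
  by (simp add: monomial_eval_def)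

lemma monomial_eval_add: "monomial_eval x (m + n) = monomial_eval x m * monomial_eval x n"
proof -
  let ?S = "Poly_Mapping.keys m \<union> Poly_Mapping.keys n"
  have "monomial_eval x (m + n) = (\<Prod>v\<in>?S. x v ^ Poly_Mapping.lookup (m + n) v)"
    by (rule monomial_eval_superset) (use Poly_Mapping.keys_add[of m n] in auto)
  moreover have "monomial_eval x m = (\<Prod>v\<in>?S. x v ^ Poly_Mapping.lookup m v)"
    by (rule monomial_eval_superset) auto
  moreover have "monomial_eval x n = (\<Prod>v\<in>?S. x v ^ Poly_Mapping.lookup n v)"
    by (rule monomial_eval_superset) auto
  ultimately show ?thesis
    by (simp add: lookup_add power_add prod.distrib)
qed

lemma monomial_eval_single [simp]: "monomial_eval x (Poly_Mapping.single v 1) = x v"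
  by (simp add: monomial_eval_def)

lemma mp_sum_single:
  "p = (\<Sum>m\<in>Poly_Mapping.keys p. Poly_Mapping.single m (Poly_Mapping.lookup p m))"
  for p :: "'a \<Rightarrow>\<^sub>0 'b::comm_monoid_add"
proof (rule poly_mapping_eqI)
  fix k
  have "Poly_Mapping.lookup (\<Sum>m\<in>Poly_Mapping.keys p. Poly_Mapping.single m (Poly_Mapping.lookup p m)) k
     = (\<Sum>m\<in>Poly_Mapping.keys p. (if m = k then Poly_Mapping.lookup p k else 0))"
    unfolding lookup_sum by (rule sum.cong) (auto simp: lookup_single)
  then show "Poly_Mapping.lookup p k =
    Poly_Mapping.lookup (\<Sum>m\<in>Poly_Mapping.keys p. Poly_Mapping.single m (Poly_Mapping.lookup p m)) k"
    by (simp add: in_keys_iff)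
qed

lemma Var_power: "Var v ^ n = Poly_Mapping.single (Poly_Mapping.single v n) 1"
  by (induction n) (auto simp: Var_def mult_single simp flip: single_add)

lemma prod_single_1:
  "finite S \<Longrightarrow> (\<Prod>v\<in>S. Poly_Mapping.single (f v) 1)
     = (Poly_Mapping.single (\<Sum>v\<in>S. f v) 1 :: ('a::comm_monoid_add) \<Rightarrow>\<^sub>0 'b::comm_semiring_1)"
  by (induction S rule: finite_induct) (auto simp: mult_single)

lemma single_eq_Const_mult_Vars:
  "Poly_Mapping.single m c = Const c * (\<Prod>v\<in>Poly_Mapping.keys m. Var v ^ Poly_Mapping.lookup m v)"
  by (simp add: Var_power prod_single_1 Const_def mult_single flip: mp_sum_single)

text \<open>A polynomial is a finite sum of constants times powers of variables, so identities
  between homomorphisms need checking on generators only.\<close>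

lemma mp_induct [case_names Const Var add mult]:
  fixes p :: mp
  assumes C: "\<And>c. P (Const c)" and V: "\<And>v. P (Var v)"
    and A: "\<And>p q. P p \<Longrightarrow> P q \<Longrightarrow> P (p + q)" and M: "\<And>p q. P p \<Longrightarrow> P q \<Longrightarrow> P (p * q)"
  shows "P p"
proof -
  have 0: "P 0" and 1: "P 1" using C[of 0] C[of 1] by (auto simp: Const_def)
  have pw: "P (Var v ^ n)" for v n by (induction n) (auto intro: 1 V M)
  have pr: "finite S \<Longrightarrow> P (\<Prod>v\<in>S. Var v ^ f v)" for S and f :: "nat \<Rightarrow> nat"
    by (induction S rule: finite_induct) (auto intro: 1 M pw)
  have sg: "P (Poly_Mapping.single m c)" for m c
    unfolding single_eq_Const_mult_Vars by (intro M C pr finite_keys)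
  have "finite S \<Longrightarrow> P (\<Sum>m\<in>S. Poly_Mapping.single m (f m))" for S f
    by (induction S rule: finite_induct) (auto intro: 0 A sg)
  then have "P (\<Sum>m\<in>Poly_Mapping.keys p. Poly_Mapping.single m (Poly_Mapping.lookup p m))"
    by simp
  then show ?thesis by (simp flip: mp_sum_single)
qed

lemma monomial_eval_power2: "monomial_eval (\<lambda>v. if v = w then c else 1) m = c ^ Poly_Mapping.lookup m w"
proof -
  have "monomial_eval (\<lambda>v. if v = w then c else 1) m
    = (\<Prod>v\<in>insert w (Poly_Mapping.keys m). (if v = w then c ^ Poly_Mapping.lookup m w else 1))"
    by (subst monomial_eval_superset[of "insert w (Poly_Mapping.keys m)"], simp, blast, rule prod.cong) auto
  also have "\<dots> = c ^ Poly_Mapping.lookup m w" by (subst prod.delta) auto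
  finally show ?thesis .
qed

lemma monomial_eval_mult: "monomial_eval (\<lambda>v. x v * y v) m = monomial_eval x m * monomial_eval y m"
  by (simp add: monomial_eval_def power_mult_distrib prod.distrib)

text \<open>The monomials are distinct characters of the multiplicative monoid of complex points, hence
  linearly independent.\<close>

lemma monomials_independent:
  fixes c :: "(nat \<Rightarrow>\<^sub>0 nat) \<Rightarrow> complex"
  assumes "finite S" "\<And>x. (\<Sum>m\<in>S. c m * monomial_eval x m) = 0" "m \<in> S"
  shows "c m = 0"
  using assms
proof (induction S arbitrary: c m rule: finite_induct)
  case (insert a S)
  have *: "c m = 0" if m: "m \<in> S" for m
  proof -
    have "m \<noteq> a" using m insert.hyps by auto
    then obtain w where w: "Poly_Mapping.lookup m w \<noteq> Poly_Mapping.lookup a w"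
      by (metis poly_mapping_eqI)
    \<comment> \<open>Dedekind's argument: the relation at \<open>x * y\<close> minus the relation
      at \<open>x\<close> scaled by the value of \<open>a\<close> at \<open>y\<close> loses the term
      \<open>a\<close>, while the coefficient of \<open>m\<close> picks up a nonzero factor.\<close>
    define y where "y = (\<lambda>v. if v = w then (2::complex) else 1)"
    have "(\<Sum>m\<in>S. (c m * (monomial_eval y m - monomial_eval y a)) * monomial_eval x m) = 0" for x
    proof -
      have e1: "c a * monomial_eval x a * monomial_eval y a + (\<Sum>m\<in>S. c m * monomial_eval x m * monomial_eval y m) = 0"
        using insert.prems(1)[of "\<lambda>v. x v * y v"] insert.hyps by (simp add: monomial_eval_mult mult.assoc)
      have e2: "c a * monomial_eval x a + (\<Sum>m\<in>S. c m * monomial_eval x m) = 0"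
        using insert.prems(1)[of x] insert.hyps by simp
      have "(\<Sum>m\<in>S. (c m * (monomial_eval y m - monomial_eval y a)) * monomial_eval x m)
         = (\<Sum>m\<in>S. c m * monomial_eval x m * monomial_eval y m) - (\<Sum>m\<in>S. c m * monomial_eval x m) * monomial_eval y a"
        by (simp add: sum_distrib_left sum_subtractf algebra_simps)
      also have "\<dots> = 0"
      proof -
        have "(\<Sum>m\<in>S. c m * monomial_eval x m * monomial_eval y m) = - (c a * monomial_eval x a * monomial_eval y a)"
          "(\<Sum>m\<in>S. c m * monomial_eval x m) = - (c a * monomial_eval x a)"
          using e1 e2 by (simp_all add: eq_neg_iff_add_eq_0 add.commute)
        then show ?thesis by simp
      qed
      finally show ?thesis .
    qed
    from insert.IH[OF this m] have "c m * (monomial_eval y m - monomial_eval y a) = 0" .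
    moreover have "monomial_eval y m \<noteq> monomial_eval y a"
    proof -
      have "(2::complex) ^ i = 2 ^ j \<longleftrightarrow> i = j" for i j :: nat
      proof -
        have "(2::complex) ^ i = 2 ^ j \<longleftrightarrow> (of_nat (2 ^ i) :: complex) = of_nat (2 ^ j)"
          by (simp only: of_nat_power of_nat_numeral)
        then have "(2::complex) ^ i = 2 ^ j \<longleftrightarrow> (2::nat) ^ i = 2 ^ j"
          by (simp only: of_nat_eq_iff)
        then show ?thesis by simp
      qed
      then show ?thesis using w by (simp add: y_def monomial_eval_power2)
    qed
    ultimately show ?thesis by simp
  qed
  have "c a * monomial_eval (\<lambda>_. 1) a = 0"
    using insert.prems(1)[of "\<lambda>_. 1"] insert.hyps * by simp
  moreover have "monomial_eval (\<lambda>_. 1::complex) a = 1" by (simp add: monomial_eval_def)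
  ultimately show ?case using * insert.prems(2) by auto
qed simp

lemma mp_eval_eq_0_imp:
  assumes "\<And>x. mp_eval (\<lambda>c. c) x p = 0"
  shows "p = 0"
proof (rule poly_mapping_eqI)
  fix m
  have "m \<in> Poly_Mapping.keys p \<Longrightarrow> Poly_Mapping.lookup p m = 0"
    by (rule monomials_independent[of "Poly_Mapping.keys p"]) (use assms in \<open>auto simp: mp_eval_def\<close>)
  then show "Poly_Mapping.lookup p m = Poly_Mapping.lookup 0 m" by (auto simp: in_keys_iff)
qed

section \<open>Evaluation as a ring homomorphism\<close>

context
  fixes k :: "complex \<Rightarrow> 'a::comm_ring_1"
  assumes k: "comm_ring_hom k"
begin

interpretation k: comm_ring_hom k by (rule k)

lemma mp_eval_superset:
  assumes "finite S" "Poly_Mapping.keys p \<subseteq> S"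
  shows "mp_eval k x p = (\<Sum>m\<in>S. k (Poly_Mapping.lookup p m) * monomial_eval x m)"
  unfolding mp_eval_def
  by (rule sum.mono_neutral_left[OF assms]) (auto simp: in_keys_iff)

lemma mp_eval_add: "mp_eval k x (p + q) = mp_eval k x p + mp_eval k x q"
proof -
  let ?S = "Poly_Mapping.keys p \<union> Poly_Mapping.keys q"
  have "mp_eval k x (p + q) = (\<Sum>m\<in>?S. k (Poly_Mapping.lookup (p + q) m) * monomial_eval x m)"
    by (rule mp_eval_superset) (use Poly_Mapping.keys_add[of p q] in auto)
  moreover have "mp_eval k x p = (\<Sum>m\<in>?S. k (Poly_Mapping.lookup p m) * monomial_eval x m)"
    by (rule mp_eval_superset) auto
  moreover have "mp_eval k x q = (\<Sum>m\<in>?S. k (Poly_Mapping.lookup q m) * monomial_eval x m)"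
    by (rule mp_eval_superset) auto
  ultimately show ?thesis
    by (simp add: lookup_add k.hom_add ring_distribs sum.distrib)
qed

lemma mp_eval_single: "mp_eval k x (Poly_Mapping.single m c) = k c * monomial_eval x m"
  by (cases "c = 0") (auto simp: mp_eval_def)

lemma mp_eval_Const: "mp_eval k x (Const c) = k c"
  by (simp add: Const_def mp_eval_single)

lemma mp_eval_Var: "mp_eval k x (Var v) = x v"
  unfolding Var_def mp_eval_single by (simp del: One_nat_def)

lemma mp_eval_0: "mp_eval k x 0 = 0" by (simp add: mp_eval_def)

lemma mp_eval_1: "mp_eval k x 1 = 1"
  using mp_eval_Const[of x 1] by (simp add: Const_def)

lemma mp_eval_sum: "mp_eval k x (sum f S) = (\<Sum>i\<in>S. mp_eval k x (f i))"
  by (induction S rule: infinite_finite_induct) (auto simp: mp_eval_0 mp_eval_add)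

lemma mp_eval_mult: "mp_eval k x (p * q) = mp_eval k x p * mp_eval k x q"
proof -
  let ?s = "\<lambda>p m. Poly_Mapping.single m (Poly_Mapping.lookup p m)"
  have "mp_eval k x (p * q) = mp_eval k x ((\<Sum>m\<in>Poly_Mapping.keys p. ?s p m) * (\<Sum>n\<in>Poly_Mapping.keys q. ?s q n))"
    by (simp flip: mp_sum_single)
  also have "\<dots> = (\<Sum>m\<in>Poly_Mapping.keys p. \<Sum>n\<in>Poly_Mapping.keys q. mp_eval k x (?s p m) * mp_eval k x (?s q n))"
    by (simp add: sum_product mp_eval_sum mult_single mp_eval_single k.hom_mult monomial_eval_add ac_simps)
  also have "\<dots> = (\<Sum>m\<in>Poly_Mapping.keys p. mp_eval k x (?s p m)) * (\<Sum>n\<in>Poly_Mapping.keys q. mp_eval k x (?s q n))"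
    by (simp add: sum_product)
  also have "\<dots> = mp_eval k x p * mp_eval k x q"
    by (simp flip: mp_sum_single mp_eval_sum)
  finally show ?thesis .
qed

lemma mp_eval_hom: "comm_ring_hom (mp_eval k x)"
  by unfold_locales (auto simp: mp_eval_0 mp_eval_1 mp_eval_add mp_eval_mult)

lemma mp_eval_minus: "mp_eval k x (p - q) = mp_eval k x p - mp_eval k x q"
proof -
  interpret comm_ring_hom "mp_eval k x" by (rule mp_eval_hom)
  show ?thesis by (rule hom_minus)
qed

lemma mp_eval_power: "mp_eval k x (p ^ n) = mp_eval k x p ^ n"
  by (induction n) (auto simp: mp_eval_1 mp_eval_mult)

lemma mp_eval_prod: "mp_eval k x (prod f S) = (\<Prod>i\<in>S. mp_eval k x (f i))"
  by (induction S rule: infinite_finite_induct) (auto simp: mp_eval_1 mp_eval_mult)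

lemmas mp_eval_simps = mp_eval_0 mp_eval_1 mp_eval_add mp_eval_mult mp_eval_minus mp_eval_Const mp_eval_Var mp_eval_sum mp_eval_power mp_eval_prod

end

lemma comm_ring_hom_id: "comm_ring_hom (\<lambda>c. c)"
  by unfold_locales auto

lemma comm_ring_hom_comp: "comm_ring_hom h \<Longrightarrow> comm_ring_hom k \<Longrightarrow> comm_ring_hom (\<lambda>c. h (k c))"
proof -
  assume "comm_ring_hom h" "comm_ring_hom k"
  then interpret h: comm_ring_hom h + k: comm_ring_hom k .
  show ?thesis by unfold_locales (auto simp: h.hom_add k.hom_add h.hom_mult k.hom_mult)
qed

lemma comm_ring_hom_Const: "comm_ring_hom Const"
  by unfold_locales (auto simp: Const_def single_add mult_single)

text \<open>Both sides are homomorphisms in \<open>p\<close> that agree on constants and variables.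
  Changes of the target ring go through this lemma.\<close>

lemma hom_ev:
  assumes k: "comm_ring_hom k" and h: "comm_ring_hom h"
  shows "h (mp_eval k x p) = mp_eval (\<lambda>c. h (k c)) (\<lambda>v. h (x v)) p"
proof -
  interpret h: comm_ring_hom h by (rule h)
  note s1 = mp_eval_simps[OF k] and s2 = mp_eval_simps[OF comm_ring_hom_comp[OF h k]]
  show ?thesis
    by (induction p rule: mp_induct) (simp_all add: s1 s2 h.hom_add h.hom_mult)
qed

abbreviation subst :: "(nat \<Rightarrow> mp) \<Rightarrow> mp \<Rightarrow> mp" where "subst \<equiv> mp_eval Const"

abbreviation ceval :: "(nat \<Rightarrow> complex) \<Rightarrow> mp \<Rightarrow> complex" where "ceval \<equiv> mp_eval (\<lambda>c. c)"

lemmas subst_simps = mp_eval_simps[OF comm_ring_hom_Const]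
lemmas ceval_simps = mp_eval_simps[OF comm_ring_hom_id]

lemma mp_eval_subst:
  assumes k: "comm_ring_hom k"
  shows "mp_eval k x (subst f p) = mp_eval k (\<lambda>v. mp_eval k x (f v)) p"
  by (subst hom_ev[OF comm_ring_hom_Const mp_eval_hom[OF k]]) (simp add: mp_eval_simps[OF k])

lemma subst_Var: "subst Var p = p"
  by (induction p rule: mp_induct) (simp_all add: subst_simps)

lemma const_poly_hom: "comm_ring_hom (\<lambda>c. [:c::'a::comm_ring_1:])"
  by unfold_locales (auto simp: one_pCons)

lemma poly_eval_hom: "comm_ring_hom (\<lambda>p. poly p (c::'a::comm_ring_1))"
  by unfold_locales auto

text \<open>On the line through the origin and \<open>x\<close> the polynomial becomes univariate
  without a root, hence constant by the fundamental theorem of algebra; so its values at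
  \<open>x\<close> and at the origin agree.\<close>

lemma nonvanishing_imp_Const:
  assumes "\<And>x. ceval x p \<noteq> 0"
  shows "p = Const (ceval (\<lambda>_. 0) p)"
proof -
  have "ceval x p = ceval (\<lambda>_. 0) p" for x
  proof -
    define q where "q = mp_eval (\<lambda>c. [:c:]) (\<lambda>v. [:0, x v:]) p"
    have q: "poly q t = ceval (\<lambda>v. t * x v) p" for t
      unfolding q_def by (subst hom_ev[OF const_poly_hom poly_eval_hom]) simp
    have "constant (poly q)"
      using fundamental_theorem_of_algebra[of q] assms by (auto simp: q)
    then have "poly q 1 = poly q 0" by (simp add: constant_def)
    then show ?thesis by (simp add: q)
  qed
  then have "p - Const (ceval (\<lambda>_. 0) p) = 0"
    by (intro mp_eval_eq_0_imp) (simp add: ceval_simps)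
  then show ?thesis by simp
qed

subsection \<open>Polynomial monomorphisms and Newton iteration\<close>

text \<open>The variables \<open>2v\<close> and \<open>2v + 1\<close> stand for the \<open>v\<close>-th coordinates of two points \<open>x\<close> and \<open>x'\<close>.\<close>

definition pair :: "(nat \<Rightarrow> 'a) \<Rightarrow> (nat \<Rightarrow> 'a) \<Rightarrow> nat \<Rightarrow> 'a" where
  "pair x x' v = (if even v then x (v div 2) else x' (v div 2))"

lemma pair_even [simp]: "pair x x' (2 * v) = x v"
  and pair_odd [simp]: "pair x x' (Suc (2 * v)) = x' v"
  by (simp_all add: pair_def)

lemma comp_pair: "(\<lambda>v. h (pair x x' v)) = pair (\<lambda>v. h (x v)) (\<lambda>v. h (x' v))"
  by (auto simp: pair_def)

lemma fps_const_hom: "comm_ring_hom k \<Longrightarrow> comm_ring_hom (\<lambda>c. fps_const (k c))"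
proof -
  assume "comm_ring_hom k"
  then interpret comm_ring_hom k .
  show ?thesis by unfold_locales (auto simp: hom_add hom_mult simp flip: fps_const_add fps_const_mult)
qed

lemma fps_nth_0_hom: "comm_ring_hom (\<lambda>f. fps_nth (f::'a::comm_ring_1 fps) 0)"
  by unfold_locales auto

lemma fps_of_poly_hom: "comm_ring_hom (fps_of_poly :: 'a::comm_ring_1 poly \<Rightarrow> 'a fps)"
  by unfold_locales (auto simp: fps_of_poly_add fps_of_poly_mult)

text \<open>Divisibility by \<open>t ^ n\<close>, used for congruences between power series.\<close>

definition low_zero :: "nat \<Rightarrow> 'a::comm_ring_1 fps \<Rightarrow> bool" where
  "low_zero n f \<longleftrightarrow> (\<forall>j<n. fps_nth f j = 0)"

lemma low_zero_mult: "low_zero n g \<Longrightarrow> low_zero n (f * g)"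
  by (auto simp: low_zero_def fps_mult_nth intro!: sum.neutral)

lemma low_zero_sum: "(\<And>i. i \<in> S \<Longrightarrow> low_zero n (f i)) \<Longrightarrow> low_zero n (\<Sum>i\<in>S. f i)"
  by (auto simp: low_zero_def fps_sum_nth intro!: sum.neutral)

text \<open>In lowest order a factor acts through its constant term only. In the Newton step this
  replaces the Jacobian along the iteration by the one at the start.\<close>

lemma low_zero_mult_nth: "low_zero n g \<Longrightarrow> fps_nth (f * g) n = fps_nth f 0 * fps_nth g n"
proof -
  assume "low_zero n g"
  then have "fps_nth (f * g) n = (\<Sum>i\<in>{0}. fps_nth f i * fps_nth g (n - i))"
    unfolding fps_mult_nth by (intro sum.mono_neutral_right) (auto simp: low_zero_def)
  then show ?thesis by simp
qed

text \<open>\<open>F\<close> fixes all variables outside the finite set \<open>I\<close>; this avoids any bookkeeping of the variables that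
  occur in a polynomial.\<close>

locale poly_mono =
  fixes I :: "nat set" and F :: "nat \<Rightarrow> mp" and J N :: "nat \<Rightarrow> nat \<Rightarrow> mp"
  assumes fin: "finite I"
    and F_out: "\<And>v. v \<notin> I \<Longrightarrow> F v = Var v"
    and J_diff: "\<And>b. b \<in> I \<Longrightarrow> subst (\<lambda>v. Var (2 * v)) (F b) - subst (\<lambda>v. Var (Suc (2 * v))) (F b)
                    = (\<Sum>a\<in>I. J b a * (Var (2 * a) - Var (Suc (2 * a))))"
    and NJ: "\<And>a c. a \<in> I \<Longrightarrow> c \<in> I \<Longrightarrow> (\<Sum>b\<in>I. N a b * J b c) = (if a = c then 1 else 0)"
    and JN: "\<And>a c. a \<in> I \<Longrightarrow> c \<in> I \<Longrightarrow> (\<Sum>b\<in>I. J a b * N b c) = (if a = c then 1 else 0)"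
begin

text \<open>Multiply \<open>J_diff\<close> by the inverse matrix \<open>N\<close>. The coordinate
  differences thus lie in the ideal of the differences of \<open>F\<close>, an identity that
  transfers to every commutative algebra.\<close>

lemma N_diff:
  assumes "a \<in> I"
  shows "Var (2 * a) - Var (Suc (2 * a)) = (\<Sum>b\<in>I. N a b *
    (subst (\<lambda>v. Var (2 * v)) (F b) - subst (\<lambda>v. Var (Suc (2 * v))) (F b)))"
proof -
  let ?d = "\<lambda>c. Var (2 * c) - Var (Suc (2 * c))"
  have "(\<Sum>b\<in>I. N a b * (subst (\<lambda>v. Var (2 * v)) (F b) - subst (\<lambda>v. Var (Suc (2 * v))) (F b)))
      = (\<Sum>b\<in>I. \<Sum>c\<in>I. N a b * J b c * ?d c)"
    by (intro sum.cong refl) (simp add: J_diff sum_distrib_left mult.assoc)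
  also have "\<dots> = (\<Sum>c\<in>I. (\<Sum>b\<in>I. N a b * J b c) * ?d c)"
    by (subst sum.swap) (simp add: sum_distrib_right)
  also have "\<dots> = (\<Sum>c\<in>I. (if a = c then ?d c else 0))"
    by (intro sum.cong refl) (simp add: NJ assms)
  also have "\<dots> = ?d a" using assms fin by simp
  finally show ?thesis by simp
qed

lemma mp_eval_even: "comm_ring_hom k \<Longrightarrow> mp_eval k (pair x x') (subst (\<lambda>v. Var (2 * v)) p) = mp_eval k x p"
  by (simp add: mp_eval_subst mp_eval_simps)

lemma mp_eval_odd: "comm_ring_hom k \<Longrightarrow> mp_eval k (pair x x') (subst (\<lambda>v. Var (Suc (2 * v))) p) = mp_eval k x' p"
  by (simp add: mp_eval_subst mp_eval_simps)

lemma mp_eval_J_diff: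
  assumes k: "comm_ring_hom k" and b: "b \<in> I"
  shows "mp_eval k x (F b) - mp_eval k x' (F b) = (\<Sum>a\<in>I. mp_eval k (pair x x') (J b a) * (x a - x' a))"
  using arg_cong[OF J_diff[OF b], of "mp_eval k (pair x x')"]
  by (simp add: mp_eval_simps[OF k] mp_eval_even[OF k] mp_eval_odd[OF k])

text \<open>The Newton iteration that keeps the matrix \<open>N(z, z)\<close>, inverse to the
  Jacobian at \<open>z\<close>, gains one power of \<open>t\<close> per step; its limit lifts the
  formal curve \<open>Y\<close> to a curve through \<open>z\<close>.\<close>

lemma newton:
  fixes k :: "complex \<Rightarrow> 'a::comm_ring_1" and z :: "nat \<Rightarrow> 'a" and Y :: "nat \<Rightarrow> 'a fps"
  assumes k: "comm_ring_hom k" and Y0: "\<And>v. fps_nth (Y v) 0 = mp_eval k z (F v)"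
  shows "\<exists>X. (\<forall>v. fps_nth (X v) 0 = z v) \<and> (\<forall>v. mp_eval (\<lambda>c. fps_const (k c)) X (F v) = Y v)"
proof -
  define K where "K = (\<lambda>c. fps_const (k c))"
  have K: "comm_ring_hom K" unfolding K_def by (rule fps_const_hom[OF k])
  have ev0: "fps_nth (mp_eval K x p) 0 = mp_eval k (\<lambda>v. fps_nth (x v) 0) p" for x p
    by (subst hom_ev[OF K fps_nth_0_hom]) (simp add: K_def)
  \<comment> \<open>Outside \<open>I\<close> the map is the identity, so there the lift has to be
    \<open>Y\<close> itself.\<close>
  define Z where "Z = rec_nat (\<lambda>a. if a \<in> I then fps_const (z a) else Y a)
     (\<lambda>_ Zn a. if a \<in> I then Zn a + (\<Sum>b\<in>I. fps_const (mp_eval k (pair z z) (N a b)) * (Y b - mp_eval K Zn (F b)))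
              else Y a)"
  have Z0: "Z 0 = (\<lambda>a. if a \<in> I then fps_const (z a) else Y a)"
    and ZS: "Z (Suc n) = (\<lambda>a. if a \<in> I then Z n a + (\<Sum>b\<in>I. fps_const (mp_eval k (pair z z) (N a b)) * (Y b - mp_eval K (Z n) (F b)))
              else Y a)" for n
    unfolding Z_def by simp_all
  \<comment> \<open>The defect of the \<open>n\<close>-th iterate, shown below to be divisible by
    \<open>t ^ (n + 1)\<close>.\<close>
  define d where "d n b = Y b - mp_eval K (Z n) (F b)" for n b
  have Y0': "fps_nth (Y v) 0 = z v" if "v \<notin> I" for v
    using Y0[of v] that by (simp add: F_out mp_eval_simps[OF k])
  have step: "low_zero (Suc n) (Z (Suc n) a - Z n a)" if "\<And>b. b \<in> I \<Longrightarrow> low_zero (Suc n) (d n b)" for n a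
  proof (cases "a \<in> I")
    case True
    then have "Z (Suc n) a - Z n a = (\<Sum>b\<in>I. fps_const (mp_eval k (pair z z) (N a b)) * d n b)"
      by (simp add: ZS d_def)
    then show ?thesis using that by (auto intro!: low_zero_sum low_zero_mult)
  next
    case False
    then have "Z (Suc n) a = Z n a" by (cases n) (auto simp: ZS Z0)
    then show ?thesis by (simp add: low_zero_def)
  qed
  have Zz: "fps_nth (Z n a) 0 = z a" if "\<And>m b. m < n \<Longrightarrow> b \<in> I \<Longrightarrow> low_zero (Suc m) (d m b)" for n a
    using that
  proof (induction n)
    case 0
    then show ?case by (simp add: Z0 Y0')
  next
    case (Suc n)
    have "low_zero (Suc n) (Z (Suc n) a - Z n a)" using Suc.prems by (intro step) auto
    then show ?case using Suc.IH Suc.prems by (auto simp: low_zero_def)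
  qed
  have d: "low_zero (Suc n) (d n b)" if "b \<in> I" for n b
    using that
  proof (induction n arbitrary: b rule: less_induct)
    case (less n)
    show ?case
    proof (cases n)
      case 0
      have "mp_eval k (\<lambda>v. fps_nth (Z 0 v) 0) (F b) = mp_eval k z (F b)"
        by (subst Zz) auto
      then show ?thesis using 0 by (simp add: low_zero_def d_def ev0 Y0)
    next
      case (Suc m)
      have IH: "low_zero (Suc m) (d m b)" if "b \<in> I" for b using less.IH[of m b] Suc that by simp
      have Zm: "fps_nth (Z m a) 0 = z a" and Zn: "fps_nth (Z n a) 0 = z a" for a
        using less.IH Suc by (auto intro!: Zz)
      have st: "low_zero (Suc m) (Z n a - Z m a)" for a unfolding Suc by (rule step[OF IH])
      have J0: "fps_nth (mp_eval K (pair (Z n) (Z m)) p) 0 = mp_eval k (pair z z) p" for p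
        unfolding ev0 by (simp add: comp_pair[of "\<lambda>f. fps_nth f 0"] Zm Zn)
      have dd: "d n b = d m b - (\<Sum>a\<in>I. mp_eval K (pair (Z n) (Z m)) (J b a) * (Z n a - Z m a))"
        using mp_eval_J_diff[OF K less.prems(1), of "Z n" "Z m"] by (simp add: d_def algebra_simps)
      have "low_zero (Suc m) (\<Sum>a\<in>I. mp_eval K (pair (Z n) (Z m)) (J b a) * (Z n a - Z m a))"
        using st Suc by (auto intro!: low_zero_sum low_zero_mult)
      then have 1: "low_zero (Suc m) (d n b)" using IH[OF less.prems(1)] dd by (auto simp: low_zero_def)
      \<comment> \<open>In order \<open>m + 1\<close> only \<open>J(z, z)\<close> is visible, and
        the correction was \<open>N(z, z)\<close> applied to the defect; by \<open>JN\<close> the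
        leading coefficient cancels.\<close>
      have "fps_nth (\<Sum>a\<in>I. mp_eval K (pair (Z n) (Z m)) (J b a) * (Z n a - Z m a)) (Suc m)
         = (\<Sum>a\<in>I. mp_eval k (pair z z) (J b a) * fps_nth (Z n a - Z m a) (Suc m))"
        by (simp add: fps_sum_nth low_zero_mult_nth[OF st] J0 del: fps_sub_nth)
      also have "\<dots> = (\<Sum>a\<in>I. \<Sum>c\<in>I. mp_eval k (pair z z) (J b a * N a c) * fps_nth (d m c) (Suc m))"
      proof (intro sum.cong refl)
        fix a assume "a \<in> I"
        then have "Z n a - Z m a = (\<Sum>c\<in>I. fps_const (mp_eval k (pair z z) (N a c)) * d m c)"
          by (simp add: ZS Suc d_def)
        then show "mp_eval k (pair z z) (J b a) * fps_nth (Z n a - Z m a) (Suc m)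
          = (\<Sum>c\<in>I. mp_eval k (pair z z) (J b a * N a c) * fps_nth (d m c) (Suc m))"
          by (simp add: fps_sum_nth sum_distrib_left mp_eval_simps[OF k] mult.assoc)
      qed
      also have "\<dots> = (\<Sum>c\<in>I. mp_eval k (pair z z) (\<Sum>a\<in>I. J b a * N a c) * fps_nth (d m c) (Suc m))"
        by (subst sum.swap) (simp add: mp_eval_simps[OF k] sum_distrib_right)
      also have "\<dots> = (\<Sum>c\<in>I. if b = c then fps_nth (d m c) (Suc m) else 0)"
        by (intro sum.cong refl) (simp add: JN less.prems mp_eval_simps[OF k])
      also have "\<dots> = fps_nth (d m b) (Suc m)" using less.prems fin by simp
      finally have "fps_nth (d n b) (Suc m) = 0" by (simp add: dd)
      then show ?thesis using 1 Suc by (auto simp: low_zero_def less_Suc_eq)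
    qed
  qed
  \<comment> \<open>Coefficient \<open>j\<close> no longer changes from the \<open>j\<close>-th
    iterate on, so the diagonal is the limit.\<close>
  define X where "X a = Abs_fps (\<lambda>j. fps_nth (Z j a) j)" for a
  have stable: "fps_nth (Z n a) j = fps_nth (Z j a) j" if "j \<le> n" for j n a
    using that
  proof (induction n)
    case (Suc n)
    show ?case
    proof (cases "j = Suc n")
      case False
      then have "fps_nth (Z (Suc n) a - Z n a) j = 0"
        using step[OF d, of n a] Suc.prems unfolding low_zero_def by (metis le_neq_implies_less)
      then show ?thesis using Suc False by auto
    qed auto
  qed auto
  have XZ: "low_zero (Suc n) (X a - Z n a)" for n a
    using stable[of _ n a] by (simp add: low_zero_def X_def less_Suc_eq_le)
  have "mp_eval K X (F b) = Y b" for b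
  proof (cases "b \<in> I")
    case True
    show ?thesis
    proof (rule fps_ext)
      fix n
      have "low_zero (Suc n) (mp_eval K X (F b) - mp_eval K (Z n) (F b))"
        unfolding mp_eval_J_diff[OF K True] using XZ by (auto intro!: low_zero_sum low_zero_mult)
      with d[OF True, of n] show "fps_nth (mp_eval K X (F b)) n = fps_nth (Y b) n"
        by (auto simp: low_zero_def d_def)
    qed
  next
    case False
    have "Z n b = Y b" for n using False by (cases n) (auto simp: Z0 ZS)
    then show ?thesis using False by (simp add: F_out mp_eval_simps[OF K]) (simp add: X_def fps_eq_iff)
  qed
  moreover have "fps_nth (X v) 0 = z v" for v
    using Zz[of 0 v] by (simp add: X_def)
  ultimately show ?thesis unfolding K_def by blast
qed

text \<open>Lift the segment from \<open>F(0)\<close> to an arbitrary \<open>y\<close> to a formal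
  curve. On the segment \<open>p\<close> equals \<open>subst F p\<close> along the lift, so it is
  the zero polynomial in \<open>t\<close>, and \<open>t = 1\<close> gives \<open>p\<close> at
  \<open>y\<close>.\<close>

lemma subst_F_inj:
  assumes "subst F p = 0"
  shows "p = 0"
proof (rule mp_eval_eq_0_imp)
  fix y
  define c where "c v = ceval (\<lambda>_. 0) (F v)" for v
  define Y where "Y v = [:c v, y v - c v:]" for v
  obtain X where X: "\<And>v. mp_eval (\<lambda>c. fps_const c) X (F v) = fps_of_poly (Y v)"
    using newton[OF comm_ring_hom_id, of "\<lambda>v. fps_of_poly (Y v)" "\<lambda>_. 0"] by (auto simp: Y_def c_def)
  note kc = fps_const_hom[OF comm_ring_hom_id]
  have "fps_of_poly (mp_eval (\<lambda>c. [:c:]) Y p) = mp_eval (\<lambda>c. fps_const c) (\<lambda>v. fps_of_poly (Y v)) p"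
    by (subst hom_ev[OF const_poly_hom fps_of_poly_hom]) (simp add: fps_of_poly_const)
  also have "\<dots> = mp_eval (\<lambda>c. fps_const c) X (subst F p)"
    by (subst mp_eval_subst[OF kc]) (simp add: X)
  also have "\<dots> = 0" by (simp add: assms mp_eval_simps[OF kc])
  finally have "mp_eval (\<lambda>c. [:c:]) Y p = 0" using fps_of_poly_eq_iff[of _ 0] by (metis fps_of_poly_0)
  then have "poly (mp_eval (\<lambda>c. [:c:]) Y p) 1 = 0" by simp
  then show "ceval y p = 0"
    by (subst (asm) hom_ev[OF const_poly_hom poly_eval_hom]) (simp add: Y_def)
qed

text \<open>Zariski density of the image of \<open>F\<close>, a reformulation of the injectivity of
  \<open>subst F\<close>.\<close>

lemma vanish_on_image:
  assumes "\<And>x. ceval (\<lambda>v. ceval x (F v)) p = 0"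
  shows "p = 0"
  by (rule subst_F_inj, rule mp_eval_eq_0_imp) (simp add: mp_eval_subst[OF comm_ring_hom_id] assms)

end

subsection \<open>Rationality of the inverse\<close>

abbreviation to_frac :: "mp \<Rightarrow> mp fract" where "to_frac p \<equiv> Fract p 1"

lemma to_frac_hom: "comm_ring_hom to_frac"
  by unfold_locales (auto simp: One_fract_def Zero_fract_def)

lemma to_frac_const_hom: "comm_ring_hom (\<lambda>c. to_frac (Const c))"
  by (rule comm_ring_hom_comp[OF to_frac_hom comm_ring_hom_Const])

text \<open>Substitution into a polynomial in doubled variables, where the first set of variables acts by
  multiplication after, and the second set by multiplication before, the additive map \<open>\<tau>\<close>.\<close>

definition sandwich :: "(mp fract \<Rightarrow> mp fract) \<Rightarrow> (nat \<Rightarrow> mp fract) \<Rightarrow> mp fract \<Rightarrow> mp \<Rightarrow> mp fract" where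
  "sandwich \<tau> X z p = (\<Sum>m\<in>Poly_Mapping.keys p. to_frac (Const (Poly_Mapping.lookup p m))
     * monomial_eval (pair X (\<lambda>_. 1)) m * \<tau> (monomial_eval (pair (\<lambda>_. 1) X) m * z))"

context
  fixes \<tau> :: "mp fract \<Rightarrow> mp fract" and X :: "nat \<Rightarrow> mp fract"
  assumes add: "\<And>x y. \<tau> (x + y) = \<tau> x + \<tau> y"
    and C_lin: "\<And>c x. \<tau> (to_frac (Const c) * x) = to_frac (Const c) * \<tau> x"
begin

interpretation tc: comm_ring_hom "\<lambda>c. to_frac (Const c)" by (rule to_frac_const_hom)

lemma sandwich_superset:
  assumes "finite S" "Poly_Mapping.keys p \<subseteq> S"
  shows "sandwich \<tau> X z p = (\<Sum>m\<in>S. to_frac (Const (Poly_Mapping.lookup p m))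
     * monomial_eval (pair X (\<lambda>_. 1)) m * \<tau> (monomial_eval (pair (\<lambda>_. 1) X) m * z))"
  unfolding sandwich_def
  by (rule sum.mono_neutral_left[OF assms]) (auto simp: in_keys_iff)

lemma sandwich_add: "sandwich \<tau> X z (p + q) = sandwich \<tau> X z p + sandwich \<tau> X z q"
proof -
  let ?S = "Poly_Mapping.keys p \<union> Poly_Mapping.keys q"
  have fin: "finite ?S" by simp
  have sub: "Poly_Mapping.keys (p + q) \<subseteq> ?S" by (rule Poly_Mapping.keys_add)
  show ?thesis
    unfolding sandwich_superset[OF fin sub] sandwich_superset[OF fin Un_upper1] sandwich_superset[OF fin Un_upper2]
      sum.distrib[symmetric]
    by (intro sum.cong refl) (simp only: lookup_add tc.hom_add ring_distribs)
qed

lemma sandwich_0: "sandwich \<tau> X z 0 = 0" by (simp add: sandwich_def)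

lemma sandwich_single: "sandwich \<tau> X z (Poly_Mapping.single m c)
   = to_frac (Const c) * monomial_eval (pair X (\<lambda>_. 1)) m * \<tau> (monomial_eval (pair (\<lambda>_. 1) X) m * z)"
  by (subst sandwich_superset[of "{m}"]) (auto split: if_splits)

lemma sandwich_sum: "sandwich \<tau> X z (sum f S) = (\<Sum>i\<in>S. sandwich \<tau> X z (f i))"
  by (induction S rule: infinite_finite_induct) (auto simp: sandwich_0 sandwich_add)

lemma sandwich_minus: "sandwich \<tau> X z (p - q) = sandwich \<tau> X z p - sandwich \<tau> X z q"
  using sandwich_add[of z "p - q" q] by simp

lemma sandwich_add_arg: "sandwich \<tau> X (z + z') p = sandwich \<tau> X z p + sandwich \<tau> X z' p"
  unfolding sandwich_def by (simp add: ring_distribs add sum.distrib del: add_rat)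

lemma sandwich_Const: "sandwich \<tau> X z (p * Const c) = to_frac (Const c) * sandwich \<tau> X z p"
proof -
  have "p * Const c = (\<Sum>m\<in>Poly_Mapping.keys p. Poly_Mapping.single m (Poly_Mapping.lookup p m)) * Const c"
    by (simp flip: mp_sum_single)
  also have "\<dots> = (\<Sum>m\<in>Poly_Mapping.keys p. Poly_Mapping.single m (Poly_Mapping.lookup p m * c))"
    by (simp add: sum_distrib_right Const_def mult_single)
  finally show ?thesis
    by (simp only: sandwich_sum sandwich_single tc.hom_mult) (simp only: sandwich_def sum_distrib_left ac_simps)
qed

lemma sandwich_Var_left: "sandwich \<tau> X z (p * Var (2 * v)) = sandwich \<tau> X z p * X v"
proof -
  let ?e = "Poly_Mapping.single (2 * v) (1::nat)"
  have "p * Var (2 * v) = (\<Sum>m\<in>Poly_Mapping.keys p. Poly_Mapping.single m (Poly_Mapping.lookup p m)) * Var (2 * v)"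
    by (simp flip: mp_sum_single)
  also have "\<dots> = (\<Sum>m\<in>Poly_Mapping.keys p. Poly_Mapping.single (m + ?e) (Poly_Mapping.lookup p m))"
    by (simp add: sum_distrib_right Var_def mult_single)
  finally show ?thesis
    by (simp only: sandwich_sum sandwich_single monomial_eval_add monomial_eval_single pair_even pair_odd)
      (simp only: sandwich_def sum_distrib_right, simp only: ac_simps mult_1_right mult_1_left)
qed

lemma sandwich_Var_right: "sandwich \<tau> X z (p * Var (Suc (2 * v))) = sandwich \<tau> X (X v * z) p"
proof -
  let ?e = "Poly_Mapping.single (Suc (2 * v)) (1::nat)"
  have "p * Var (Suc (2 * v)) = (\<Sum>m\<in>Poly_Mapping.keys p. Poly_Mapping.single m (Poly_Mapping.lookup p m)) * Var (Suc (2 * v))"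
    by (simp flip: mp_sum_single)
  also have "\<dots> = (\<Sum>m\<in>Poly_Mapping.keys p. Poly_Mapping.single (m + ?e) (Poly_Mapping.lookup p m))"
    by (simp add: sum_distrib_right Var_def mult_single)
  finally show ?thesis
    by (simp only: sandwich_sum sandwich_single monomial_eval_add monomial_eval_single pair_even pair_odd)
      (simp only: sandwich_def sum_distrib_right ac_simps mult_1_right mult_1_left)
qed

text \<open>A factor in the first variables acts after \<open>\<tau>\<close> and comes out. Keeping
  \<open>p\<close> general lets the product case absorb one factor at a time.\<close>

lemma sandwich_left:
  "sandwich \<tau> X z (p * subst (\<lambda>v. Var (2 * v)) q) = sandwich \<tau> X z p * mp_eval (\<lambda>c. to_frac (Const c)) X q"
proof (induction q arbitrary: p rule: mp_induct)
  case (Const c)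
  then show ?case by (simp only: mp_eval_simps[OF to_frac_const_hom] subst_simps sandwich_Const mult.commute)
next
  case (Var v)
  then show ?case by (simp only: mp_eval_simps[OF to_frac_const_hom] subst_simps sandwich_Var_left)
next
  case (add q r)
  then show ?case by (simp only: mp_eval_simps[OF to_frac_const_hom] subst_simps sandwich_add ring_distribs)
next
  case (mult q r)
  then show ?case by (simp only: mp_eval_simps[OF to_frac_const_hom] subst_simps mult.assoc[symmetric])
qed

lemma sandwich_scale_arg: "sandwich \<tau> X (to_frac (Const c) * z) p = to_frac (Const c) * sandwich \<tau> X z p"
proof -
  have *: "\<tau> (monomial_eval (pair (\<lambda>_. 1) X) m * (to_frac (Const c) * z)) = to_frac (Const c) * \<tau> (monomial_eval (pair (\<lambda>_. 1) X) m * z)" for m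
    by (simp only: C_lin[symmetric] ac_simps)
  show ?thesis unfolding sandwich_def * by (simp only: sum_distrib_left ac_simps)
qed

text \<open>A factor in the second variables acts before \<open>\<tau>\<close>, so it joins the
  argument \<open>z\<close>.\<close>

lemma sandwich_right:
  "sandwich \<tau> X z (p * subst (\<lambda>v. Var (Suc (2 * v))) q) = sandwich \<tau> X (mp_eval (\<lambda>c. to_frac (Const c)) X q * z) p"
proof (induction q arbitrary: p z rule: mp_induct)
  case (Const c)
  then show ?case by (simp only: mp_eval_simps[OF to_frac_const_hom] subst_simps sandwich_Const sandwich_scale_arg)
next
  case (Var v)
  then show ?case by (simp only: mp_eval_simps[OF to_frac_const_hom] subst_simps sandwich_Var_right)
next
  case (add q r)
  then show ?case by (simp only: mp_eval_simps[OF to_frac_const_hom] subst_simps sandwich_add sandwich_add_arg ring_distribs)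
next
  case (mult q r)
  then show ?case by (simp only: mp_eval_simps[OF to_frac_const_hom] subst_simps mult.assoc[symmetric])
qed

end

section \<open>The field endomorphism induced by \<open>F\<close> and its range\<close>

context poly_mono
begin

text \<open>Substitution of \<open>F\<close> in numerator and denominator. Independence of the
  chosen representative is \<open>frac_subst_Fract\<close>, where \<open>subst_F_0_iff\<close> keeps
  denominators nonzero. The range is the field generated by \<open>F\<close> over the
  constants.\<close>

definition frac_subst :: "mp fract \<Rightarrow> mp fract" where
  "frac_subst q = (SOME r. \<exists>a b. b \<noteq> 0 \<and> q = Fract a b \<and> r = Fract (subst F a) (subst F b))"

lemma subst_F_0_iff: "subst F p = 0 \<longleftrightarrow> p = 0"
  using subst_F_inj by (auto simp: subst_simps)

lemma frac_subst_Fract: "b \<noteq> 0 \<Longrightarrow> frac_subst (Fract a b) = Fract (subst F a) (subst F b)"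
  unfolding frac_subst_def
proof (rule some_equality, blast)
  fix r assume b: "b \<noteq> 0" and "\<exists>a' b'. b' \<noteq> 0 \<and> Fract a b = Fract a' b' \<and> r = Fract (subst F a') (subst F b')"
  then obtain a' b' where *: "b' \<noteq> 0" "Fract a b = Fract a' b'" and r: "r = Fract (subst F a') (subst F b')"
    by blast
  from * b have "a * b' = a' * b" by (simp add: eq_fract)
  then have "subst F a * subst F b' = subst F a' * subst F b" by (metis subst_simps(4))
  with * b r show "r = Fract (subst F a) (subst F b)" by (simp add: eq_fract subst_F_0_iff)
qed

lemma frac_subst_add: "frac_subst (x + y) = frac_subst x + frac_subst y"
  by (cases x; cases y) (simp add: frac_subst_Fract subst_F_0_iff subst_simps)

lemma frac_subst_mult: "frac_subst (x * y) = frac_subst x * frac_subst y"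
  by (cases x; cases y) (simp add: frac_subst_Fract subst_F_0_iff subst_simps)

lemma frac_subst_1: "frac_subst 1 = 1"
  by (simp add: One_fract_def frac_subst_Fract subst_simps)

lemma frac_subst_to_frac: "frac_subst (to_frac p) = to_frac (subst F p)"
  by (simp add: frac_subst_Fract subst_simps)

lemma frac_subst_hom: "comm_ring_hom frac_subst"
  using frac_subst_to_frac[of 0]
  by unfold_locales (auto simp: frac_subst_add frac_subst_mult frac_subst_1 Zero_fract_def subst_simps)

text \<open>Otherwise 1 and the variable are independent over the range, and some
  \<open>\<tau>\<close> linear over it sends 1 to 0 and the variable to 1. Sandwiching
  \<open>N_diff\<close> with \<open>\<tau>\<close> gives 0 on the right, where each
  \<open>F b\<close> commutes with \<open>\<tau>\<close>, but -1 on the left.\<close>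

lemma Var_in_image:
  assumes a: "a \<in> I"
  shows "to_frac (Var a) \<in> range frac_subst"
proof (rule ccontr)
  assume nin: "to_frac (Var a) \<notin> range frac_subst"
  interpret fs: comm_ring_hom frac_subst by (rule frac_subst_hom)
  have fs0: "frac_subst x = 0 \<longleftrightarrow> x = 0" for x
    using frac_subst_mult[of x "inverse x"] by (cases "x = 0") (auto simp: frac_subst_1)
  have fs_inv: "frac_subst (inverse x) = inverse (frac_subst x)" for x
    using frac_subst_mult[of x "inverse x"]
    by (cases "x = 0") (auto simp: frac_subst_1 intro: inverse_unique[symmetric])
  \<comment> \<open>Scalars act through \<open>frac_subst\<close>, so linear means linear over the
    range.\<close>
  let ?s = "\<lambda>q z. frac_subst q * z"
  interpret vs: vector_space ?s
    by unfold_locales (auto simp: ring_distribs frac_subst_add frac_subst_mult frac_subst_1)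
  interpret vp: vector_space_pair ?s ?s ..
  have ne: "to_frac (Var a) \<noteq> 1"
    using nin frac_subst_1 by (metis rangeI)
  have "vs.independent {1, to_frac (Var a)}"
  proof -
    have "to_frac (Var a) \<notin> vs.span {1}"
      using nin by (auto simp: vs.span_singleton)
    then show ?thesis
      using vs.independent_insert[of "to_frac (Var a)" "{1}"] ne by (auto simp: insert_commute)
  qed
  from vp.linear_independent_extend[OF this, of "\<lambda>x. if x = 1 then 0 else 1"]
  obtain \<tau> where lin: "Vector_Spaces.linear ?s ?s \<tau>" and "\<forall>x\<in>{1, to_frac (Var a)}. \<tau> x = (if x = 1 then 0 else 1)"
    by blast
  then have \<tau>1: "\<tau> 1 = 0" and \<tau>a: "\<tau> (to_frac (Var a)) = 1" using ne by auto
  interpret \<tau>: Vector_Spaces.linear ?s ?s \<tau> by (rule lin)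
  have add: "\<tau> (x + y) = \<tau> x + \<tau> y" for x y by (rule \<tau>.add)
  have F_lin: "\<tau> (to_frac (subst F p) * x) = to_frac (subst F p) * \<tau> x" for p x
    using \<tau>.scale[of "to_frac p" x] by (simp add: frac_subst_to_frac)
  have C_lin: "\<tau> (to_frac (Const c) * x) = to_frac (Const c) * \<tau> x" for c x
    using F_lin[of "Const c"] by (simp add: subst_simps)
  define X where "X v = to_frac (Var v)" for v
  note sw = sandwich_left[OF add C_lin, of X] sandwich_right[OF add C_lin, of X]
    sandwich_minus[OF add C_lin, of X] sandwich_sum[OF add C_lin, of X]
  have evX: "mp_eval (\<lambda>c. to_frac (Const c)) X p = to_frac p" for p
    using hom_ev[OF comm_ring_hom_Const to_frac_hom, of Var p]
    unfolding X_def[abs_def] by (simp add: subst_Var)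
  have sF: "sandwich \<tau> X (to_frac (F b)) p = sandwich \<tau> X 1 p * to_frac (F b)" for p b
  proof -
    have *: "\<tau> (w * to_frac (F b)) = \<tau> w * to_frac (F b)" for w
      using F_lin[of "Var b" w] by (simp only: subst_simps mult.commute)
    then show ?thesis
      unfolding sandwich_def sum_distrib_right mult_1_right * by (simp only: mult.assoc)
  qed
  let ?d = "\<lambda>p. subst (\<lambda>v. Var (2 * v)) p - subst (\<lambda>v. Var (Suc (2 * v))) p"
  have key: "sandwich \<tau> X 1 (N a b * ?d (F b)) = 0" for b
    unfolding right_diff_distrib sw evX mult_1_right sF by simp
  have "Var (2 * a) - Var (Suc (2 * a)) = (1::mp) * ?d (Var a)" by (simp add: subst_simps)
  then have "sandwich \<tau> X 1 (Var (2 * a) - Var (Suc (2 * a)))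
     = sandwich \<tau> X 1 1 * to_frac (Var a) - sandwich \<tau> X (to_frac (Var a)) 1"
    by (simp only: right_diff_distrib sw evX mult_1_right)
  moreover have "sandwich \<tau> X z 1 = \<tau> z" for z
    using sandwich_single[OF add C_lin, of X z 0 1] by (simp add: Const_def flip: One_fract_def)
  ultimately have "sandwich \<tau> X 1 (Var (2 * a) - Var (Suc (2 * a))) = - 1"
    by (simp add: \<tau>1 \<tau>a)
  moreover have "sandwich \<tau> X 1 (Var (2 * a) - Var (Suc (2 * a))) = 0"
    unfolding N_diff[OF a] sw key by simp
  ultimately show False by simp
qed

text \<open>Each variable in \<open>I\<close> is a quotient of polynomials in \<open>F\<close>; the
  product of the denominators serves all of them, and the other variables are values of
  \<open>F\<close> anyway.\<close>

lemma common_denominator: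
  "\<exists>b \<alpha>. b \<noteq> 0 \<and> (\<forall>v. subst F b * Var v = subst F (\<alpha> v))"
proof -
  have "\<exists>\<beta> \<alpha>. \<beta> \<noteq> 0 \<and> subst F \<beta> * Var v = subst F \<alpha>" if v: "v \<in> I" for v
  proof -
    obtain q where q: "to_frac (Var v) = frac_subst q" using Var_in_image[OF v] by blast
    obtain \<alpha> \<beta> where "q = Fract \<alpha> \<beta>" "\<beta> \<noteq> 0" by (cases q) auto
    with q have "\<beta> \<noteq> 0 \<and> subst F \<beta> * Var v = subst F \<alpha>"
      by (simp add: frac_subst_Fract eq_fract subst_F_0_iff mult.commute)
    then show ?thesis by blast
  qed
  then obtain \<beta> \<alpha> where \<beta>: "\<And>v. v \<in> I \<Longrightarrow> \<beta> v \<noteq> 0" and \<alpha>: "\<And>v. v \<in> I \<Longrightarrow> subst F (\<beta> v) * Var v = subst F (\<alpha> v)"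
    by metis
  define b where "b = (\<Prod>v\<in>I. \<beta> v)"
  have "\<exists>\<alpha>'. subst F b * Var v = subst F \<alpha>'" for v
  proof (cases "v \<in> I")
    case True
    then have "b = \<beta> v * (\<Prod>v\<in>I - {v}. \<beta> v)" unfolding b_def by (simp add: prod.remove fin)
    then have "subst F b * Var v = subst F (\<alpha> v * (\<Prod>v\<in>I - {v}. \<beta> v))"
      by (simp only: subst_simps \<alpha>[OF True, symmetric]) (simp only: ac_simps)
    then show ?thesis by blast
  next
    case False
    then have "subst F b * Var v = subst F (b * Var v)" by (simp add: subst_simps F_out)
    then show ?thesis by blast
  qed
  moreover have "b \<noteq> 0" using \<beta> fin by (simp add: b_def)
  ultimately show ?thesis by metis
qed

end

subsection \<open>Rational power series over a polynomial ring\<close>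

text \<open>Take \<open>h\<close> of least degree among the nonzero elements of the ideal of
  \<open>a\<close> and \<open>b\<close>. By pseudo-division \<open>h\<close> divides scalar
  multiples of \<open>a\<close> and \<open>b\<close>; the quotients are coprime over the fraction
  field of the coefficients, as the nonzero constant \<open>r\<close> witnesses.\<close>

lemma bezout_reduced_pair:
  fixes a b :: "'a::idom poly"
  assumes b: "b \<noteq> 0"
  shows "\<exists>A B u v r. a * B = b * A \<and> B \<noteq> 0 \<and> u * A + v * B = [:r:] \<and> r \<noteq> 0"
proof -
  let ?P = "\<lambda>n. \<exists>u v. u * a + v * b \<noteq> 0 \<and> degree (u * a + v * b) = n"
  have "?P (degree b)" using b by (intro exI[of _ 0] exI[of _ 1]) simp
  then have "?P (LEAST n. ?P n)" by (rule LeastI)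
  then obtain u v where h0: "u * a + v * b \<noteq> 0" and deg: "degree (u * a + v * b) = (LEAST n. ?P n)"
    by blast
  define h where "h = u * a + v * b"
  have min: "x * a + y * b = 0" if "degree (x * a + y * b) < degree h" for x y
    using not_less_Least[of "degree (x * a + y * b)" ?P] that deg unfolding h_def by auto
  have dv: "\<exists>c q. c \<noteq> 0 \<and> Polynomial.smult c (x * a + y * b) = q * h" for x y
  proof -
    let ?f = "x * a + y * b"
    obtain q r where qr: "pseudo_divmod ?f h = (q, r)" by fastforce
    define c where "c = lead_coeff h ^ (Suc (degree ?f) - degree h)"
    have h: "h \<noteq> 0" using h0 by (simp add: h_def)
    from pseudo_divmod[OF h qr] have eq: "Polynomial.smult c ?f = h * q + r" and r: "r = 0 \<or> degree r < degree h"
      unfolding c_def by blast+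
    have "r = (Polynomial.smult c x - q * u) * a + (Polynomial.smult c y - q * v) * b"
      using eq by (simp add: h_def algebra_simps smult_add_right)
    then have "r = 0" using r min by metis
    then have "Polynomial.smult c ?f = q * h" using eq by (simp add: mult.commute)
    moreover have "c \<noteq> 0" using h by (simp add: c_def)
    ultimately show ?thesis by blast
  qed
  obtain c q where c: "c \<noteq> 0" "Polynomial.smult c a = q * h" using dv[of 1 0] by auto
  obtain c' q' where c': "c' \<noteq> 0" "Polynomial.smult c' b = q' * h" using dv[of 0 1] by auto
  have h: "h \<noteq> 0" using h0 by (simp add: h_def)
  have q': "q' \<noteq> 0" using c' b by auto
  have "h * (a * Polynomial.smult c q') = h * (b * Polynomial.smult c' q)"
  proof -
    have "h * (a * Polynomial.smult c q') = (Polynomial.smult c a) * (q' * h)" by (simp add: algebra_simps)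
    also have "\<dots> = (q * h) * (Polynomial.smult c' b)" using c c' by simp
    also have "\<dots> = h * (b * Polynomial.smult c' q)" by (simp add: algebra_simps)
    finally show ?thesis .
  qed
  then have "a * Polynomial.smult c q' = b * Polynomial.smult c' q"
    by (rule iffD1[OF mult_left_cancel[OF h]])
  moreover have "u * Polynomial.smult c' q + v * Polynomial.smult c q' = [:c * c':]"
  proof -
    have "h * (u * Polynomial.smult c' q + v * Polynomial.smult c q') = Polynomial.smult c' (u * (q * h)) + Polynomial.smult c (v * (q' * h))"
      by (simp add: algebra_simps)
    also have "\<dots> = Polynomial.smult (c * c') h"
      unfolding c(2)[symmetric] c'(2)[symmetric] by (simp add: h_def smult_add_right mult.commute)
    also have "\<dots> = h * [:c * c':]" by simp
    finally show ?thesis by (rule iffD1[OF mult_left_cancel[OF h]])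
  qed
  moreover have "Polynomial.smult c q' \<noteq> 0" "c * c' \<noteq> 0" using c c' q' by auto
  ultimately show ?thesis by blast
qed

text \<open>The outer variable is \<open>t\<close>, the coefficients are polynomials in
  \<open>s\<close>; this specialises \<open>s\<close>.\<close>

definition eval_coeffs :: "complex \<Rightarrow> complex poly poly \<Rightarrow> complex poly" where
  "eval_coeffs s = map_poly (\<lambda>p. poly p s)"

lemma coeff_eval_coeffs: "coeff (eval_coeffs s p) n = poly (coeff p n) s"
  by (simp add: eval_coeffs_def coeff_map_poly)

lemma eval_coeffs_hom: "comm_ring_hom (eval_coeffs s)"
  by unfold_locales (auto simp: poly_eq_iff coeff_eval_coeffs coeff_mult poly_sum)

lemma eval_coeffs_pCons: "eval_coeffs s (pCons a p) = pCons (poly a s) (eval_coeffs s p)"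
  by (simp add: poly_eq_iff coeff_eval_coeffs coeff_pCons split: nat.split)

lemma eval_coeffs_0: "eval_coeffs s 0 = 0"
  by (simp add: poly_eq_iff coeff_eval_coeffs)

lemma poly_eval_coeffs: "poly (eval_coeffs s p) t = poly (poly p [:t:]) s"
  by (induction p) (simp_all add: eval_coeffs_pCons eval_coeffs_0)

lemma degree_eval_coeffs_le: "degree (eval_coeffs s p) \<le> degree p"
  by (rule degree_le) (auto simp: coeff_eval_coeffs coeff_eq_0)

lemma degree_eval_coeffs_eq: "poly (lead_coeff p) s \<noteq> 0 \<Longrightarrow> degree (eval_coeffs s p) = degree p"
  by (intro antisym degree_eval_coeffs_le le_degree) (simp add: coeff_eval_coeffs)

lemma eval_coeffs_eq_0_imp:
  assumes "eval_coeffs s p = 0"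
  shows "\<exists>p'. p = Polynomial.smult [:- s, 1:] p'"
proof -
  have "poly (coeff p n) s = 0" for n using assms by (metis coeff_eval_coeffs coeff_0)
  then have "[:[:- s, 1:]:] dvd p" by (simp add: const_poly_dvd_iff poly_eq_0_iff_dvd)
  then show ?thesis by (auto simp: dvd_def)
qed

text \<open>Among all pairs choose one whose \<open>r\<close> has least degree in \<open>s\<close>.
  If \<open>A\<close> and \<open>B\<close> both vanished at some \<open>s\<close>, the common linear
  factor would divide \<open>r\<close> too, and cancelling it would lower the degree.\<close>

lemma bezout_reduced_pair_complex:
  fixes a b :: "complex poly poly"
  assumes b: "b \<noteq> 0"
  shows "\<exists>A B u v r. a * B = b * A \<and> B \<noteq> 0 \<and> u * A + v * B = [:r:] \<and> r \<noteq> 0 \<and>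
     (\<forall>s. eval_coeffs s A \<noteq> 0 \<or> eval_coeffs s B \<noteq> 0)"
proof -
  let ?Q = "\<lambda>A B u v r. a * B = b * A \<and> B \<noteq> 0 \<and> u * A + v * B = [:r:] \<and> r \<noteq> 0"
  let ?P = "\<lambda>n. \<exists>A B u v r. ?Q A B u v r \<and> degree r = n"
  have "\<exists>n. ?P n" using bezout_reduced_pair[OF b, of a] by metis
  then have "?P (LEAST n. ?P n)" by (rule LeastI_ex)
  then obtain A B u v r where Q: "?Q A B u v r" and d: "degree r = (LEAST n. ?P n)" by blast
  have "eval_coeffs s A \<noteq> 0 \<or> eval_coeffs s B \<noteq> 0" for s
  proof (rule ccontr)
    let ?m = "[:- s, 1:]"
    assume "\<not> ?thesis"
    then obtain A' B' where A': "A = Polynomial.smult ?m A'" and B': "B = Polynomial.smult ?m B'"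
      using eval_coeffs_eq_0_imp by metis
    have "Polynomial.smult ?m (a * B') = Polynomial.smult ?m (b * A')" using Q by (simp add: A' B' del: smult_pCons)
    then have "Polynomial.smult ?m (a * B' - b * A') = 0" by (simp only: smult_diff_right right_minus_eq)
    then have 1: "a * B' = b * A'" by (simp only: smult_eq_0_iff) simp
    have 2: "Polynomial.smult ?m (u * A' + v * B') = [:r:]"
      using Q by (simp add: A' B' smult_add_right del: smult_pCons)
    have 0: "coeff (u * A' + v * B') (Suc n) = 0" for n
    proof -
      have "?m * coeff (u * A' + v * B') (Suc n) = coeff [:r:] (Suc n)"
        unfolding 2[symmetric] by (simp only: coeff_smult)
      then have "?m * coeff (u * A' + v * B') (Suc n) = 0" by (simp only: coeff_pCons_Suc coeff_0)
      then have "?m = 0 \<or> coeff (u * A' + v * B') (Suc n) = 0" by (simp only: mult_eq_0_iff)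
      then show ?thesis by (simp del: coeff_add)
    qed
    have 3: "u * A' + v * B' = [:coeff (u * A' + v * B') 0:]"
    proof (rule poly_eqI)
      fix n
      show "coeff (u * A' + v * B') n = coeff [:coeff (u * A' + v * B') 0:] n"
        by (cases n) (simp_all only: 0 coeff_pCons_0 coeff_pCons_Suc coeff_0)
    qed
    define r' where "r' = coeff (u * A' + v * B') 0"
    have r': "r = ?m * r'" using arg_cong[OF 2, of "\<lambda>p. coeff p 0"] by (simp only: coeff_smult r'_def coeff_pCons_0)
    have "r' \<noteq> 0" using r' Q by auto
    then have "degree r = Suc (degree r')" unfolding r' by (subst degree_mult_eq) auto
    moreover have "?Q A' B' u v r'" using 1 3 Q \<open>r' \<noteq> 0\<close> by (auto simp: B' r'_def)
    then have "(LEAST n. ?P n) \<le> degree r'" by (intro Least_le) blast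
    ultimately show False using d by simp
  qed
  then show ?thesis using Q by blast
qed

definition fps_map :: "('a \<Rightarrow> 'b) \<Rightarrow> 'a fps \<Rightarrow> 'b fps" where
  "fps_map h f = Abs_fps (\<lambda>n. h (fps_nth f n))"

lemma fps_map_nth [simp]: "fps_nth (fps_map h f) n = h (fps_nth f n)"
  by (simp add: fps_map_def)

lemma fps_map_hom: "comm_ring_hom h \<Longrightarrow> comm_ring_hom (fps_map h)"
proof -
  assume "comm_ring_hom h"
  then interpret comm_ring_hom h .
  show ?thesis by unfold_locales (auto simp: fps_eq_iff fps_mult_nth hom_add hom_mult hom_sum)
qed

text \<open>The Bezout identity turns \<open>B f = A\<close> into \<open>B g = r\<close>, from which the roots of \<open>r\<close> are cancelled one by
  one.\<close>

lemma fatou_denominator: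
  fixes A B u v :: "complex poly poly" and f :: "complex poly fps"
  assumes bez: "u * A + v * B = [:r:]" "r \<noteq> 0" and cop: "eval_coeffs s A \<noteq> 0 \<or> eval_coeffs s B \<noteq> 0"
    and f: "fps_of_poly B * f = fps_of_poly A"
  shows "poly (coeff B 0) s \<noteq> 0"
proof
  assume B0: "poly (coeff B 0) s = 0"
  define E where "E = fps_map (\<lambda>p. poly p s)"
  interpret E: comm_ring_hom E unfolding E_def by (rule fps_map_hom[OF poly_eval_hom])
  have Eof: "E (fps_of_poly p) = fps_of_poly (eval_coeffs s p)" for p
    by (simp add: E_def fps_eq_iff coeff_eval_coeffs)
  have "E (fps_of_poly B) * E f = E (fps_of_poly A)" by (simp only: f flip: E.hom_mult)
  then have EB: "eval_coeffs s B \<noteq> 0" using cop unfolding Eof by auto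
  \<comment> \<open>At \<open>s\<close> the constant term of \<open>B\<close> is zero, so
    \<open>r\<close> vanishes there; as \<open>B\<close> itself does not vanish at \<open>s\<close>,
    \<open>g\<close> does. Cancelling the linear factor from \<open>r\<close> and \<open>g\<close>
    lowers the degree of \<open>r\<close>, and this descent cannot go on forever.\<close>
  have contra: False if "fps_of_poly B * g = fps_const r" "r \<noteq> 0" for g r
    using that
  proof (induction "degree r" arbitrary: g r rule: less_induct)
    case (less r g)
    have Eg: "fps_of_poly (eval_coeffs s B) * E g = fps_const (poly r s)"
      using arg_cong[OF less.prems(1), of E] by (simp add: E.hom_mult Eof) (simp add: E_def fps_eq_iff)
    have "poly r s = 0"
      using arg_cong[OF Eg, of "\<lambda>f. fps_nth f 0"] by (simp add: coeff_eval_coeffs B0)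
    then obtain r' where r': "r = [:- s, 1:] * r'" by (auto simp: poly_eq_0_iff_dvd)
    have "E g = 0" using Eg EB \<open>poly r s = 0\<close> by simp
    then have "\<forall>n. \<exists>c. fps_nth g n = [:- s, 1:] * c"
      by (auto simp: E_def fps_eq_iff poly_eq_0_iff_dvd dvd_def)
    then obtain c where c: "\<And>n. fps_nth g n = [:- s, 1:] * c n" by metis
    have g: "g = fps_const [:- s, 1:] * Abs_fps c" by (rule fps_ext) (simp only: c fps_mult_left_const_nth fps_nth_Abs_fps)
    have "fps_const [:- s, 1:] * (fps_of_poly B * Abs_fps c) = fps_const [:- s, 1:] * fps_const r'"
      using less.prems(1) unfolding g r' by (simp only: fps_const_mult[symmetric] ac_simps)
    moreover have "fps_const [:- s, 1:] \<noteq> 0" by simp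
    ultimately have "fps_of_poly B * Abs_fps c = fps_const r'"
      by (metis mult_left_cancel)
    moreover have "r' \<noteq> 0" using r' less.prems(2) by auto
    moreover from this have "degree r' < degree r" unfolding r' by (subst degree_mult_eq) auto
    ultimately show False using less.hyps by blast
  qed
  have "fps_of_poly B * (fps_of_poly u * f + fps_of_poly v) = fps_of_poly u * (fps_of_poly B * f) + fps_of_poly B * fps_of_poly v"
    by (simp add: algebra_simps)
  also have "\<dots> = fps_of_poly (u * A + v * B)" by (simp add: f fps_of_poly_add fps_of_poly_mult)
  also have "\<dots> = fps_const r" by (simp add: bez fps_of_poly_const)
  finally show False using contra bez(2) by blast
qed

lemma nonvanishing_poly_const:
  assumes "\<And>s. poly (q :: complex poly) s \<noteq> 0"
  shows "\<exists>c. c \<noteq> 0 \<and> q = [:c:]"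
proof -
  have "degree q = 0" using fundamental_theorem_of_algebra[of q] constant_degree[of q] assms by blast
  then obtain c where "q = [:c:]" by (auto elim: degree_eq_zeroE)
  then show ?thesis using assms[of 0] by auto
qed

subsection \<open>The reduced denominator along lines\<close>

text \<open>The Bezout identity exhibits the cofactor: it is \<open>u * A2 + v * B2\<close> divided
  by \<open>r\<close>.\<close>

lemma reduced_pair_unique:
  fixes a b A B :: "'a::field poly"
  assumes AB: "a * B = b * A" and nz: "b \<noteq> 0" "B \<noteq> 0" and bez: "u * A + v * B = [:r:]" "r \<noteq> 0"
    and AB2: "a * B2 = b * A2" "B2 \<noteq> 0"
  shows "\<exists>k. k \<noteq> 0 \<and> A2 = A * k \<and> B2 = B * k"
proof -
  have "b * (A * B2) = b * (A2 * B)"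
    using AB AB2(1) by (metis mult.assoc mult.commute)
  then have e: "A * B2 = A2 * B" using nz(1) by (metis mult_left_cancel)
  define k where "k = Polynomial.smult (1 / r) (u * A2 + v * B2)"
  have "B * (u * A2 + v * B2) = u * (A2 * B) + v * B * B2" by (simp add: algebra_simps)
  also have "\<dots> = (u * A + v * B) * B2" unfolding e[symmetric] by (simp add: algebra_simps)
  also have "\<dots> = Polynomial.smult r B2" by (simp add: bez)
  finally have B2: "B2 = B * k" using bez(2) by (simp add: k_def)
  have "B * A2 = B * (A * k)" using e unfolding B2 by (metis mult.assoc mult.commute)
  then have "A2 = A * k" using nz(2) by (metis mult_left_cancel)
  with B2 AB2(2) show ?thesis by auto
qed

lemma max_degree_mult:
  fixes A B k :: "'a::idom poly"
  assumes "B \<noteq> 0" "k \<noteq> 0"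
  shows "max (degree (A * k)) (degree (B * k)) = max (degree A) (degree B) + degree k"
  using assms by (cases "A = 0") (auto simp: degree_mult_eq)

lemma degree_common_factor:
  fixes A B k :: "'a::idom poly"
  assumes "u * (A * k) + v * (B * k) = [:r:]" "r \<noteq> 0"
  shows "degree k = 0"
proof -
  have "(u * A + v * B) * k = [:r:]" using assms(1) by (simp add: algebra_simps)
  moreover from this have "u * A + v * B \<noteq> 0" "k \<noteq> 0" using assms(2) by auto
  ultimately have "degree (u * A + v * B) + degree k = degree [:r:]" by (metis degree_mult_eq)
  then show ?thesis by simp
qed

lemma const_poly_poly_hom: "comm_ring_hom (\<lambda>c. [:[:c::complex:]:])"
  by (rule comm_ring_hom_comp[OF const_poly_hom const_poly_hom])

lemma pcompose_hom: "comm_ring_hom (\<lambda>p. pcompose p (q :: 'a::comm_ring_1 poly))"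
  by unfold_locales (auto simp: pcompose_add pcompose_mult pcompose_1)

text \<open>The bound is uniform over all affine substitutions; it will bound degrees in
  \<open>t\<close> independently of the end point of a segment.\<close>

lemma mp_eval_degree_bound:
  "\<exists>d. \<forall>x. (\<forall>v. degree (x v) \<le> 1) \<longrightarrow> degree (mp_eval (\<lambda>c. [:c:]) x p) \<le> d"
proof (induction p rule: mp_induct)
  case (Const c)
  then show ?case by (simp add: mp_eval_simps[OF const_poly_hom])
next
  case (Var v)
  then show ?case by (auto simp: mp_eval_simps[OF const_poly_hom])
next
  case (add p q)
  then obtain d e where "\<forall>x. (\<forall>v. degree (x v) \<le> 1) \<longrightarrow> degree (mp_eval (\<lambda>c. [:c:]) x p) \<le> d"
    "\<forall>x. (\<forall>v. degree (x v) \<le> 1) \<longrightarrow> degree (mp_eval (\<lambda>c. [:c:]) x q) \<le> e" by blast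
  then show ?case
    by (intro exI[of _ "d + e"])
      (auto simp: mp_eval_simps[OF const_poly_hom] intro!: degree_add_le intro: trans_le_add1 trans_le_add2)
next
  case (mult p q)
  then obtain d e where "\<forall>x. (\<forall>v. degree (x v) \<le> 1) \<longrightarrow> degree (mp_eval (\<lambda>c. [:c:]) x p) \<le> d"
    "\<forall>x. (\<forall>v. degree (x v) \<le> 1) \<longrightarrow> degree (mp_eval (\<lambda>c. [:c:]) x q) \<le> e" by blast
  then show ?case
    by (intro exI[of _ "d + e"])
      (auto simp: mp_eval_simps[OF const_poly_hom] intro!: order_trans[OF degree_mult_le] add_mono)
qed

text \<open>The tuple \<open>\<alpha> / b\<close> is a rational left inverse of \<open>F\<close>,
  and \<open>xb\<close> is a base point whose image avoids the zeros of \<open>b\<close>.\<close>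

locale poly_mono_frac = poly_mono +
  fixes b :: mp and \<alpha> :: "nat \<Rightarrow> mp" and xb :: "nat \<Rightarrow> complex"
  assumes den: "\<And>v. subst F b * Var v = subst F (\<alpha> v)"
    and nz: "ceval (\<lambda>v. ceval xb (F v)) b \<noteq> 0"
begin

lemma den_ev:
  assumes k: "comm_ring_hom k"
  shows "mp_eval k (\<lambda>v. mp_eval k x (F v)) b * x l = mp_eval k (\<lambda>v. mp_eval k x (F v)) (\<alpha> l)"
  using arg_cong[OF den[of l], of "mp_eval k x"] by (simp add: mp_eval_simps[OF k] mp_eval_subst[OF k])

text \<open>After clearing denominators the claim is a polynomial identity. It holds on the image of
  \<open>F\<close>, where \<open>\<alpha> / b\<close> recovers the point, hence everywhere by
  density.\<close>

lemma inverse_on_dense: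
  assumes y: "ceval y b \<noteq> 0"
  shows "ceval (\<lambda>v. ceval y (\<alpha> v) / ceval y b) (F w) = y w"
proof -
  have clear: "\<exists>p' e. \<forall>y. ceval y b \<noteq> 0 \<longrightarrow>
      ceval (\<lambda>v. ceval y (\<alpha> v) / ceval y b) p * ceval y b ^ e = ceval y p'" for p
  proof (induction p rule: mp_induct)
    case (Const c)
    have "\<forall>y. ceval y b \<noteq> 0 \<longrightarrow> ceval (\<lambda>v. ceval y (\<alpha> v) / ceval y b) (Const c) * ceval y b ^ 0 = ceval y (Const c)"
      by (simp add: ceval_simps)
    then show ?case by blast
  next
    case (Var v)
    have "\<forall>y. ceval y b \<noteq> 0 \<longrightarrow> ceval (\<lambda>v. ceval y (\<alpha> v) / ceval y b) (Var v) * ceval y b ^ 1 = ceval y (\<alpha> v)"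
      by (simp add: ceval_simps)
    then show ?case by blast
  next
    case (add p q)
    then obtain p' e q' e' where "\<forall>y. ceval y b \<noteq> 0 \<longrightarrow> ceval (\<lambda>v. ceval y (\<alpha> v) / ceval y b) p * ceval y b ^ e = ceval y p'"
      "\<forall>y. ceval y b \<noteq> 0 \<longrightarrow> ceval (\<lambda>v. ceval y (\<alpha> v) / ceval y b) q * ceval y b ^ e' = ceval y q'" by blast
    then have "\<forall>y. ceval y b \<noteq> 0 \<longrightarrow> ceval (\<lambda>v. ceval y (\<alpha> v) / ceval y b) (p + q) * ceval y b ^ (e + e')
      = ceval y (p' * b ^ e' + q' * b ^ e)"
      by (auto simp: ceval_simps power_add algebra_simps)
    then show ?case by blast
  next
    case (mult p q)
    then obtain p' e q' e' where "\<forall>y. ceval y b \<noteq> 0 \<longrightarrow> ceval (\<lambda>v. ceval y (\<alpha> v) / ceval y b) p * ceval y b ^ e = ceval y p'"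
      "\<forall>y. ceval y b \<noteq> 0 \<longrightarrow> ceval (\<lambda>v. ceval y (\<alpha> v) / ceval y b) q * ceval y b ^ e' = ceval y q'" by blast
    then have "\<forall>y. ceval y b \<noteq> 0 \<longrightarrow> (ceval (\<lambda>v. ceval y (\<alpha> v) / ceval y b) p * ceval y b ^ e)
        * (ceval (\<lambda>v. ceval y (\<alpha> v) / ceval y b) q * ceval y b ^ e') = ceval y (p' * q')"
      by (simp add: ceval_simps)
    then have "\<forall>y. ceval y b \<noteq> 0 \<longrightarrow> ceval (\<lambda>v. ceval y (\<alpha> v) / ceval y b) (p * q) * ceval y b ^ (e + e') = ceval y (p' * q')"
      by (simp only: ceval_simps power_add ac_simps)
    then show ?case by blast
  qed
  obtain p' e where p': "\<And>y. ceval y b \<noteq> 0 \<Longrightarrow>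
      ceval (\<lambda>v. ceval y (\<alpha> v) / ceval y b) (F w) * ceval y b ^ e = ceval y p'" using clear by blast
  have "b * (p' - Var w * b ^ e) = 0"
  proof (rule vanish_on_image)
    fix x
    let ?y = "\<lambda>v. ceval x (F v)"
    show "ceval ?y (b * (p' - Var w * b ^ e)) = 0"
    proof (cases "ceval ?y b = 0")
      case False
      have "ceval ?y (\<alpha> v) / ceval ?y b = x v" for v
        using den_ev[OF comm_ring_hom_id, of x v] False by (simp add: field_simps)
      then show ?thesis using p'[OF False] by (simp add: ceval_simps)
    qed (simp add: ceval_simps)
  qed
  then have "ceval y (b * (p' - Var w * b ^ e)) = 0" by (simp only: ceval_simps)
  with y p'[OF y] show ?thesis by (simp add: ceval_simps)
qed

section \<open>Segments in the target and lines in the source\<close>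

definition base :: "nat \<Rightarrow> complex" where "base v = ceval xb (F v)"

text \<open>Segment in the target from \<open>F xb\<close> at \<open>t = 0\<close> to
  \<open>F x\<close> at \<open>t = 1\<close>; the inverse along it is
  \<open>numer / denom\<close>.\<close>

definition seg :: "(nat \<Rightarrow> complex) \<Rightarrow> nat \<Rightarrow> complex poly" where
  "seg x v = [:base v, ceval x (F v) - base v:]"

definition denom :: "(nat \<Rightarrow> complex) \<Rightarrow> complex poly" where
  "denom x = mp_eval (\<lambda>c. [:c:]) (seg x) b"

definition numer :: "(nat \<Rightarrow> complex) \<Rightarrow> nat \<Rightarrow> complex poly" where
  "numer x l = mp_eval (\<lambda>c. [:c:]) (seg x) (\<alpha> l)"

lemma poly_denom: "poly (denom x) t = ceval (\<lambda>v. poly (seg x v) t) b"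
  unfolding denom_def by (subst hom_ev[OF const_poly_hom poly_eval_hom]) simp

lemma denom_nz: "denom x \<noteq> 0"
  using poly_denom[of x 0] nz by (auto simp: seg_def base_def)

definition line :: "(nat \<Rightarrow> complex) \<Rightarrow> (nat \<Rightarrow> complex) \<Rightarrow> nat \<Rightarrow> complex poly" where
  "line p q v = [:p v, q v - p v:]"

text \<open>The same segments while the end point runs over the line from \<open>p\<close> to
  \<open>q\<close>: \<open>s\<close> lives in the coefficients, \<open>t\<close> is the outer
  variable.\<close>

definition seg2 :: "(nat \<Rightarrow> complex) \<Rightarrow> (nat \<Rightarrow> complex) \<Rightarrow> nat \<Rightarrow> complex poly poly" where
  "seg2 p q v = [:[:base v:], mp_eval (\<lambda>c. [:c:]) (line p q) (F v) - [:base v:]:]"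

lemma eval_seg2:
  "eval_coeffs s (mp_eval (\<lambda>c. [:[:c:]:]) (seg2 p q) r) = mp_eval (\<lambda>c. [:c:]) (seg (\<lambda>v. p v + s * (q v - p v))) r"
proof -
  have "eval_coeffs s (seg2 p q v) = seg (\<lambda>v. p v + s * (q v - p v)) v" for v
  proof -
    have "poly (mp_eval (\<lambda>c. [:c:]) (line p q) (F v)) s = ceval (\<lambda>v. p v + s * (q v - p v)) (F v)"
      by (subst hom_ev[OF const_poly_hom poly_eval_hom]) (simp add: line_def)
    then show ?thesis by (simp add: seg2_def seg_def eval_coeffs_pCons eval_coeffs_0)
  qed
  then show ?thesis
    by (subst hom_ev[OF const_poly_poly_hom eval_coeffs_hom]) (simp add: eval_coeffs_pCons eval_coeffs_0)
qed

text \<open>Newton's method gives the rational function as a power series over \<open>\<complex>[s]\<close> both at \<open>t = 0\<close> and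
  at \<open>t = 1\<close>, so the denominator has unit values there.\<close>

lemma line_reduced:
  "\<exists>A B u v r c0 c1. mp_eval (\<lambda>c. [:[:c:]:]) (seg2 p q) (\<alpha> l) * B = mp_eval (\<lambda>c. [:[:c:]:]) (seg2 p q) b * A \<and> B \<noteq> 0 \<and>
     u * A + v * B = [:r:] \<and> r \<noteq> 0 \<and> c0 \<noteq> 0 \<and> c1 \<noteq> 0 \<and> coeff B 0 = [:c0:] \<and> poly B 1 = [:c1:]"
proof -
  let ?mp_eval = "mp_eval (\<lambda>c. [:[:c:]:]) (seg2 p q)"
  have bs: "?mp_eval b \<noteq> 0"
  proof
    assume "?mp_eval b = 0"
    then have "denom (\<lambda>v. p v + 0 * (q v - p v)) = 0" unfolding denom_def eval_seg2[symmetric] by (simp add: eval_coeffs_0)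
    then show False using denom_nz by blast
  qed
  obtain A B u v r where AB: "?mp_eval (\<alpha> l) * B = ?mp_eval b * A" "B \<noteq> 0" and bez: "u * A + v * B = [:r:]" "r \<noteq> 0"
    and cop: "\<And>s. eval_coeffs s A \<noteq> 0 \<or> eval_coeffs s B \<noteq> 0"
    using bezout_reduced_pair_complex[OF bs, of "?mp_eval (\<alpha> l)"] by blast
  let ?K = "\<lambda>c. fps_const [:c::complex:]"
  have K: "comm_ring_hom ?K" by (rule fps_const_hom[OF const_poly_hom])
  \<comment> \<open>After reparametrisation by \<open>\<rho>\<close> the segments start at an image
    point, so Newton iteration lifts them over the polynomials in \<open>s\<close>; the lift expands
    \<open>A / B\<close> as a power series.\<close>
  have series: "\<exists>f. fps_of_poly (pcompose B \<rho>) * f = fps_of_poly (pcompose A \<rho>)"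
    if "\<And>v. coeff (pcompose (seg2 p q v) \<rho>) 0 = mp_eval (\<lambda>c. [:c:]) z (F v)" "pcompose (?mp_eval b) \<rho> \<noteq> 0" for z \<rho>
  proof -
    have "fps_nth (fps_of_poly (pcompose (seg2 p q v) \<rho>)) 0 = mp_eval (\<lambda>c. [:c:]) z (F v)" for v
      using that(1)[of v] by (simp only: fps_of_poly_nth)
    from newton[OF const_poly_hom this] obtain X
      where X: "\<And>v. mp_eval ?K X (F v) = fps_of_poly (pcompose (seg2 p q v) \<rho>)" by blast
    have of: "mp_eval ?K (\<lambda>v. fps_of_poly (pcompose (seg2 p q v) \<rho>)) w = fps_of_poly (pcompose (?mp_eval w) \<rho>)" for w
      by (subst hom_ev[OF const_poly_poly_hom comm_ring_hom_comp[OF fps_of_poly_hom pcompose_hom]])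
        (simp add: fps_of_poly_const pcompose_const)
    have "fps_of_poly (pcompose (?mp_eval b) \<rho>) * X l = fps_of_poly (pcompose (?mp_eval (\<alpha> l)) \<rho>)"
      using den_ev[OF K, of X l] by (simp add: X of)
    have "fps_of_poly (pcompose (?mp_eval b) \<rho>) * (fps_of_poly (pcompose B \<rho>) * X l)
       = (fps_of_poly (pcompose (?mp_eval b) \<rho>) * X l) * fps_of_poly (pcompose B \<rho>)"
      by (simp only: ac_simps)
    also note \<open>fps_of_poly (pcompose (?mp_eval b) \<rho>) * X l = fps_of_poly (pcompose (?mp_eval (\<alpha> l)) \<rho>)\<close>
    also have "fps_of_poly (pcompose (?mp_eval (\<alpha> l)) \<rho>) * fps_of_poly (pcompose B \<rho>) = fps_of_poly (pcompose (?mp_eval b * A) \<rho>)"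
      unfolding AB(1)[symmetric] by (simp only: fps_of_poly_mult pcompose_mult)
    also have "\<dots> = fps_of_poly (pcompose (?mp_eval b) \<rho>) * fps_of_poly (pcompose A \<rho>)"
      by (simp only: fps_of_poly_mult pcompose_mult)
    finally have eq: "fps_of_poly (pcompose (?mp_eval b) \<rho>) * (fps_of_poly (pcompose B \<rho>) * X l)
       = fps_of_poly (pcompose (?mp_eval b) \<rho>) * fps_of_poly (pcompose A \<rho>)" .
    have "fps_of_poly (pcompose (?mp_eval b) \<rho>) \<noteq> 0"
      using that(2) fps_of_poly_eq_iff[of "pcompose (?mp_eval b) \<rho>" 0] by simp
    from iffD1[OF mult_left_cancel[OF this] eq]
    have "fps_of_poly (pcompose B \<rho>) * X l = fps_of_poly (pcompose A \<rho>)" .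
    then show ?thesis by blast
  qed
  \<comment> \<open>Expansion at \<open>t = 0\<close>, where the start point is \<open>xb\<close>
    for all \<open>s\<close>.\<close>
  have "\<exists>f. fps_of_poly (pcompose B [:0, 1:]) * f = fps_of_poly (pcompose A [:0, 1:])"
  proof (rule series)
    show "coeff (pcompose (seg2 p q v) [:0, 1:]) 0 = mp_eval (\<lambda>c. [:c:]) (\<lambda>v. [:xb v:]) (F v)" for v
      using hom_ev[OF comm_ring_hom_id const_poly_hom, of xb "F v"] by (simp add: seg2_def base_def pcompose_pCons)
  qed (use bs in simp)
  then obtain f where "fps_of_poly B * f = fps_of_poly A" by auto
  from nonvanishing_poly_const[of "coeff B 0"] fatou_denominator[OF bez cop this]
  obtain c0 where c0: "c0 \<noteq> 0" "coeff B 0 = [:c0:]" by blast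
  \<comment> \<open>Substituting \<open>1 - t\<close> for \<open>t\<close> moves
    \<open>t = 1\<close> to the origin, where the point on the line itself is a preimage.\<close>
  let ?\<rho> = "[:1, -1:] :: complex poly poly"
  have "\<exists>f. fps_of_poly (pcompose B ?\<rho>) * f = fps_of_poly (pcompose A ?\<rho>)"
  proof (rule series)
    show "coeff (pcompose (seg2 p q v) ?\<rho>) 0 = mp_eval (\<lambda>c. [:c:]) (line p q) (F v)" for v
      by (simp add: seg2_def pcompose_pCons)
  qed (use bs pcompose_eq_0[of "?mp_eval b" ?\<rho>] in auto)
  then obtain f where f: "fps_of_poly (pcompose B ?\<rho>) * f = fps_of_poly (pcompose A ?\<rho>)" by blast
  have bez1: "pcompose u ?\<rho> * pcompose A ?\<rho> + pcompose v ?\<rho> * pcompose B ?\<rho> = [:r:]"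
    using arg_cong[OF bez(1), of "\<lambda>p. pcompose p ?\<rho>"] by (simp add: pcompose_add pcompose_mult pcompose_const)
  have ec: "eval_coeffs s (pcompose w ?\<rho>) = pcompose (eval_coeffs s w) [:1, -1:]" for s w
  proof -
    interpret e: comm_ring_hom "eval_coeffs s" by (rule eval_coeffs_hom)
    show ?thesis
      by (induction w) (simp_all add: pcompose_pCons eval_coeffs_0 eval_coeffs_pCons e.hom_add e.hom_mult
        one_pCons del: pCons_one mult_pCons_left mult_pCons_right)
  qed
  have cop1: "eval_coeffs s (pcompose A ?\<rho>) \<noteq> 0 \<or> eval_coeffs s (pcompose B ?\<rho>) \<noteq> 0" for s
    using cop[of s] pcompose_eq_0[of "eval_coeffs s A" "[:1, -1:]"] pcompose_eq_0[of "eval_coeffs s B" "[:1, -1:]"]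
    unfolding ec by auto
  have "coeff (pcompose B ?\<rho>) 0 = poly B 1"
    by (simp flip: poly_0_coeff_0 add: poly_pcompose)
  with nonvanishing_poly_const[of "poly B 1"] fatou_denominator[OF bez1 bez(2) cop1 f]
  obtain c1 where c1: "c1 \<noteq> 0" "poly B 1 = [:c1:]" by metis
  show ?thesis using AB bez c0 c1 by blast
qed


text \<open>The inverse on the segment in lowest terms, unique up to a constant factor;
  \<open>fraction_degree\<close> is its degree as a rational function of \<open>t\<close>.\<close>

definition reduced_fraction :: "nat \<Rightarrow> (nat \<Rightarrow> complex) \<Rightarrow> complex poly \<times> complex poly" where
  "reduced_fraction l x = (SOME AB. numer x l * snd AB = denom x * fst AB \<and> snd AB \<noteq> 0 \<and>
     (\<exists>u v r. u * fst AB + v * snd AB = [:r:] \<and> r \<noteq> 0))"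

definition fraction_degree :: "nat \<Rightarrow> (nat \<Rightarrow> complex) \<Rightarrow> nat" where
  "fraction_degree l x = max (degree (fst (reduced_fraction l x))) (degree (snd (reduced_fraction l x)))"

lemma reduced_fraction:
  shows reduced_fraction_eq: "numer x l * snd (reduced_fraction l x) = denom x * fst (reduced_fraction l x)" and reduced_fraction_nz: "snd (reduced_fraction l x) \<noteq> 0"
    and reduced_fraction_bezout: "\<exists>u v r. u * fst (reduced_fraction l x) + v * snd (reduced_fraction l x) = [:r:] \<and> r \<noteq> 0"
proof -
  have "\<exists>AB. numer x l * snd AB = denom x * fst AB \<and> snd AB \<noteq> 0 \<and> (\<exists>u v r. u * fst AB + v * snd AB = [:r:] \<and> r \<noteq> 0)"
    using bezout_reduced_pair[OF denom_nz[of x], of "numer x l"] by (metis fst_conv snd_conv)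
  from someI_ex[OF this] show "numer x l * snd (reduced_fraction l x) = denom x * fst (reduced_fraction l x)" "snd (reduced_fraction l x) \<noteq> 0"
    "\<exists>u v r. u * fst (reduced_fraction l x) + v * snd (reduced_fraction l x) = [:r:] \<and> r \<noteq> 0"
    unfolding reduced_fraction_def by blast+
qed

lemma reduced_fraction_unique:
  assumes "numer x l * B = denom x * A" "B \<noteq> 0"
  shows "\<exists>k. k \<noteq> 0 \<and> A = fst (reduced_fraction l x) * k \<and> B = snd (reduced_fraction l x) * k \<and>
    max (degree A) (degree B) = fraction_degree l x + degree k"
proof -
  obtain u v r where "u * fst (reduced_fraction l x) + v * snd (reduced_fraction l x) = [:r:]" "r \<noteq> 0" using reduced_fraction_bezout by blast
  from reduced_pair_unique[OF reduced_fraction_eq denom_nz reduced_fraction_nz this assms]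
  obtain k where k: "k \<noteq> 0" "A = fst (reduced_fraction l x) * k" "B = snd (reduced_fraction l x) * k" by blast
  have "max (degree A) (degree B) = fraction_degree l x + degree k"
    unfolding fraction_degree_def k(2,3) by (rule max_degree_mult[OF reduced_fraction_nz k(1)])
  with k show ?thesis by blast
qed

lemma fraction_degree_bounded: "\<exists>d. \<forall>x. fraction_degree l x \<le> d"
proof -
  obtain d where d: "\<And>x. (\<forall>v. degree (x v) \<le> 1) \<Longrightarrow> degree (mp_eval (\<lambda>c. [:c:]) x (\<alpha> l)) \<le> d"
    using mp_eval_degree_bound by blast
  obtain e where e: "\<And>x. (\<forall>v. degree (x v) \<le> 1) \<Longrightarrow> degree (mp_eval (\<lambda>c. [:c:]) x b) \<le> e"
    using mp_eval_degree_bound by blast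
  have "fraction_degree l x \<le> max d e" for x
  proof -
    have "numer x l * denom x = denom x * numer x l" by (rule mult.commute)
    from reduced_fraction_unique[OF this denom_nz] obtain k :: "complex poly"
      where "max (degree (numer x l)) (degree (denom x)) = fraction_degree l x + degree k"
      by blast
    moreover have "degree (numer x l) \<le> d" "degree (denom x) \<le> e"
      unfolding numer_def denom_def by (intro d e, simp add: seg_def)+
    ultimately show ?thesis by linarith
  qed
  then show ?thesis by blast
qed

lemma fraction_degree_max_exists: "\<exists>p. \<forall>x. fraction_degree l x \<le> fraction_degree l p"
proof -
  obtain d where "\<And>x. fraction_degree l x \<le> d" using fraction_degree_bounded by blast
  then show ?thesis
    using ex_has_greatest_nat[of "\<lambda>_. True" undefined "fraction_degree l" "Suc d"] by (auto simp: less_Suc_eq_le)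
qed

text \<open>Generic specialisation keeps \<open>A / B\<close> reduced and of full degree
  \<open>m\<close> in \<open>t\<close>, so \<open>m\<close> is at most the maximum; specialising at
  \<open>p\<close> shows the converse. At end points of maximal degree no room is left for a common
  factor, so \<open>B\<close> specialises to the reduced denominator up to a constant.\<close>

lemma line_facts:
  assumes max: "\<And>x. fraction_degree l x \<le> fraction_degree l p"
  shows "\<exists>A B c0 c1 S. c0 \<noteq> 0 \<and> c1 \<noteq> 0 \<and> finite S \<and> coeff B 0 = [:c0:] \<and> poly B 1 = [:c1:] \<and>
    (\<forall>s x. x = (\<lambda>v. p v + s * (q v - p v)) \<longrightarrow>
       numer x l * eval_coeffs s B = denom x * eval_coeffs s A \<and>
       (fraction_degree l x = fraction_degree l p \<longrightarrow> (\<exists>k. k \<noteq> 0 \<and> eval_coeffs s B = Polynomial.smult k (snd (reduced_fraction l x)))) \<and>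
       (s \<notin> S \<longrightarrow> fraction_degree l x = fraction_degree l p \<and> degree (eval_coeffs s B) = degree B))"
proof -
  obtain A B u v r c0 c1
    where AB: "mp_eval (\<lambda>c. [:[:c:]:]) (seg2 p q) (\<alpha> l) * B = mp_eval (\<lambda>c. [:[:c:]:]) (seg2 p q) b * A" "B \<noteq> 0"
      and bez: "u * A + v * B = [:r:]" "r \<noteq> 0" and c: "c0 \<noteq> 0" "c1 \<noteq> 0" "coeff B 0 = [:c0:]" "poly B 1 = [:c1:]"
    using line_reduced[of p q l] by blast
  define x where "x s = (\<lambda>v. p v + s * (q v - p v))" for s
  have eqs: "numer (x s) l * eval_coeffs s B = denom (x s) * eval_coeffs s A" for s
  proof -
    interpret e: comm_ring_hom "eval_coeffs s" by (rule eval_coeffs_hom)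
    show ?thesis
      using arg_cong[OF AB(1), of "eval_coeffs s"] by (simp add: e.hom_mult eval_seg2 numer_def denom_def x_def)
  qed
  have Bnz: "eval_coeffs s B \<noteq> 0" for s
    using c by (metis coeff_0 coeff_eval_coeffs poly_const_conv)
  define m where "m = max (degree A) (degree B)"
  \<comment> \<open>Leading coefficient of a member of larger degree; off its roots the maximum of
    the two degrees persists.\<close>
  define w where "w = (if degree A \<le> degree B then lead_coeff B else lead_coeff A)"
  \<comment> \<open>Off \<open>S\<close> no common factor appears, and neither \<open>m\<close> nor
    the degree of \<open>B\<close> drops.\<close>
  define S where "S = {s. poly (r * w * lead_coeff B) s = 0}"
  have "w \<noteq> 0" using AB(2) by (auto simp: w_def)
  then have S: "finite S" unfolding S_def using bez(2) AB(2) by (intro poly_roots_finite) auto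
  have k: "\<exists>k. k \<noteq> 0 \<and> eval_coeffs s A = fst (reduced_fraction l (x s)) * k \<and> eval_coeffs s B = snd (reduced_fraction l (x s)) * k
      \<and> max (degree (eval_coeffs s A)) (degree (eval_coeffs s B)) = fraction_degree l (x s) + degree k" for s
    by (rule reduced_fraction_unique[OF eqs Bnz])
  have gen: "fraction_degree l (x s) = m \<and> degree (eval_coeffs s B) = degree B" if s: "s \<notin> S" for s
  proof -
    have r: "poly r s \<noteq> 0" and w: "poly w s \<noteq> 0" and lB: "poly (lead_coeff B) s \<noteq> 0" using s by (auto simp: S_def)
    obtain k where k: "eval_coeffs s A = fst (reduced_fraction l (x s)) * k" "eval_coeffs s B = snd (reduced_fraction l (x s)) * k"
      "max (degree (eval_coeffs s A)) (degree (eval_coeffs s B)) = fraction_degree l (x s) + degree k" using k by blast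
    interpret e: comm_ring_hom "eval_coeffs s" by (rule eval_coeffs_hom)
    have "eval_coeffs s u * eval_coeffs s A + eval_coeffs s v * eval_coeffs s B = [:poly r s:]"
      using arg_cong[OF bez(1), of "eval_coeffs s"] by (simp add: e.hom_mult e.hom_add eval_coeffs_pCons eval_coeffs_0)
    then have "degree k = 0" unfolding k(1,2) using r by (rule degree_common_factor)
    moreover have "max (degree (eval_coeffs s A)) (degree (eval_coeffs s B)) = m"
      using w degree_eval_coeffs_eq[of A s] degree_eval_coeffs_eq[of B s]
        degree_eval_coeffs_le[of s A] degree_eval_coeffs_le[of s B]
      unfolding w_def m_def by (auto split: if_splits)
    ultimately show ?thesis using k(3) degree_eval_coeffs_eq[OF lB] by simp
  qed
  obtain s0 where "s0 \<notin> S" using S ex_new_if_finite infinite_UNIV_char_0 by blast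
  then have mle: "m \<le> fraction_degree l p" using gen max by metis
  have le: "fraction_degree l (x s) + degree k \<le> m"
    if "max (degree (eval_coeffs s A)) (degree (eval_coeffs s B)) = fraction_degree l (x s) + degree k" for s k
    using that degree_eval_coeffs_le[of s A] degree_eval_coeffs_le[of s B] by (auto simp: m_def)
  have "x 0 = p" by (simp add: x_def)
  then have m: "m = fraction_degree l p" using k[of 0] le[of 0] mle by (metis add_leD1 antisym)
  have smult: "\<exists>k. k \<noteq> 0 \<and> eval_coeffs s B = Polynomial.smult k (snd (reduced_fraction l (x s)))" if "fraction_degree l (x s) = fraction_degree l p" for s
  proof -
    obtain k where k: "k \<noteq> 0" "eval_coeffs s B = snd (reduced_fraction l (x s)) * k"
      "max (degree (eval_coeffs s A)) (degree (eval_coeffs s B)) = fraction_degree l (x s) + degree k" using k by blast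
    from le[OF k(3)] that m have "degree k = 0" by simp
    then obtain c where "k = [:c:]" by (auto elim: degree_eq_zeroE)
    then show ?thesis using k by (intro exI[of _ c]) auto
  qed
  show ?thesis
    using c S eqs gen smult unfolding m x_def[symmetric]
    by (intro exI[of _ A] exI[of _ B] exI[of _ c0] exI[of _ c1] exI[of _ S]) auto
qed

end

context poly_mono_frac
begin

text \<open>\<open>B(s, 0)\<close> and \<open>B(s, 1)\<close> do not depend on \<open>s\<close>, and
  the reduced denominators of \<open>p\<close> and \<open>q\<close> are \<open>B\<close> at
  \<open>s = 0\<close> and \<open>s = 1\<close> up to scalars. The scalars cancel in the ratio of
  the two values.\<close>

lemma max_reduced_ratio:
  assumes max: "\<And>x. fraction_degree l x \<le> fraction_degree l p" and q: "fraction_degree l q = fraction_degree l p"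
  shows "poly (snd (reduced_fraction l p)) 0 \<noteq> 0"
    and "poly (snd (reduced_fraction l q)) 1 * poly (snd (reduced_fraction l p)) 0 = poly (snd (reduced_fraction l p)) 1 * poly (snd (reduced_fraction l q)) 0"
proof -
  obtain A B c0 c1 where c: "c0 \<noteq> 0" "c1 \<noteq> 0" "coeff B 0 = [:c0:]" "poly B 1 = [:c1:]"
    and k: "\<And>s x. x = (\<lambda>v. p v + s * (q v - p v)) \<Longrightarrow> fraction_degree l x = fraction_degree l p \<Longrightarrow>
        \<exists>k. k \<noteq> 0 \<and> eval_coeffs s B = Polynomial.smult k (snd (reduced_fraction l x))"
    using line_facts[OF max, of q] by blast
  have B: "poly (eval_coeffs s B) 0 = c0" "poly (eval_coeffs s B) 1 = c1" for s
    using c by (simp add: poly_0_coeff_0 coeff_eval_coeffs) (use c in \<open>simp add: poly_eval_coeffs flip: one_pCons\<close>)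
  obtain k0 where k0: "k0 \<noteq> 0" "eval_coeffs 0 B = Polynomial.smult k0 (snd (reduced_fraction l p))" using k[of p 0] by auto
  obtain k1 where k1: "k1 \<noteq> 0" "eval_coeffs 1 B = Polynomial.smult k1 (snd (reduced_fraction l q))" using k[of q 1] q by auto
  have p: "k0 * poly (snd (reduced_fraction l p)) 0 = c0" "k0 * poly (snd (reduced_fraction l p)) 1 = c1"
    using B[of 0] by (simp_all add: k0)
  have q: "k1 * poly (snd (reduced_fraction l q)) 0 = c0" "k1 * poly (snd (reduced_fraction l q)) 1 = c1"
    using B[of 1] by (simp_all add: k1)
  show "poly (snd (reduced_fraction l p)) 0 \<noteq> 0" using p c by auto
  have "(k0 * k1) * (poly (snd (reduced_fraction l q)) 1 * poly (snd (reduced_fraction l p)) 0)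
      = (k1 * poly (snd (reduced_fraction l q)) 1) * (k0 * poly (snd (reduced_fraction l p)) 0)" by simp
  also have "\<dots> = (k0 * poly (snd (reduced_fraction l p)) 1) * (k1 * poly (snd (reduced_fraction l q)) 0)" unfolding p q by simp
  also have "\<dots> = (k0 * k1) * (poly (snd (reduced_fraction l p)) 1 * poly (snd (reduced_fraction l q)) 0)" by simp
  finally show "poly (snd (reduced_fraction l q)) 1 * poly (snd (reduced_fraction l p)) 0 = poly (snd (reduced_fraction l p)) 1 * poly (snd (reduced_fraction l q)) 0"
    using k0(1) k1(1) by simp
qed

text \<open>Moving the end point of the segment to parameter \<open>t\<close> rescales the rational function, so the value
  of the normalised denominator at \<open>1\<close> equals its value at almost every \<open>t\<close>.\<close>

lemma max_reduced_denominator_const: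
  assumes max: "\<And>x. fraction_degree l x \<le> fraction_degree l p"
  shows "degree (snd (reduced_fraction l p)) = 0"
proof -
  define A B where "A = fst (reduced_fraction l p)" and "B = snd (reduced_fraction l p)"
  have main: "poly B t = poly B 1" if t: "t \<noteq> 0" "poly (denom p) t \<noteq> 0" for t
  proof -
    let ?y = "\<lambda>v. poly (seg p v) t"
    \<comment> \<open>\<open>q\<close> is the preimage of the point at parameter \<open>t\<close>;
      the segment to it is the old one traversed at speed \<open>t\<close>.\<close>
    define q where "q v = ceval ?y (\<alpha> v) / ceval ?y b" for v
    have q: "ceval q (F v) = ?y v" for v
      unfolding q_def[abs_def] by (rule inverse_on_dense) (use t in \<open>simp add: poly_denom\<close>)
    have seg: "seg q v = pcompose (seg p v) [:0, t:]" for v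
      by (simp add: seg_def q pcompose_pCons)
    have comp: "mp_eval (\<lambda>c. [:c:]) (seg q) r = pcompose (mp_eval (\<lambda>c. [:c:]) (seg p) r) [:0, t:]" for r
      by (subst hom_ev[OF const_poly_hom pcompose_hom]) (simp add: seg[abs_def] pcompose_const)
    have eq: "numer q l * pcompose B [:0, t:] = denom q * pcompose A [:0, t:]"
      unfolding numer_def denom_def comp pcompose_mult[symmetric]
      using reduced_fraction_eq[of p l] by (simp add: numer_def denom_def A_def B_def)
    have nz: "pcompose B [:0, t:] \<noteq> 0"
      using reduced_fraction_nz[of l p] t(1) pcompose_eq_0[of B "[:0, t:]"] by (auto simp: B_def)
    obtain k where k: "k \<noteq> 0" "pcompose A [:0, t:] = fst (reduced_fraction l q) * k" "pcompose B [:0, t:] = snd (reduced_fraction l q) * k"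
      "max (degree (pcompose A [:0, t:])) (degree (pcompose B [:0, t:])) = fraction_degree l q + degree k"
      using reduced_fraction_unique[OF eq nz] by blast
    obtain u v r where bez: "u * A + v * B = [:r:]" "r \<noteq> 0"
      using reduced_fraction_bezout[of l p] unfolding A_def B_def by blast
    \<comment> \<open>The Bezout identity survives the rescaling, so \<open>q\<close> has maximal
      degree as well and the ratios can be compared.\<close>
    have "pcompose u [:0, t:] * pcompose A [:0, t:] + pcompose v [:0, t:] * pcompose B [:0, t:] = [:r:]"
      using arg_cong[OF bez(1), of "\<lambda>p. pcompose p [:0, t:]"] by (simp add: pcompose_add pcompose_mult pcompose_const)
    then have k0: "degree k = 0" unfolding k(2,3) using bez(2) by (rule degree_common_factor)
    then have "fraction_degree l q = fraction_degree l p" using k(4) t(1) by (simp add: degree_pcompose fraction_degree_def A_def B_def)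
    note ratio = max_reduced_ratio[OF max this]
    from k0 k(1) obtain c where c: "k = [:c:]" "c \<noteq> 0" by (auto elim: degree_eq_zeroE)
    have "poly B t = poly (pcompose B [:0, t:]) 1" "poly B 0 = poly (pcompose B [:0, t:]) 0"
      by (simp_all add: poly_pcompose)
    then have Bt: "poly B t = c * poly (snd (reduced_fraction l q)) 1" and B0: "poly B 0 = c * poly (snd (reduced_fraction l q)) 0"
      unfolding k(3) c by simp_all
    have "poly B t * poly B 0 = c * (poly (snd (reduced_fraction l q)) 1 * poly B 0)"
      by (simp only: Bt mult.assoc)
    also have "\<dots> = c * (poly B 1 * poly (snd (reduced_fraction l q)) 0)"
      using ratio(2) by (simp only: B_def)
    also have "\<dots> = poly B 1 * poly B 0"
      by (simp only: B0 mult.left_commute)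
    finally have "poly B t * poly B 0 = poly B 1 * poly B 0" .
    then show ?thesis using ratio(1) by (simp add: B_def)
  qed
  have "B = [:poly B 1:]"
  proof (rule ccontr)
    assume "B \<noteq> [:poly B 1:]"
    then have "finite {t. poly (B - [:poly B 1:]) t = 0}" by (intro poly_roots_finite) simp
    moreover have "finite {t. poly (denom p) t = 0}" by (rule poly_roots_finite[OF denom_nz])
    ultimately have "finite ({t. poly (B - [:poly B 1:]) t = 0} \<union> {t. poly (denom p) t = 0} \<union> {0})" by simp
    moreover have "UNIV \<subseteq> {t. poly (B - [:poly B 1:]) t = 0} \<union> {t. poly (denom p) t = 0} \<union> {0}"
      using main by auto
    ultimately show False using infinite_UNIV_char_0 finite_subset by blast
  qed
  then obtain c where "B = [:c:]" by blast
  then show ?thesis by (simp flip: B_def)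
qed

text \<open>Join \<open>x\<close> to a point \<open>p\<close> of maximal degree. A generic point of
  the line has maximal degree too, hence constant denominator; so \<open>B\<close> has degree 0 in
  \<open>t\<close> and equals the constant \<open>c0\<close>, and \<open>s = 1\<close> gives the
  claim at \<open>x\<close>.\<close>

lemma denominator_dvd: "denom x dvd numer x l"
proof -
  obtain p where max: "\<And>x. fraction_degree l x \<le> fraction_degree l p" using fraction_degree_max_exists by blast
  obtain A B c0 c1 S where c: "c0 \<noteq> 0" "coeff B 0 = [:c0:]" "finite S"
    and line: "\<And>s y. y = (\<lambda>v. p v + s * (x v - p v)) \<Longrightarrow> numer y l * eval_coeffs s B = denom y * eval_coeffs s A \<and>
       (fraction_degree l y = fraction_degree l p \<longrightarrow> (\<exists>k. k \<noteq> 0 \<and> eval_coeffs s B = Polynomial.smult k (snd (reduced_fraction l y)))) \<and>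
       (s \<notin> S \<longrightarrow> fraction_degree l y = fraction_degree l p \<and> degree (eval_coeffs s B) = degree B)"
    using line_facts[OF max, of x] by blast
  obtain s where s: "s \<notin> S" using c(3) ex_new_if_finite infinite_UNIV_char_0 by blast
  define y where "y = (\<lambda>v. p v + s * (x v - p v))"
  have y: "fraction_degree l y = fraction_degree l p" "degree (eval_coeffs s B) = degree B" using line[OF y_def] s by auto
  obtain k where k: "k \<noteq> 0" "eval_coeffs s B = Polynomial.smult k (snd (reduced_fraction l y))" using line[OF y_def] y by blast
  have "degree (snd (reduced_fraction l y)) = 0" by (rule max_reduced_denominator_const) (simp add: y max)
  then have "degree B = 0" using k y(2) by simp
  then obtain c' where "B = [:c':]" by (auto elim: degree_eq_zeroE)
  with c have B: "B = [:[:c0:]:]" by simp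
  have "numer x l * eval_coeffs 1 B = denom x * eval_coeffs 1 A" using line[of x 1] by simp
  then have "Polynomial.smult c0 (numer x l) = denom x * eval_coeffs 1 A" by (simp add: B eval_coeffs_pCons eval_coeffs_0)
  then show ?thesis using c(1) by (metis dvd_smult_cancel dvd_triv_left)
qed

text \<open>Newton iteration towards a generic target, whose coordinates are the variables, gives a
  series with polynomial coefficients. At image points it is a polynomial of degree at most
  \<open>d\<close> by \<open>denominator_dvd\<close>, so by density it stops at \<open>d\<close>;
  its value at \<open>t = 1\<close> is the inverse.\<close>

lemma polynomial_right_inverse: "\<exists>Q. \<forall>v. subst Q (F v) = Var v"
proof -
  let ?K = "\<lambda>c. fps_const (Const c)"
  have K: "comm_ring_hom ?K" by (rule fps_const_hom[OF comm_ring_hom_Const])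
  define Y where "Y v = [:Const (base v), Var v - Const (base v):]" for v
  have "fps_nth (fps_of_poly (Y v)) 0 = subst (\<lambda>v. Const (xb v)) (F v)" for v
    using hom_ev[OF comm_ring_hom_id comm_ring_hom_Const, of xb "F v"] by (simp add: Y_def base_def)
  from newton[OF comm_ring_hom_Const this]
  obtain X where X: "\<And>v. mp_eval ?K X (F v) = fps_of_poly (Y v)" by blast
  have vanish: "\<exists>d. \<forall>j>d. fps_nth (X l) j = 0" for l
  proof -
    obtain d where d: "\<And>x. (\<forall>v. degree (x v) \<le> 1) \<Longrightarrow> degree (mp_eval (\<lambda>c. [:c:]) x (\<alpha> l)) \<le> d"
      using mp_eval_degree_bound by blast
    have "fps_nth (X l) j = 0" if j: "j > d" for j
    proof (rule vanish_on_image)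
      fix x
      define h where "h = ceval (\<lambda>v. ceval x (F v))"
      have h: "comm_ring_hom h" unfolding h_def by (rule mp_eval_hom[OF comm_ring_hom_id])
      interpret H: comm_ring_hom "fps_map h" by (rule fps_map_hom[OF h])
      have hY: "fps_map h (fps_of_poly (Y v)) = fps_of_poly (seg x v)" for v
        by (rule fps_ext) (simp add: Y_def seg_def coeff_pCons h_def ceval_simps split: nat.split)
      have hK: "fps_map h (?K c) = fps_const c" for c
        by (rule fps_ext) (simp add: h_def ceval_simps)
      have e: "fps_map h (mp_eval ?K (\<lambda>v. fps_of_poly (Y v)) r) = fps_of_poly (mp_eval (\<lambda>c. [:c:]) (seg x) r)" for r
        unfolding hom_ev[OF K fps_map_hom[OF h]] hom_ev[OF const_poly_hom fps_of_poly_hom]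
        by (simp add: hY hK fps_of_poly_const)
      have "fps_map h (mp_eval ?K (\<lambda>v. fps_of_poly (Y v)) b) * fps_map h (X l) = fps_map h (mp_eval ?K (\<lambda>v. fps_of_poly (Y v)) (\<alpha> l))"
        using den_ev[OF K, of X l] by (simp only: X H.hom_mult[symmetric])
      then have 1: "fps_of_poly (denom x) * fps_map h (X l) = fps_of_poly (numer x l)"
        unfolding e denom_def numer_def .
      obtain w where w: "numer x l = denom x * w" using denominator_dvd by (auto simp: dvd_def)
      have "fps_of_poly (denom x) \<noteq> 0" using denom_nz fps_of_poly_eq_iff[of "denom x" 0] by simp
      moreover have "fps_of_poly (denom x) * fps_map h (X l) = fps_of_poly (denom x) * fps_of_poly w"
        unfolding 1 w fps_of_poly_mult ..
      ultimately have "fps_map h (X l) = fps_of_poly w" using mult_left_cancel by blast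
      then have "h (fps_nth (X l) j) = coeff w j" by (metis fps_map_nth fps_of_poly_nth)
      moreover have "coeff w j = 0"
      proof (cases "w = 0")
        case False
        then have "degree w \<le> degree (numer x l)" unfolding w using denom_nz by (subst degree_mult_eq) auto
        also have "\<dots> \<le> d" unfolding numer_def by (rule d) (simp add: seg_def)
        finally show ?thesis using j by (intro coeff_eq_0) simp
      qed simp
      ultimately show "ceval (\<lambda>v. ceval x (F v)) (fps_nth (X l) j) = 0" by (simp add: h_def)
    qed
    then show ?thesis by blast
  qed
  have "\<exists>p. X l = fps_of_poly p" for l
  proof -
    obtain d where d: "\<And>j. j > d \<Longrightarrow> fps_nth (X l) j = 0" using vanish by blast
    have "X l = fps_of_poly (Poly (map (fps_nth (X l)) [0..<Suc d]))"
      by (rule fps_ext) (use d in \<open>auto simp: nth_default_def not_less less_Suc_eq_le simp del: upt_Suc\<close>)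
    then show ?thesis by blast
  qed
  then obtain p where p: "\<And>l. X l = fps_of_poly (p l)" by metis
  have cc: "comm_ring_hom (\<lambda>c. [:Const c:])" by (rule comm_ring_hom_comp[OF const_poly_hom comm_ring_hom_Const])
  have "subst (\<lambda>l. poly (p l) 1) (F v) = Var v" for v
  proof -
    have "fps_of_poly (mp_eval (\<lambda>c. [:Const c:]) p (F v)) = mp_eval ?K X (F v)"
      unfolding hom_ev[OF cc fps_of_poly_hom] by (simp add: p[abs_def] fps_of_poly_const)
    then have "mp_eval (\<lambda>c. [:Const c:]) p (F v) = Y v" by (simp add: X fps_of_poly_eq_iff)
    then have "poly (mp_eval (\<lambda>c. [:Const c:]) p (F v)) 1 = Var v" by (simp add: Y_def)
    then show ?thesis unfolding hom_ev[OF cc poly_eval_hom] by simp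
  qed
  then show ?thesis by blast
qed

end

text \<open>By density the image of some base point lies outside the zeros of the common
  denominator.\<close>

theorem (in poly_mono) polynomial_inverse_exists: "\<exists>Q. \<forall>v. subst Q (F v) = Var v"
proof -
  obtain b \<alpha> where b: "b \<noteq> 0" and den: "\<And>v. subst F b * Var v = subst F (\<alpha> v)"
    using common_denominator by blast
  then have "\<not> (\<forall>x. ceval (\<lambda>v. ceval x (F v)) b = 0)" using vanish_on_image by blast
  then obtain xb where "ceval (\<lambda>v. ceval xb (F v)) b \<noteq> 0" by blast
  then interpret poly_mono_frac I F J N b \<alpha> xb by unfold_locales (rule den)
  show ?thesis by (rule polynomial_right_inverse)
qed

subsection \<open>Words in matrices and their first order expansion\<close>

text \<open>Matrix products as entry functions over any commutative ring, so that homomorphisms act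
  entrywise and entries may be polynomials.\<close>

fun word_entry :: "nat \<Rightarrow> (nat \<Rightarrow> nat \<Rightarrow> nat \<Rightarrow> 'a::comm_ring_1) \<Rightarrow> nat list \<Rightarrow> nat \<Rightarrow> nat \<Rightarrow> 'a" where
  "word_entry n X [] i j = (if i = j then 1 else 0)"
| "word_entry n X (a # w) i j = (\<Sum>k<n. X a i k * word_entry n X w k j)"

lemma word_entry_hom: "comm_ring_hom h \<Longrightarrow> h (word_entry n X w i j) = word_entry n (\<lambda>a i j. h (X a i j)) w i j"
proof (induction w arbitrary: i j)
  case Nil
  then interpret comm_ring_hom h by simp
  show ?case by simp
next
  case (Cons a w)
  then interpret comm_ring_hom h by simp
  show ?case using Cons by (simp add: hom_sum hom_mult)
qed

lemma word_entry_cong: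
  assumes "\<And>a i j. a \<in> set w \<Longrightarrow> i < n \<Longrightarrow> j < n \<Longrightarrow> X a i j = Y a i j" "i < n"
  shows "word_entry n X w i j = word_entry n Y w i j"
  using assms by (induction w arbitrary: i) (auto intro!: sum.cong)

lemma word_entry_append:
  "i < n \<Longrightarrow> word_entry n X (u @ w) i j = (\<Sum>k<n. word_entry n X u i k * word_entry n X w k j)"
proof (induction u arbitrary: i)
  case Nil
  have "(\<Sum>k<n. word_entry n X [] i k * word_entry n X w k j) = (\<Sum>k<n. if i = k then word_entry n X w k j else 0)"
    by (intro sum.cong) auto
  then show ?case using Nil by simp
next
  case (Cons a u)
  have "word_entry n X ((a # u) @ w) i j = (\<Sum>k<n. \<Sum>l<n. X a i k * word_entry n X u k l * word_entry n X w l j)"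
    by (simp add: Cons.IH sum_distrib_left mult.assoc)
  also have "\<dots> = (\<Sum>l<n. \<Sum>k<n. X a i k * word_entry n X u k l * word_entry n X w l j)" by (rule sum.swap)
  finally show ?case by (simp add: sum_distrib_right)
qed

lemma word_entry_single: "i < n \<Longrightarrow> j < n \<Longrightarrow> word_entry n X [a] i j = X a i j"
proof -
  assume "j < n"
  have "word_entry n X [a] i j = (\<Sum>k<n. if k = j then X a i k else 0)"
    unfolding word_entry.simps by (intro sum.cong) auto
  then show ?thesis using \<open>j < n\<close> by simp
qed

text \<open>Upper right block of a word at block triangular matrices with diagonal \<open>X\<close>,
  \<open>X'\<close> and corner \<open>H\<close>, as \<open>word_entry_blk\<close> confirms.\<close>

fun word_corner :: "nat \<Rightarrow> (nat \<Rightarrow> nat \<Rightarrow> nat \<Rightarrow> 'a::comm_ring_1) \<Rightarrow> (nat \<Rightarrow> nat \<Rightarrow> nat \<Rightarrow> 'a)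
    \<Rightarrow> (nat \<Rightarrow> nat \<Rightarrow> nat \<Rightarrow> 'a) \<Rightarrow> nat list \<Rightarrow> nat \<Rightarrow> nat \<Rightarrow> 'a" where
  "word_corner n X X' H [] i j = 0"
| "word_corner n X X' H (a # w) i j = (\<Sum>k<n. X a i k * word_corner n X X' H w k j) + (\<Sum>k<n. H a i k * word_entry n X' w k j)"

definition block_entries :: "nat \<Rightarrow> (nat \<Rightarrow> nat \<Rightarrow> nat \<Rightarrow> 'a::comm_ring_1) \<Rightarrow> (nat \<Rightarrow> nat \<Rightarrow> nat \<Rightarrow> 'a)
    \<Rightarrow> (nat \<Rightarrow> nat \<Rightarrow> nat \<Rightarrow> 'a) \<Rightarrow> nat \<Rightarrow> nat \<Rightarrow> nat \<Rightarrow> 'a" where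
  "block_entries n X H X' a i j = (if i < n then if j < n then X a i j else H a i (j - n)
      else if j < n then 0 else X' a (i - n) (j - n))"

lemma sum_lessThan_double:
  "(\<Sum>k<2 * n. f k) = (\<Sum>k<n. f k) + (\<Sum>k<n. f (n + k))" for f :: "nat \<Rightarrow> 'a::comm_monoid_add"
proof -
  have "(\<Sum>k<2 * n. f k) = (\<Sum>k<n. f k) + (\<Sum>k=n..<n + n. f k)"
    using sum.atLeastLessThan_concat[of 0 n "2 * n" f] by (simp add: lessThan_atLeast0 mult_2)
  also have "(\<Sum>k=n..<n + n. f k) = (\<Sum>k<n. f (n + k))"
    using sum.shift_bounds_nat_ivl[of f 0 n n] by (simp add: lessThan_atLeast0 add.commute)
  finally show ?thesis .
qed

lemma word_entry_blk:
  assumes "i < 2 * n" "j < 2 * n"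
  shows "word_entry (2 * n) (block_entries n X H X') w i j = (if i < n then if j < n then word_entry n X w i j else word_corner n X X' H w i (j - n)
      else if j < n then 0 else word_entry n X' w (i - n) (j - n))"
  using assms
proof (induction w arbitrary: i)
  case Nil
  then show ?case by auto
next
  case (Cons a w)
  let ?B = "block_entries n X H X'"
  have bl: "?B a i k = (if i < n then X a i k else 0)" "?B a i (n + k) = (if i < n then H a i k else X' a (i - n) k)"
    if "k < n" for k using that by (auto simp: block_entries_def)
  have IH: "word_entry (2 * n) ?B w k j = (if j < n then word_entry n X w k j else word_corner n X X' H w k (j - n))"
    "word_entry (2 * n) ?B w (n + k) j = (if j < n then 0 else word_entry n X' w k (j - n))" if "k < n" for k
    using Cons.IH[of k] Cons.IH[of "n + k"] Cons.prems(2) that by auto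
  have "word_entry (2 * n) ?B (a # w) i j
    = (\<Sum>k<n. (if i < n then X a i k else 0) * (if j < n then word_entry n X w k j else word_corner n X X' H w k (j - n)))
    + (\<Sum>k<n. (if i < n then H a i k else X' a (i - n) k) * (if j < n then 0 else word_entry n X' w k (j - n)))"
    unfolding word_entry.simps sum_lessThan_double
    by (intro arg_cong2[where f = "(+)"] sum.cong refl) (simp_all only: lessThan_iff bl IH)
  then show ?case by auto
qed

text \<open>The triangular tuple with corner \<open>X - X'\<close> is conjugate to the block
  diagonal one by a unipotent matrix; the induction is the corresponding telescoping.\<close>

lemma word_corner_diff: "word_corner n X X' (\<lambda>a i j. X a i j - X' a i j) w i j = word_entry n X w i j - word_entry n X' w i j"
  by (induction w arbitrary: i) (simp_all add: ring_distribs sum_subtractf)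

lemma word_corner_0: "word_corner n X X' (\<lambda>a i j. 0) w i j = 0"
  by (induction w arbitrary: i) simp_all

text \<open>The coefficient of \<open>H a k l\<close> in the upper right block.\<close>

fun word_jacobian :: "nat \<Rightarrow> (nat \<Rightarrow> nat \<Rightarrow> nat \<Rightarrow> 'a::comm_ring_1) \<Rightarrow> (nat \<Rightarrow> nat \<Rightarrow> nat \<Rightarrow> 'a)
    \<Rightarrow> nat list \<Rightarrow> nat \<Rightarrow> nat \<Rightarrow> nat \<Rightarrow> nat \<Rightarrow> nat \<Rightarrow> 'a" where
  "word_jacobian n X X' [] a k l i j = 0"
| "word_jacobian n X X' (b # w) a k l i j = (\<Sum>k'<n. X b i k' * word_jacobian n X X' w a k l k' j)
      + (if a = b \<and> k = i then word_entry n X' w l j else 0)"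

lemma word_jacobian_hom:
  "comm_ring_hom h \<Longrightarrow> h (word_jacobian n X X' w a k l i j) = word_jacobian n (\<lambda>a i j. h (X a i j)) (\<lambda>a i j. h (X' a i j)) w a k l i j"
proof (induction w arbitrary: i j)
  case Nil
  then interpret comm_ring_hom h by simp
  show ?case by simp
next
  case (Cons b w)
  then interpret comm_ring_hom h by simp
  show ?case using Cons by (simp add: hom_sum hom_mult hom_add word_entry_hom)
qed

lemma word_corner_eq_sum_JW:
  assumes "set w \<subseteq> {..<N}" "i < n"
  shows "word_corner n X X' H w i j = (\<Sum>a<N. \<Sum>k<n. \<Sum>l<n. word_jacobian n X X' w a k l i j * H a k l)"
  using assms
proof (induction w arbitrary: i)
  case (Cons b w)
  have b: "b < N" using Cons.prems by simp
  have "(\<Sum>a<N. \<Sum>k<n. \<Sum>l<n. word_jacobian n X X' (b # w) a k l i j * H a k l)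
    = (\<Sum>a<N. \<Sum>k<n. \<Sum>l<n. \<Sum>k'<n. X b i k' * (word_jacobian n X X' w a k l k' j * H a k l))
     + (\<Sum>a<N. \<Sum>k<n. \<Sum>l<n. if a = b \<and> k = i then H a k l * word_entry n X' w l j else 0)"
    unfolding sum.distrib[symmetric] by (intro sum.cong refl) (simp add: ring_distribs sum_distrib_left mult_ac)
  also have "(\<Sum>a<N. \<Sum>k<n. \<Sum>l<n. \<Sum>k'<n. X b i k' * (word_jacobian n X X' w a k l k' j * H a k l))
    = (\<Sum>k'<n. \<Sum>a<N. \<Sum>k<n. \<Sum>l<n. X b i k' * (word_jacobian n X X' w a k l k' j * H a k l))"
  proof -
    have "(\<Sum>a<N. \<Sum>k<n. \<Sum>l<n. \<Sum>k'<n. f a k l k') = (\<Sum>k'<n. \<Sum>a<N. \<Sum>k<n. \<Sum>l<n. f a k l k')"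
      for f :: "nat \<Rightarrow> nat \<Rightarrow> nat \<Rightarrow> nat \<Rightarrow> 'a"
    proof -
      have "(\<Sum>a<N. \<Sum>k<n. \<Sum>l<n. \<Sum>k'<n. f a k l k') = (\<Sum>a<N. \<Sum>k<n. \<Sum>k'<n. \<Sum>l<n. f a k l k')"
        by (rule sum.cong[OF refl], rule sum.cong[OF refl], rule sum.swap)
      also have "\<dots> = (\<Sum>a<N. \<Sum>k'<n. \<Sum>k<n. \<Sum>l<n. f a k l k')"
        by (rule sum.cong[OF refl], rule sum.swap)
      also have "\<dots> = (\<Sum>k'<n. \<Sum>a<N. \<Sum>k<n. \<Sum>l<n. f a k l k')" by (rule sum.swap)
      finally show ?thesis .
    qed
    then show ?thesis .
  qed
  also have "\<dots> = (\<Sum>k'<n. X b i k' * word_corner n X X' H w k' j)"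
    using Cons by (intro sum.cong refl) (simp add: sum_distrib_left)
  also have "(\<Sum>a<N. \<Sum>k<n. \<Sum>l<n. if a = b \<and> k = i then H a k l * word_entry n X' w l j else 0)
    = (\<Sum>a<N. \<Sum>k<n. if a = b \<and> k = i then \<Sum>l<n. H b i l * word_entry n X' w l j else 0)"
    by (intro sum.cong refl) auto
  also have "\<dots> = (\<Sum>a<N. if a = b then \<Sum>l<n. H b i l * word_entry n X' w l j else 0)"
    using Cons.prems by (intro sum.cong refl) auto
  also have "\<dots> = (\<Sum>l<n. H b i l * word_entry n X' w l j)" using b by simp
  finally show ?case by simp
qed simp

text \<open>The Leibniz rule in the direction \<open>[Z, T]\<close> telescopes to the commutator of
  the whole word with \<open>T\<close>.\<close>

lemma word_corner_commutator:
  assumes "\<And>a i j. a \<in> set w \<Longrightarrow> i < n \<Longrightarrow> j < n \<Longrightarrow> H a i j = (\<Sum>k<n. Z a i k * T k j) - (\<Sum>k<n. T i k * Z a k j)"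
    and "i < n" "j < n"
  shows "word_corner n Z Z H w i j = (\<Sum>k<n. word_entry n Z w i k * T k j) - (\<Sum>k<n. T i k * word_entry n Z w k j)"
  using assms
proof (induction w arbitrary: i)
  case Nil
  have "(\<Sum>k<n. word_entry n Z [] i k * T k j) = (\<Sum>k<n. if i = k then T k j else 0)"
    "(\<Sum>k<n. T i k * word_entry n Z [] k j) = (\<Sum>k<n. if k = j then T i k else 0)"
    by (rule sum.cong, simp, simp)+
  then show ?case using Nil.prems by simp
next
  case (Cons a w)
  have "word_corner n Z Z H (a # w) i j = (\<Sum>k<n. Z a i k * ((\<Sum>l<n. word_entry n Z w k l * T l j) - (\<Sum>l<n. T k l * word_entry n Z w l j)))
     + (\<Sum>k<n. ((\<Sum>l<n. Z a i l * T l k) - (\<Sum>l<n. T i l * Z a l k)) * word_entry n Z w k j)"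
    using Cons by simp
  also have "\<dots> = (\<Sum>k<n. \<Sum>l<n. Z a i k * word_entry n Z w k l * T l j) - (\<Sum>k<n. \<Sum>l<n. Z a i k * T k l * word_entry n Z w l j)
     + ((\<Sum>k<n. \<Sum>l<n. Z a i l * T l k * word_entry n Z w k j) - (\<Sum>k<n. \<Sum>l<n. T i l * Z a l k * word_entry n Z w k j))"
    by (simp add: ring_distribs sum_subtractf sum_distrib_left sum_distrib_right mult.assoc)
  also have "(\<Sum>k<n. \<Sum>l<n. Z a i l * T l k * word_entry n Z w k j) = (\<Sum>k<n. \<Sum>l<n. Z a i k * T k l * word_entry n Z w l j)"
    by (rule sum.swap)
  also have "(\<Sum>k<n. \<Sum>l<n. Z a i k * word_entry n Z w k l * T l j) = (\<Sum>l<n. \<Sum>k<n. Z a i k * word_entry n Z w k l * T l j)"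
    by (rule sum.swap)
  also have "(\<Sum>k<n. \<Sum>l<n. T i l * Z a l k * word_entry n Z w k j) = (\<Sum>l<n. \<Sum>k<n. T i l * Z a l k * word_entry n Z w k j)"
    by (rule sum.swap)
  finally show ?case
    by (simp add: sum_distrib_left sum_distrib_right mult.assoc)
qed

section \<open>Noncommutative polynomials in matrix entries and their two-point Jacobians\<close>

definition poly_entry :: "(complex \<Rightarrow> 'a::comm_ring_1) \<Rightarrow> nat \<Rightarrow> (nat list \<Rightarrow> complex)
    \<Rightarrow> (nat \<Rightarrow> nat \<Rightarrow> nat \<Rightarrow> 'a) \<Rightarrow> nat \<Rightarrow> nat \<Rightarrow> 'a" where
  "poly_entry k n p X i j = (\<Sum>w | p w \<noteq> 0. k (p w) * word_entry n X w i j)"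

definition poly_jacobian :: "(complex \<Rightarrow> 'a::comm_ring_1) \<Rightarrow> nat \<Rightarrow> (nat list \<Rightarrow> complex)
    \<Rightarrow> (nat \<Rightarrow> nat \<Rightarrow> nat \<Rightarrow> 'a) \<Rightarrow> (nat \<Rightarrow> nat \<Rightarrow> nat \<Rightarrow> 'a) \<Rightarrow> nat \<Rightarrow> nat \<Rightarrow> nat \<Rightarrow> nat \<Rightarrow> nat \<Rightarrow> 'a" where
  "poly_jacobian k n p X X' a r s i j = (\<Sum>w | p w \<noteq> 0. k (p w) * word_jacobian n X X' w a r s i j)"

lemma poly_entry_hom: "comm_ring_hom h \<Longrightarrow> h (poly_entry k n p X i j) = poly_entry (\<lambda>c. h (k c)) n p (\<lambda>a i j. h (X a i j)) i j"
proof -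
  assume h: "comm_ring_hom h"
  then interpret comm_ring_hom h .
  show ?thesis by (simp add: poly_entry_def hom_sum hom_mult word_entry_hom[OF h])
qed

lemma poly_jacobian_hom: "comm_ring_hom h \<Longrightarrow> h (poly_jacobian k n p X X' a r s i j)
   = poly_jacobian (\<lambda>c. h (k c)) n p (\<lambda>a i j. h (X a i j)) (\<lambda>a i j. h (X' a i j)) a r s i j"
proof -
  assume h: "comm_ring_hom h"
  then interpret comm_ring_hom h .
  show ?thesis by (simp add: poly_jacobian_def hom_sum hom_mult word_jacobian_hom[OF h])
qed

lemma ncpoly_words: "p \<in> ncpoly N \<Longrightarrow> p w \<noteq> 0 \<Longrightarrow> set w \<subseteq> {..<N}"
  by (simp add: ncpoly_def)

lemma poly_entry_cong:
  assumes "p \<in> ncpoly N" "\<And>a i j. a < N \<Longrightarrow> i < n \<Longrightarrow> j < n \<Longrightarrow> X a i j = Y a i j" "i < n"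
  shows "poly_entry k n p X i j = poly_entry k n p Y i j"
  unfolding poly_entry_def
proof (intro sum.cong refl arg_cong[where f = "(*) _"] word_entry_cong)
  fix w a i j assume "w \<in> {w. p w \<noteq> 0}" "a \<in> set w" "i < n" "j < n"
  then show "X a i j = Y a i j" using ncpoly_words[OF assms(1), of w] assms(2) by auto
qed (use assms in auto)

lemma poly_entry_blk:
  assumes "i < 2 * n" "j < 2 * n"
  shows "poly_entry k (2 * n) p (block_entries n X H X') i j = (if i < n then if j < n then poly_entry k n p X i j
        else (\<Sum>w | p w \<noteq> 0. k (p w) * word_corner n X X' H w i (j - n))
      else if j < n then 0 else poly_entry k n p X' (i - n) (j - n))"
  unfolding poly_entry_def word_entry_blk[OF assms] by auto

lemma sum_UR_eq_JP:
  assumes "p \<in> ncpoly N" "i < n"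
  shows "(\<Sum>w | p w \<noteq> 0. k (p w) * word_corner n X X' H w i j) = (\<Sum>a<N. \<Sum>r<n. \<Sum>s<n. poly_jacobian k n p X X' a r s i j * H a r s)"
proof -
  have "(\<Sum>w | p w \<noteq> 0. k (p w) * word_corner n X X' H w i j)
    = (\<Sum>w | p w \<noteq> 0. \<Sum>a<N. \<Sum>r<n. \<Sum>s<n. k (p w) * word_jacobian n X X' w a r s i j * H a r s)"
  proof (rule sum.cong)
    fix w assume "w \<in> {w. p w \<noteq> 0}"
    then have "set w \<subseteq> {..<N}" using ncpoly_words[OF assms(1)] by simp
    then show "k (p w) * word_corner n X X' H w i j = (\<Sum>a<N. \<Sum>r<n. \<Sum>s<n. k (p w) * word_jacobian n X X' w a r s i j * H a r s)"
      using assms(2) by (simp add: word_corner_eq_sum_JW sum_distrib_left mult.assoc)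
  qed simp
  also have "\<dots> = (\<Sum>a<N. \<Sum>w | p w \<noteq> 0. \<Sum>r<n. \<Sum>s<n. k (p w) * word_jacobian n X X' w a r s i j * H a r s)"
    by (rule sum.swap)
  also have "\<dots> = (\<Sum>a<N. \<Sum>r<n. \<Sum>w | p w \<noteq> 0. \<Sum>s<n. k (p w) * word_jacobian n X X' w a r s i j * H a r s)"
    by (rule sum.cong[OF refl], rule sum.swap)
  also have "\<dots> = (\<Sum>a<N. \<Sum>r<n. \<Sum>s<n. \<Sum>w | p w \<noteq> 0. k (p w) * word_jacobian n X X' w a r s i j * H a r s)"
    by (rule sum.cong[OF refl], rule sum.cong[OF refl], rule sum.swap)
  finally show ?thesis by (simp add: poly_jacobian_def sum_distrib_right)
qed

text \<open>The corner for \<open>H = X - X'\<close>, written as linear in \<open>H\<close>; this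
  supplies \<open>J_diff\<close>.\<close>

lemma poly_entry_diff:
  assumes "p \<in> ncpoly N" "i < n"
  shows "poly_entry k n p X i j - poly_entry k n p X' i j = (\<Sum>a<N. \<Sum>r<n. \<Sum>s<n. poly_jacobian k n p X X' a r s i j * (X a r s - X' a r s))"
  unfolding sum_UR_eq_JP[OF assms, symmetric] word_corner_diff
  by (simp add: poly_entry_def right_diff_distrib sum_subtractf)

section \<open>Numbering of matrix entries\<close>

lemma sum_div_mod: "(\<Sum>v<M * n. f (v div n) (v mod n)) = (\<Sum>a<M. \<Sum>l<n. f a l)"
  for f :: "nat \<Rightarrow> nat \<Rightarrow> 'a::comm_monoid_add"
proof (induction M)
  case (Suc M)
  have "(\<Sum>v<Suc M * n. f (v div n) (v mod n)) = (\<Sum>v<M * n. f (v div n) (v mod n)) + (\<Sum>v=M * n..<M * n + n. f (v div n) (v mod n))"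
    using sum.atLeastLessThan_concat[of 0 "M * n" "M * n + n" "\<lambda>v. f (v div n) (v mod n)"]
    by (simp add: lessThan_atLeast0 add.commute)
  also have "(\<Sum>v=M * n..<M * n + n. f (v div n) (v mod n)) = (\<Sum>l=0..<n. f ((l + M * n) div n) ((l + M * n) mod n))"
    using sum.shift_bounds_nat_ivl[of "\<lambda>v. f (v div n) (v mod n)" 0 "M * n" n] by (simp add: add.commute)
  also have "\<dots> = (\<Sum>l<n. f M l)"
    by (intro sum.cong) auto
  finally show ?case by (simp add: Suc.IH)
qed simp

definition flatten_index :: "nat \<Rightarrow> nat \<Rightarrow> nat \<Rightarrow> nat \<Rightarrow> nat" where
  "flatten_index n a i j = (a * n + i) * n + j"

lemma flatten_index_decode: "flatten_index n (v div n div n) (v div n mod n) (v mod n) = v"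
  by (simp add: flatten_index_def)

lemma decode_enc:
  assumes "i < n" "j < n"
  shows "flatten_index n a i j mod n = j" "flatten_index n a i j div n mod n = i" "flatten_index n a i j div n div n = a"
  using assms by (simp_all add: flatten_index_def)

lemma flatten_index_less:
  assumes "a < N" "i < n" "j < n"
  shows "flatten_index n a i j < N * n * n"
proof -
  have "a * n + i < Suc a * n" using assms by simp
  also have "\<dots> \<le> N * n" using assms by (intro mult_le_mono1) simp
  finally have "Suc (a * n + i) * n \<le> N * n * n" by (intro mult_le_mono1) simp
  then show ?thesis using assms(3) by (simp add: flatten_index_def)
qed

lemma sum_enc: "(\<Sum>v<N * n * n. f (v div n div n) (v div n mod n) (v mod n)) = (\<Sum>a<N. \<Sum>i<n. \<Sum>j<n. f a i j)"
  for f :: "nat \<Rightarrow> nat \<Rightarrow> nat \<Rightarrow> 'a::comm_monoid_add"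
  using sum_div_mod[of "\<lambda>u. f (u div n) (u mod n)" n "N * n"] sum_div_mod[of "\<lambda>a i. \<Sum>j<n. f a i j" n N]
  by simp

subsection \<open>The inverse at a fixed matrix size\<close>

text \<open>Injectivity at equal sizes in terms of entry functions; their values beyond the index
  bounds are arbitrary, hence the entrywise conclusion.\<close>

locale free_inj =
  fixes N :: nat and P :: "(nat list \<Rightarrow> complex) list"
  assumes fp: "fpmap N P"
    and inj: "\<And>n X Y a i j. n \<ge> 1 \<Longrightarrow>
      (\<And>a i j. a < N \<Longrightarrow> i < n \<Longrightarrow> j < n \<Longrightarrow> poly_entry (\<lambda>c. c) n (P ! a) X i j = poly_entry (\<lambda>c. c) n (P ! a) Y i j) \<Longrightarrow>
      a < N \<Longrightarrow> i < n \<Longrightarrow> j < n \<Longrightarrow> X a i j = Y a i j"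
begin

lemma P_nc: "a < N \<Longrightarrow> P ! a \<in> ncpoly N"
  using fp by (auto simp: fpmap_def)

end

locale free_inj_level = free_inj +
  fixes n :: nat
  assumes n: "n \<ge> 1"
begin

definition m where "m = N * n * n"

definition unflatten :: "(nat \<Rightarrow> 'a) \<Rightarrow> nat \<Rightarrow> nat \<Rightarrow> nat \<Rightarrow> 'a" where
  "unflatten x a i j = x (flatten_index n a i j)"

definition F :: "nat \<Rightarrow> mp" where
  "F v = (if v < m then poly_entry Const n (P ! (v div n div n)) (unflatten Var) (v div n mod n) (v mod n) else Var v)"

text \<open>Even variables carry the first tuple and odd ones the second, matching
  \<open>pair\<close>; rows belong to output entries, columns to entries of
  \<open>H\<close>.\<close>

definition J :: "nat \<Rightarrow> nat \<Rightarrow> mp" where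
  "J v u = poly_jacobian Const n (P ! (v div n div n)) (unflatten (\<lambda>v. Var (2 * v))) (unflatten (\<lambda>v. Var (Suc (2 * v))))
     (u div n div n) (u div n mod n) (u mod n) (v div n mod n) (v mod n)"

lemma decode_less:
  assumes "v < m"
  shows "v div n div n < N" "v div n mod n < n" "v mod n < n"
proof -
  have "v div n < N * n" using assms n by (simp add: m_def less_mult_imp_div_less)
  then show "v div n div n < N" by (rule less_mult_imp_div_less)
qed (use n in auto)

lemma mp_eval_F:
  assumes k: "comm_ring_hom k" and v: "v < m"
  shows "mp_eval k x (F v) = poly_entry k n (P ! (v div n div n)) (unflatten x) (v div n mod n) (v mod n)"
  using v by (simp add: F_def poly_entry_hom[OF mp_eval_hom[OF k]] mp_eval_simps[OF k] unflatten_def[abs_def])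

lemma mp_eval_F_enc:
  assumes k: "comm_ring_hom k" and "a < N" "i < n" "j < n"
  shows "mp_eval k x (F (flatten_index n a i j)) = poly_entry k n (P ! a) (unflatten x) i j"
  using assms by (subst mp_eval_F[OF k]) (simp_all add: m_def flatten_index_less decode_enc)

lemma mp_eval_J:
  assumes k: "comm_ring_hom k"
  shows "mp_eval k x (J v u) = poly_jacobian k n (P ! (v div n div n)) (unflatten (\<lambda>v. x (2 * v))) (unflatten (\<lambda>v. x (Suc (2 * v))))
     (u div n div n) (u div n mod n) (u mod n) (v div n mod n) (v mod n)"
  by (simp add: J_def poly_jacobian_hom[OF mp_eval_hom[OF k]] mp_eval_simps[OF k] unflatten_def[abs_def])

definition A where "A = mat m m (\<lambda>(v, u). J v u)"

lemma A_carrier: "A \<in> carrier_mat m m" by (simp add: A_def)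

text \<open>A kernel vector \<open>H\<close> at a pair of points gives two block triangular tuples
  of size \<open>2 * n\<close>, with corners \<open>H\<close> and 0, that have the same image.
  Injectivity at the doubled size makes \<open>H\<close> vanish.\<close>

lemma det_A_nonvanishing: "ceval z (det A) \<noteq> 0"
proof
  assume det0: "ceval z (det A) = 0"
  let ?X = "unflatten (\<lambda>v. z (2 * v))" and ?X' = "unflatten (\<lambda>v. z (Suc (2 * v)))"
  have "det (map_mat (ceval z) A) = 0"
    using comm_ring_hom.hom_det[OF mp_eval_hom[OF comm_ring_hom_id], of z A] det0 by simp
  then obtain h where h: "h \<in> carrier_vec m" "h \<noteq> 0\<^sub>v m" "map_mat (ceval z) A *\<^sub>v h = 0\<^sub>v m"
    using det_0_iff_vec_prod_zero[of "map_mat (ceval z) A" m] A_carrier by auto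
  have row: "(\<Sum>u<m. ceval z (J v u) * h $ u) = 0" if "v < m" for v
  proof -
    have "0 = (map_mat (ceval z) A *\<^sub>v h) $ v" using h(3) that by simp
    also have "\<dots> = (\<Sum>u = 0..<m. ceval z (J v u) * h $ u)"
      using h(1) that by (simp add: A_def scalar_prod_def)
    finally show ?thesis by (simp add: lessThan_atLeast0)
  qed
  define H where "H a i j = h $ (flatten_index n a i j)" for a i j
  have JH: "(\<Sum>b<N. \<Sum>r<n. \<Sum>s<n. poly_jacobian (\<lambda>c. c) n (P ! a) ?X ?X' b r s i j * H b r s) = 0"
    if "a < N" "i < n" "j < n" for a i j
    unfolding sum_enc[symmetric] H_def flatten_index_decode m_def[symmetric]
    using row[of "flatten_index n a i j"] that
    by (simp add: mp_eval_J[OF comm_ring_hom_id] decode_enc flatten_index_less m_def)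
  have eq: "poly_entry (\<lambda>c. c) (2 * n) (P ! a) (block_entries n ?X H ?X') i j = poly_entry (\<lambda>c. c) (2 * n) (P ! a) (block_entries n ?X (\<lambda>_ _ _. 0) ?X') i j"
    if "a < N" "i < 2 * n" "j < 2 * n" for a i j
  proof (cases "i < n \<and> \<not> j < n")
    case True
    then have j: "i < n" "j - n < n" using that by auto
    have "(\<Sum>w | (P ! a) w \<noteq> 0. (P ! a) w * word_corner n ?X ?X' H w i (j - n)) = 0"
      by (simp only: sum_UR_eq_JP[OF P_nc[OF that(1)] j(1), of "\<lambda>c. c"] JH[OF that(1) j])
    then show ?thesis using True by (simp add: poly_entry_blk that word_corner_0)
  qed (auto simp: poly_entry_blk that)
  have "H a i j = 0" if "a < N" "i < n" "j < n" for a i j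
    using inj[OF _ eq, of a i "n + j"] that by (simp add: block_entries_def)
  then have "h $ u = 0" if "u < m" for u
    using decode_less[OF that] flatten_index_decode[of n u] by (metis H_def)
  then have "h = 0\<^sub>v m" using h(1) by (intro eq_vecI) auto
  with h(2) show False by contradiction
qed

text \<open>The determinant never vanishes, so it is a nonzero constant, and the adjugate divided by
  it is a polynomial inverse.\<close>

lemma J_inverse_exists: "\<exists>N'. poly_mono {..<m} F J N'"
proof -
  obtain c where det: "det A = Const c"
    using nonvanishing_imp_Const[OF det_A_nonvanishing] by blast
  then have c: "c \<noteq> 0" using det_A_nonvanishing[of undefined] by (auto simp: ceval_simps)
  define N' where "N' a b = Const (1 / c) * adj_mat A $$ (a, b)" for a b
  note adj = adj_mat[OF A_carrier]
  have cc: "Const (1 / c) * Const c = 1"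
    using c by (simp add: Const_def mult_single)
  have one: "Const (1 / c) * (det A \<cdot>\<^sub>m 1\<^sub>m m) $$ (a, b) = (if a = b then 1 else 0)" if "a < m" "b < m" for a b
    using that by (auto simp: det cc)
  have "poly_mono {..<m} F J N'"
  proof
    fix b assume "b \<in> {..<m}"
    then have b: "b < m" by simp
    have "subst (\<lambda>v. Var (2 * v)) (F b) - subst (\<lambda>v. Var (Suc (2 * v))) (F b)
      = (\<Sum>a<N. \<Sum>r<n. \<Sum>s<n. poly_jacobian Const n (P ! (b div n div n)) (unflatten (\<lambda>v. Var (2 * v))) (unflatten (\<lambda>v. Var (Suc (2 * v))))
           a r s (b div n mod n) (b mod n) * (Var (2 * flatten_index n a r s) - Var (Suc (2 * flatten_index n a r s))))"
      unfolding mp_eval_F[OF comm_ring_hom_Const b]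
      by (subst poly_entry_diff[OF P_nc]) (use decode_less[OF b] in \<open>auto simp: unflatten_def\<close>)
    also have "\<dots> = (\<Sum>a<m. J b a * (Var (2 * a) - Var (Suc (2 * a))))"
      unfolding sum_enc[symmetric] flatten_index_decode m_def[symmetric] J_def ..
    finally show "subst (\<lambda>v. Var (2 * v)) (F b) - subst (\<lambda>v. Var (Suc (2 * v))) (F b)
      = (\<Sum>a\<in>{..<m}. J b a * (Var (2 * a) - Var (Suc (2 * a))))" .
  next
    fix a c' assume ac: "a \<in> {..<m}" "c' \<in> {..<m}"
    have "(\<Sum>b<m. adj_mat A $$ (a, b) * J b c') = (adj_mat A * A) $$ (a, c')"
      using ac adj(1) by (simp add: A_def scalar_prod_def lessThan_atLeast0)
    then show "(\<Sum>b\<in>{..<m}. N' a b * J b c') = (if a = c' then 1 else 0)"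
      using one[of a c'] ac by (simp add: N'_def mult.assoc adj flip: sum_distrib_left)
    have "(\<Sum>b<m. J a b * adj_mat A $$ (b, c')) = (A * adj_mat A) $$ (a, c')"
      using ac adj(1) by (simp add: A_def scalar_prod_def lessThan_atLeast0)
    then show "(\<Sum>b\<in>{..<m}. J a b * N' b c') = (if a = c' then 1 else 0)"
      using one[of a c'] ac by (simp add: N'_def mult.left_commute adj flip: sum_distrib_left)
  qed (auto simp: F_def)
  then show ?thesis by blast
qed

text \<open>Stated for values in the polynomials in \<open>t\<close>, since the inverse will be
  followed along \<open>tY\<close>.\<close>

lemma level_inverse:
  "\<exists>Q :: nat \<Rightarrow> mp. \<forall>y a i j. a < N \<longrightarrow> i < n \<longrightarrow> j < n \<longrightarrow>
     poly_entry (\<lambda>c. [:c:]) n (P ! a) (unflatten (\<lambda>v. mp_eval (\<lambda>c. [:c:]) y (Q v))) i j = y (flatten_index n a i j)"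
proof -
  obtain N' where "poly_mono {..<m} F J N'" using J_inverse_exists by blast
  then interpret poly_mono "{..<m}" F J N' .
  obtain Q where Q: "\<And>v. subst Q (F v) = Var v" using polynomial_inverse_exists by blast
  have "poly_entry (\<lambda>c. [:c:]) n (P ! a) (unflatten (\<lambda>v. mp_eval (\<lambda>c. [:c:]) y (Q v))) i j = y (flatten_index n a i j)"
    if "a < N" "i < n" "j < n" for y :: "nat \<Rightarrow> complex poly" and a i j
  proof -
    have "mp_eval (\<lambda>c. [:c:]) y (subst Q (F (flatten_index n a i j))) = y (flatten_index n a i j)"
      unfolding Q by (simp add: mp_eval_simps[OF const_poly_hom])
    then show ?thesis
      unfolding mp_eval_subst[OF const_poly_hom] mp_eval_F_enc[OF const_poly_hom that] .
  qed
  then show ?thesis by blast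
qed

end

subsection \<open>The inverse as a noncommutative polynomial\<close>

text \<open>Lists of terms, in which words may repeat, make sums, products and truncation simple;
  here equal words are collected.\<close>

definition word_coeff :: "(complex \<times> nat list) list \<Rightarrow> nat list \<Rightarrow> complex" where
  "word_coeff e w = (\<Sum>(c, u)\<leftarrow>e. if u = w then c else 0)"

lemma word_coeff_support: "{w. word_coeff e w \<noteq> 0} \<subseteq> snd ` set e"
proof
  fix w assume "w \<in> {w. word_coeff e w \<noteq> 0}"
  moreover have "w \<notin> snd ` set e \<Longrightarrow> word_coeff e w = 0"
    by (induction e) (auto simp: word_coeff_def)
  ultimately show "w \<in> snd ` set e" by auto
qed

lemma word_coeff_ncpoly:
  assumes "\<And>c w. (c, w) \<in> set e \<Longrightarrow> set w \<subseteq> {..<N}"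
  shows "word_coeff e \<in> ncpoly N"
proof -
  have "finite {w. word_coeff e w \<noteq> 0}" by (rule finite_subset[OF word_coeff_support]) simp
  moreover have "set w \<subseteq> {..<N}" if "word_coeff e w \<noteq> 0" for w
  proof -
    have "w \<in> snd ` set e" using word_coeff_support[of e] that by blast
    then obtain c where "(c, w) \<in> set e" by force
    then show ?thesis by (rule assms)
  qed
  ultimately show ?thesis unfolding ncpoly_def by blast
qed

lemma poly_entry_word_coeff: "poly_entry (\<lambda>c. c) n (word_coeff e) X i j = (\<Sum>(c, w)\<leftarrow>e. c * word_entry n X w i j)"
proof -
  have "poly_entry (\<lambda>c. c) n (word_coeff e) X i j = (\<Sum>w\<in>snd ` set e. word_coeff e w * word_entry n X w i j)"
    unfolding poly_entry_def by (rule sum.mono_neutral_left) (use word_coeff_support in auto)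
  also have "\<dots> = (\<Sum>(c, w)\<leftarrow>e. c * word_entry n X w i j)"
  proof -
    have "finite S \<Longrightarrow> snd ` set e \<subseteq> S \<Longrightarrow>
      (\<Sum>w\<in>S. word_coeff e w * word_entry n X w i j) = (\<Sum>(c, w)\<leftarrow>e. c * word_entry n X w i j)" for S
    proof (induction e)
      case Nil
      then show ?case by (simp add: word_coeff_def)
    next
      case (Cons x e)
      obtain c u where x: "x = (c, u)" by fastforce
      have "(\<Sum>w\<in>S. word_coeff (x # e) w * word_entry n X w i j)
        = (\<Sum>w\<in>S. (if u = w then c * word_entry n X w i j else 0) + word_coeff e w * word_entry n X w i j)"
        by (intro sum.cong) (auto simp: word_coeff_def x ring_distribs)
      also have "\<dots> = c * word_entry n X u i j + (\<Sum>(c, w)\<leftarrow>e. c * word_entry n X w i j)"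
        using Cons by (simp add: sum.distrib x)
      finally show ?case by (simp add: x)
    qed
    then show ?thesis by simp
  qed
  finally show ?thesis .
qed

section \<open>Matrix functions given by noncommutative polynomials at \<open>tY\<close>\<close>

context free_inj_level
begin

text \<open>The factor \<open>t\<close> to the power \<open>length w\<close> records evaluation at \<open>tY\<close>.\<close>

definition list_value :: "(complex \<times> nat list) list \<Rightarrow> (nat \<Rightarrow> complex) \<Rightarrow> nat \<Rightarrow> nat \<Rightarrow> complex poly" where
  "list_value e Y i j = (\<Sum>(c, w)\<leftarrow>e. Polynomial.monom (c * word_entry n (unflatten Y) w i j) (length w))"

text \<open>One term list has to serve all \<open>Y\<close> and all entries: this is what makes
  \<open>g\<close> a noncommutative polynomial.\<close>

definition represented :: "((nat \<Rightarrow> complex) \<Rightarrow> nat \<Rightarrow> nat \<Rightarrow> complex poly) \<Rightarrow> bool" where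
  "represented g \<longleftrightarrow> (\<exists>e. (\<forall>(c, w)\<in>set e. set w \<subseteq> {..<N}) \<and> (\<forall>Y. \<forall>i<n. \<forall>j<n. g Y i j = list_value e Y i j))"

lemma list_value_Nil [simp]: "list_value [] Y i j = 0"
  and list_value_Cons [simp]: "list_value ((c, w) # e) Y i j = Polynomial.monom (c * word_entry n (unflatten Y) w i j) (length w) + list_value e Y i j"
  and list_value_append: "list_value (e @ f) Y i j = list_value e Y i j + list_value f Y i j"
  by (simp_all add: list_value_def)

text \<open>Degree in \<open>t\<close> is word length, so cutting at degree \<open>d\<close> and
  setting \<open>t = 1\<close> drops the longer words.\<close>

lemma sum_coeff_list_value: "(\<Sum>k\<le>d. coeff (list_value e Y i j) k)
   = (\<Sum>(c, w)\<leftarrow>filter (\<lambda>(c, w). length w \<le> d) e. c * word_entry n (unflatten Y) w i j)"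
proof (induction e)
  case (Cons x e)
  then show ?case by (cases x) (simp add: sum.distrib)
qed simp

lemma represented_cong:
  assumes "\<And>Y i j. i < n \<Longrightarrow> j < n \<Longrightarrow> g Y i j = g' Y i j"
  shows "represented g \<longleftrightarrow> represented g'"
  unfolding represented_def using assms by auto

lemma represented_0: "represented (\<lambda>Y i j. 0)"
  unfolding represented_def by (rule exI[of _ "[]"]) simp

lemma represented_add:
  assumes "represented g" "represented h"
  shows "represented (\<lambda>Y i j. g Y i j + h Y i j)"
proof -
  obtain e f where "\<forall>(c, w)\<in>set e. set w \<subseteq> {..<N}" "\<forall>Y. \<forall>i<n. \<forall>j<n. g Y i j = list_value e Y i j"
    "\<forall>(c, w)\<in>set f. set w \<subseteq> {..<N}" "\<forall>Y. \<forall>i<n. \<forall>j<n. h Y i j = list_value f Y i j"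
    using assms unfolding represented_def by blast
  then show ?thesis unfolding represented_def by (intro exI[of _ "e @ f"]) (auto simp: list_value_append)
qed

lemma represented_term:
  "set w \<subseteq> {..<N} \<Longrightarrow> represented (\<lambda>Y i j. Polynomial.monom (c * word_entry n (unflatten Y) w i j) (length w))"
  unfolding represented_def by (rule exI[of _ "[(c, w)]"]) simp

lemma represented_sum:
  "(\<And>x. x \<in> S \<Longrightarrow> represented (g x)) \<Longrightarrow> represented (\<lambda>Y i j. \<Sum>x\<in>S. g x Y i j)"
  by (induction S rule: infinite_finite_induct) (auto intro: represented_0 represented_add)

lemma represented_mult:
  assumes "represented g" "represented h"
  shows "represented (\<lambda>Y i j. \<Sum>k<n. g Y i k * h Y k j)"
proof -
  obtain e where e: "\<forall>(c, w)\<in>set e. set w \<subseteq> {..<N}" "\<And>Y i j. i < n \<Longrightarrow> j < n \<Longrightarrow> g Y i j = list_value e Y i j"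
    using assms(1) unfolding represented_def by metis
  obtain f where f: "\<forall>(c, w)\<in>set f. set w \<subseteq> {..<N}" "\<And>Y i j. i < n \<Longrightarrow> j < n \<Longrightarrow> h Y i j = list_value f Y i j"
    using assms(2) unfolding represented_def by metis
  have single: "represented (\<lambda>Y i j. \<Sum>k<n. Polynomial.monom (c * word_entry n (unflatten Y) u i k) (length u) * list_value f Y k j)"
    if "set u \<subseteq> {..<N}" for c u
    using f(1)
  proof (induction f)
    case Nil
    then show ?case by (simp add: represented_0)
  next
    case (Cons x f)
    obtain d w where x: "x = (d, w)" by fastforce
    let ?t = "\<lambda>Y i j. Polynomial.monom ((c * d) * word_entry n (unflatten Y) (u @ w) i j) (length (u @ w))"
    let ?r = "\<lambda>Y i j. \<Sum>k<n. Polynomial.monom (c * word_entry n (unflatten Y) u i k) (length u) * list_value f Y k j"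
    have "represented (\<lambda>Y i j. ?t Y i j + ?r Y i j)"
      using Cons that by (intro represented_add represented_term) (auto simp: x)
    moreover have "?t Y i j + ?r Y i j
      = (\<Sum>k<n. Polynomial.monom (c * word_entry n (unflatten Y) u i k) (length u) * list_value (x # f) Y k j)" if "i < n" for Y i j
    proof -
      have "?t Y i j = (\<Sum>k<n. Polynomial.monom ((c * d) * (word_entry n (unflatten Y) u i k * word_entry n (unflatten Y) w k j)) (length (u @ w)))"
        using that by (simp only: word_entry_append sum_distrib_left monom_sum)
      then show ?thesis
        by (simp add: x ring_distribs sum.distrib mult_monom mult_ac)
    qed
    ultimately show ?case
      using represented_cong[of "\<lambda>Y i j. ?t Y i j + ?r Y i j"] by simp
  qed
  have "represented (\<lambda>Y i j. \<Sum>k<n. list_value e Y i k * list_value f Y k j)"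
    using e(1)
  proof (induction e)
    case Nil
    then show ?case by (simp add: represented_0)
  next
    case (Cons x e)
    then show ?case
      by (cases x) (auto simp: ring_distribs sum.distrib intro!: represented_add single)
  qed
  then show ?thesis
    by (rule iffD1[OF represented_cong, rotated]) (simp add: e f)
qed

lemma represented_scalar: "represented (\<lambda>Y i j. if i = j then [:c:] else 0)"
proof -
  have "represented (\<lambda>Y i j. Polynomial.monom (c * word_entry n (unflatten Y) [] i j) (length ([] :: nat list)))"
    by (rule represented_term) simp
  then show ?thesis
    by (rule iffD1[OF represented_cong, rotated]) (simp add: monom_0)
qed

lemma represented_smult:
  assumes "represented g"
  shows "represented (\<lambda>Y i j. [:c:] * g Y i j)"
proof (rule iffD1[OF represented_cong represented_mult[OF represented_scalar[of c] assms]])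
  fix Y i j assume i: "i < n"
  have "(\<Sum>k<n. (if i = k then [:c:] else 0) * g Y k j) = (\<Sum>k<n. if i = k then [:c:] * g Y k j else 0)"
    by (intro sum.cong) auto
  then show "(\<Sum>k<n. (if i = k then [:c:] else 0) * g Y k j) = [:c:] * g Y i j" using i by simp
qed

lemma represented_var: "a < N \<Longrightarrow> represented (\<lambda>Y i j. [:0, Y (flatten_index n a i j):])"
  by (rule iffD1[OF represented_cong represented_term[of "[a]" 1]])
    (auto simp: word_entry_single unflatten_def monom_Suc monom_0 simp del: word_entry.simps)

lemma represented_word:
  assumes "\<And>a. a < N \<Longrightarrow> represented (g a)" "set w \<subseteq> {..<N}"
  shows "represented (\<lambda>Y i j. word_entry n (\<lambda>a i j. g a Y i j) w i j)"
  using assms(2)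
proof (induction w)
  case Nil
  show ?case using represented_scalar[of 1] unfolding word_entry.simps pCons_one .
next
  case (Cons a w)
  then show ?case using represented_mult[OF assms(1)[of a] Cons.IH] by simp
qed

lemma represented_PE:
  assumes "\<And>a. a < N \<Longrightarrow> represented (g a)" "p \<in> ncpoly N"
  shows "represented (\<lambda>Y i j. poly_entry (\<lambda>c. [:c:]) n p (\<lambda>a i j. g a Y i j) i j)"
  unfolding poly_entry_def using ncpoly_words[OF assms(2)]
  by (intro represented_sum represented_smult represented_word assms) auto

end

section \<open>The scalar root of \<open>P\<close> and its Jacobian\<close>

context free_inj
begin

text \<open>The value of the inverse for size 1 at the origin.\<close>

lemma scalar_root: "\<exists>s. \<forall>b<N. poly_entry (\<lambda>c. c) 1 (P ! b) (\<lambda>a i j. s a) 0 0 = 0"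
proof -
  interpret free_inj_level N P 1 by unfold_locales simp
  obtain Q :: "nat \<Rightarrow> mp" where Q: "\<And>y a. a < N \<Longrightarrow>
     poly_entry (\<lambda>c. [:c:]) 1 (P ! a) (unflatten (\<lambda>v. mp_eval (\<lambda>c. [:c:]) y (Q v))) 0 0 = y (flatten_index 1 a 0 0)"
    using level_inverse by auto
  define s where "s a = poly (mp_eval (\<lambda>c. [:c:]) (\<lambda>_. 0) (Q a)) 0" for a
  have "poly_entry (\<lambda>c. c) 1 (P ! b) (\<lambda>a i j. s a) 0 0 = 0" if "b < N" for b
  proof -
    have "poly_entry (\<lambda>c. c) 1 (P ! b) (\<lambda>a i j. poly (unflatten (\<lambda>v. mp_eval (\<lambda>c. [:c:]) (\<lambda>_. 0) (Q v)) a i j) 0) 0 0 = 0"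
      using poly_entry_hom[OF poly_eval_hom[of 0], of "\<lambda>c. [:c:]" 1 "P ! b" "unflatten (\<lambda>v. mp_eval (\<lambda>c. [:c:]) (\<lambda>_. 0) (Q v))" 0 0]
      by (simp add: Q[OF that] del: One_nat_def)
    moreover have "poly_entry (\<lambda>c. c) 1 (P ! b) (\<lambda>a i j. poly (unflatten (\<lambda>v. mp_eval (\<lambda>c. [:c:]) (\<lambda>_. 0) (Q v)) a i j) 0) 0 0
       = poly_entry (\<lambda>c. c) 1 (P ! b) (\<lambda>a i j. s a) 0 0"
    proof (rule poly_entry_cong[OF P_nc[OF that]])
      fix a i j :: nat assume "i < 1" "j < 1"
      then show "poly (unflatten (\<lambda>v. mp_eval (\<lambda>c. [:c:]) (\<lambda>_. 0) (Q v)) a i j) 0 = s a"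
        unfolding unflatten_def by (simp add: s_def flatten_index_def)
    qed simp
    ultimately show ?thesis by simp
  qed
  then show ?thesis by blast
qed

text \<open>The inverse Jacobian for size 1, evaluated with both points equal to
  \<open>s\<close>.\<close>

lemma scalar_jacobian_inverse:
  "\<exists>M. \<forall>a<N. \<forall>c<N. (\<Sum>b<N. M a b * poly_jacobian (\<lambda>c. c) 1 (P ! b) (\<lambda>a i j. s a) (\<lambda>a i j. s a) c 0 0 0 0) = (if a = c then 1 else 0)"
proof -
  interpret free_inj_level N P 1 by unfold_locales simp
  obtain N' where "poly_mono {..<m} F J N'" using J_inverse_exists by blast
  then interpret poly_mono "{..<m}" F J N' .
  let ?z = "\<lambda>v. s (v div 2)"
  have m: "m = N" unfolding m_def by simp
  have unflatten: "unflatten (\<lambda>v. s v) = (\<lambda>a i j. s (a + i + j))" unfolding unflatten_def[abs_def] by (simp add: flatten_index_def)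
  have word_jacobian: "word_jacobian 1 (\<lambda>a i j. s (a + i + j)) (\<lambda>a i j. s (a + i + j)) w c 0 0 0 0 = word_jacobian 1 (\<lambda>a i j. s a) (\<lambda>a i j. s a) w c 0 0 0 0" for w c
  proof (induction w)
    case (Cons b w)
    have "word_entry 1 (\<lambda>a i j. s (a + i + j)) w 0 0 = word_entry 1 (\<lambda>a i j. s a) w 0 0"
      by (rule word_entry_cong) auto
    then show ?case using Cons by simp
  qed simp
  have "(\<Sum>b<N. ceval ?z (N' a b) * poly_jacobian (\<lambda>c. c) 1 (P ! b) (\<lambda>a i j. s a) (\<lambda>a i j. s a) c 0 0 0 0) = (if a = c then 1 else 0)"
    if "a < N" "c < N" for a c
  proof -
    have "ceval ?z (\<Sum>b<N. N' a b * J b c) = ceval ?z (if a = c then 1 else 0)"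
      using NJ[of a c] that by (simp add: m del: One_nat_def)
    then have "(\<Sum>b<N. ceval ?z (N' a b) * ceval ?z (J b c)) = (if a = c then 1 else 0)"
      by (simp only: ceval_simps) (simp add: ceval_simps split: if_splits)
    then show ?thesis
      by (simp add: mp_eval_J[OF comm_ring_hom_id] unflatten poly_jacobian_def word_jacobian del: One_nat_def)
  qed
  then show ?thesis by (intro exI[of _ "\<lambda>a b. ceval ?z (N' a b)"]) (simp del: One_nat_def)
qed

end

lemma word_entry_scalar:
  "i < n \<Longrightarrow> word_entry n (\<lambda>a i j. if i = j then s a else 0) w i j = (if i = j then word_entry 1 (\<lambda>a i j. s a) w 0 0 else 0)"
proof (induction w arbitrary: i)
  case (Cons a w)
  have "word_entry n (\<lambda>a i j. if i = j then s a else 0) (a # w) i j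
    = (\<Sum>k<n. if i = k then s a * word_entry n (\<lambda>a i j. if i = j then s a else 0) w k j else 0)"
    unfolding word_entry.simps by (intro sum.cong) auto
  then show ?case using Cons by simp
qed simp

text \<open>At scalar tuples the Jacobian for size \<open>n\<close> is the one for size 1 tensored
  with an identity. One complex matrix therefore inverts it, which keeps the Newton iteration
  noncommutative polynomial.\<close>

lemma word_jacobian_scalar:
  "i < n \<Longrightarrow> k < n \<Longrightarrow> l < n \<Longrightarrow> word_jacobian n (\<lambda>a i j. if i = j then s a else 0) (\<lambda>a i j. if i = j then s a else 0) w c k l i j
    = (if k = i \<and> l = j then word_jacobian 1 (\<lambda>a i j. s a) (\<lambda>a i j. s a) w c 0 0 0 0 else 0)"
proof (induction w arbitrary: i)
  case (Cons b w)
  let ?S = "\<lambda>a i j. if i = j then s a else 0"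
  have "(\<Sum>k'<n. ?S b i k' * word_jacobian n ?S ?S w c k l k' j) = (\<Sum>k'<n. if i = k' then s b * word_jacobian n ?S ?S w c k l k' j else 0)"
    by (intro sum.cong) auto
  also have "\<dots> = s b * word_jacobian n ?S ?S w c k l i j" using Cons.prems by simp
  finally have "word_jacobian n ?S ?S (b # w) c k l i j = s b * word_jacobian n ?S ?S w c k l i j + (if c = b \<and> k = i then word_entry n ?S w l j else 0)"
    by simp
  then show ?case using Cons by (auto simp: word_entry_scalar)
qed simp

section \<open>The truncated Newton iteration\<close>

context free_inj_level
begin

text \<open>Along \<open>tY\<close> the inverse is a polynomial \<open>q Y\<close> in
  \<open>t\<close> of degree at most \<open>d\<close>. The Newton iterates \<open>G k\<close> are
  noncommutative polynomials at \<open>tY\<close> and agree with \<open>q Y\<close> modulo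
  \<open>t ^ (k + 1)\<close>; so the part of \<open>G d\<close> of word length at most
  \<open>d\<close> computes \<open>q Y\<close>, and \<open>t = 1\<close> gives the inverse at
  \<open>Y\<close>.\<close>

lemma nc_level_inverse:
  "\<exists>Q. (\<forall>a<N. Q a \<in> ncpoly N) \<and> (\<forall>Y. \<forall>a<N. \<forall>i<n. \<forall>j<n.
     poly_entry (\<lambda>c. c) n (P ! a) (\<lambda>a i j. poly_entry (\<lambda>c. c) n (Q a) (unflatten Y) i j) i j = Y (flatten_index n a i j))"
proof -
  obtain Q :: "nat \<Rightarrow> mp" where Q: "\<And>y a i j. a < N \<Longrightarrow> i < n \<Longrightarrow> j < n \<Longrightarrow>
     poly_entry (\<lambda>c. [:c:]) n (P ! a) (unflatten (\<lambda>v. mp_eval (\<lambda>c. [:c:]) y (Q v))) i j = y (flatten_index n a i j)"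
    using level_inverse by blast
  define q where "q Y = unflatten (\<lambda>v. mp_eval (\<lambda>c. [:c:]) (\<lambda>v. [:0, Y v:]) (Q v))" for Y
  have Pq: "poly_entry (\<lambda>c. [:c:]) n (P ! a) (q Y) i j = [:0, Y (flatten_index n a i j):]" if "a < N" "i < n" "j < n" for Y a i j
    using Q[OF that] by (simp add: q_def)
  obtain s where s: "\<And>b. b < N \<Longrightarrow> poly_entry (\<lambda>c. c) 1 (P ! b) (\<lambda>a i j. s a) 0 0 = 0" using scalar_root by blast
  define S where "S = (\<lambda>a (i :: nat) j. if i = j then s a else (0::complex))"
  define L where "L b c = poly_jacobian (\<lambda>c. c) 1 (P ! b) (\<lambda>a i j. s a) (\<lambda>a i j. s a) c 0 0 0 0" for b c
  obtain M where M: "\<And>a c. a < N \<Longrightarrow> c < N \<Longrightarrow> (\<Sum>b<N. M a b * L b c) = (if a = c then 1 else 0)"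
    using scalar_jacobian_inverse[of s] unfolding L_def by blast
  have PS: "poly_entry (\<lambda>c. c) n (P ! a) S i j = 0" if "a < N" "i < n" for a i j
    using s[OF that(1)] that(2) by (cases "i = j") (simp_all add: poly_entry_def S_def word_entry_scalar del: One_nat_def)
  \<comment> \<open>Both are zeros of \<open>P\<close> at size \<open>n\<close>, so injectivity
    identifies the start of the curve with the scalar root.\<close>
  have q0: "poly (q Y a i j) 0 = S a i j" if "a < N" "i < n" "j < n" for Y a i j
  proof (rule inj[OF n _ that])
    fix a i j assume *: "a < N" "i < n" "j < n"
    show "poly_entry (\<lambda>c. c) n (P ! a) (\<lambda>a i j. poly (q Y a i j) 0) i j = poly_entry (\<lambda>c. c) n (P ! a) S i j"
      using poly_entry_hom[OF poly_eval_hom[of 0], of "\<lambda>c. [:c:]" n "P ! a" "q Y" i j] Pq[OF *] PS[OF *(1,2)] by simp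
  qed
  \<comment> \<open>Each step subtracts \<open>M\<close> applied to the defect; signs are written as
    constant factors so that \<open>represented_smult\<close> applies.\<close>
  define G where "G = rec_nat (\<lambda>a (Y :: nat \<Rightarrow> complex) i j. [:S a i j:])
     (\<lambda>k g a Y i j. g a Y i j + (\<Sum>b<N. [:- M a b:] * (poly_entry (\<lambda>c. [:c:]) n (P ! b) (\<lambda>a. g a Y) i j + [:-1:] * [:0, Y (flatten_index n b i j):])))"
  have G0: "G 0 = (\<lambda>a Y i j. [:S a i j:])"
    and GS: "G (Suc k) = (\<lambda>a Y i j. G k a Y i j + (\<Sum>b<N. [:- M a b:] * (poly_entry (\<lambda>c. [:c:]) n (P ! b) (\<lambda>a. G k a Y) i j + [:-1:] * [:0, Y (flatten_index n b i j):])))" for k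
    unfolding G_def by simp_all
  have G_rep: "represented (G k a)" if "a < N" for k a
    using that
  proof (induction k arbitrary: a)
    case 0
    show ?case
      by (rule iffD1[OF represented_cong represented_scalar[of "s a"]]) (simp add: G0 S_def)
  next
    case (Suc k)
    show ?case
      unfolding GS
      by (intro represented_add represented_sum represented_smult represented_PE represented_var Suc.IH P_nc Suc.prems) auto
  qed
  let ?T = "[:0, 1:] :: complex poly"
  have dvdT: "?T dvd p \<longleftrightarrow> poly p 0 = 0" for p
    using poly_eq_0_iff_dvd[of p 0] by simp
  have approx: "\<exists>E. \<forall>a<N. \<forall>i<n. \<forall>j<n. G k a Y i j - q Y a i j = ?T ^ Suc k * E a i j" for k Y
  proof (induction k)
    case 0
    have "\<exists>E. G 0 a Y i j - q Y a i j = ?T ^ Suc 0 * E" if "a < N" "i < n" "j < n" for a i j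
    proof -
      have "?T dvd G 0 a Y i j - q Y a i j" unfolding dvdT by (simp add: G0 q0 that)
      then show ?thesis by (auto simp: dvd_def)
    qed
    then show ?case by metis
  next
    case (Suc k)
    then obtain E where E: "\<And>a i j. a < N \<Longrightarrow> i < n \<Longrightarrow> j < n \<Longrightarrow> G k a Y i j - q Y a i j = ?T ^ Suc k * E a i j" by blast
    have Gk0: "poly (G k a Y i j) 0 = S a i j" if "a < N" "i < n" "j < n" for a i j
      using arg_cong[OF E[OF that], of "\<lambda>p. poly p 0"] by (simp add: q0 that)
    define R where "R b i j = (\<Sum>c<N. \<Sum>r<n. \<Sum>t<n. poly_jacobian (\<lambda>c. [:c:]) n (P ! b) (\<lambda>a. G k a Y) (q Y) c r t i j * E c r t)" for b i j
    have diff: "poly_entry (\<lambda>c. [:c:]) n (P ! b) (\<lambda>a. G k a Y) i j - [:0, Y (flatten_index n b i j):] = ?T ^ Suc k * R b i j"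
      if "b < N" "i < n" "j < n" for b i j
    proof -
      have "poly_entry (\<lambda>c. [:c:]) n (P ! b) (\<lambda>a. G k a Y) i j - [:0, Y (flatten_index n b i j):]
        = (\<Sum>c<N. \<Sum>r<n. \<Sum>t<n. poly_jacobian (\<lambda>c. [:c:]) n (P ! b) (\<lambda>a. G k a Y) (q Y) c r t i j * (?T ^ Suc k * E c r t))"
        unfolding Pq[OF that, symmetric] poly_entry_diff[OF P_nc[OF that(1)] that(2)]
        by (intro sum.cong refl) (simp only: E lessThan_iff)
      then show ?thesis by (simp only: R_def sum_distrib_left mult.left_commute)
    qed
    \<comment> \<open>At \<open>t = 0\<close> both points are the scalar root, so the Jacobian is
      \<open>L\<close> tensored with the identity.\<close>
    have R0: "poly (R b i j) 0 = (\<Sum>c<N. L b c * poly (E c i j) 0)" if "b < N" "i < n" "j < n" for b i j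
    proof -
      have JS: "poly (poly_jacobian (\<lambda>c. [:c:]) n (P ! b) (\<lambda>a. G k a Y) (q Y) c r t i j) 0 = (if r = i \<and> t = j then L b c else 0)"
        if "c < N" "r < n" "t < n" for c r t
      proof -
        have JWeq: "word_jacobian n (\<lambda>a i j. poly (G k a Y i j) 0) (\<lambda>a i j. poly (q Y a i j) 0) w c r t i j = word_jacobian n S S w c r t i j"
          if "set w \<subseteq> {..<N}" "i < n" for w i
          using that
        proof (induction w arbitrary: i)
          case (Cons b w)
          have "word_entry n (\<lambda>a i j. poly (q Y a i j) 0) w t j = word_entry n S w t j"
            using Cons.prems \<open>t < n\<close> by (intro word_entry_cong) (auto simp: q0)
          then show ?case using Cons by (auto simp: Gk0 intro!: sum.cong)
        qed simp
        have "poly (poly_jacobian (\<lambda>c. [:c:]) n (P ! b) (\<lambda>a. G k a Y) (q Y) c r t i j) 0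
          = poly_jacobian (\<lambda>c. c) n (P ! b) (\<lambda>a i j. poly (G k a Y i j) 0) (\<lambda>a i j. poly (q Y a i j) 0) c r t i j"
          by (subst poly_jacobian_hom[OF poly_eval_hom]) simp
        also have "\<dots> = poly_jacobian (\<lambda>c. c) n (P ! b) S S c r t i j"
          unfolding poly_jacobian_def using ncpoly_words[OF P_nc[OF \<open>b < N\<close>]] \<open>i < n\<close>
          by (intro sum.cong refl) (simp add: JWeq)
        also have "\<dots> = (if r = i \<and> t = j then L b c else 0)"
          using \<open>i < n\<close> that by (auto simp: poly_jacobian_def L_def S_def word_jacobian_scalar)
        finally show ?thesis .
      qed
      have "poly (R b i j) 0 = (\<Sum>c<N. \<Sum>r<n. \<Sum>t<n. (if r = i \<and> t = j then L b c else 0) * poly (E c r t) 0)"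
        unfolding R_def poly_sum poly_mult by (intro sum.cong refl) (simp only: JS lessThan_iff)
      also have "\<dots> = (\<Sum>c<N. \<Sum>r<n. \<Sum>t<n. if t = j then if r = i then L b c * poly (E c i j) 0 else 0 else 0)"
        by (intro sum.cong refl) auto
      also have "\<dots> = (\<Sum>c<N. L b c * poly (E c i j) 0)" using that by simp
      finally show ?thesis .
    qed
    have "\<exists>E'. G (Suc k) a Y i j - q Y a i j = ?T ^ Suc (Suc k) * E'" if "a < N" "i < n" "j < n" for a i j
    proof -
      \<comment> \<open>The new error after splitting off the old power of \<open>t\<close>; it
        vanishes at \<open>t = 0\<close> since \<open>M\<close> inverts \<open>L\<close>, which
        yields one more power.\<close>
      let ?D = "E a i j - (\<Sum>b<N. [:M a b:] * R b i j)"
      have "(\<Sum>b<N. [:- M a b:] * (poly_entry (\<lambda>c. [:c:]) n (P ! b) (\<lambda>a. G k a Y) i j + [:-1:] * [:0, Y (flatten_index n b i j):]))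
        = (\<Sum>b<N. - (?T ^ Suc k * ([:M a b:] * R b i j)))"
      proof (intro sum.cong refl)
        fix b assume "b \<in> {..<N}"
        then have d: "poly_entry (\<lambda>c. [:c:]) n (P ! b) (\<lambda>a. G k a Y) i j + [:-1:] * [:0, Y (flatten_index n b i j):] = ?T ^ Suc k * R b i j"
        proof -
          have neg: "[:-1:] * [:0, Y (flatten_index n b i j):] = - [:0, Y (flatten_index n b i j):]" by simp
          have "b < N" using \<open>b \<in> {..<N}\<close> by simp
          from diff[OF this that(2,3)] show ?thesis by (simp only: neg add_uminus_conv_diff)
        qed
        have M: "[:- M a b:] = - [:M a b:]" by simp
        show "[:- M a b:] * (poly_entry (\<lambda>c. [:c:]) n (P ! b) (\<lambda>a. G k a Y) i j + [:-1:] * [:0, Y (flatten_index n b i j):])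
          = - (?T ^ Suc k * ([:M a b:] * R b i j))"
          unfolding d M by (simp only: mult_minus_left mult.left_commute)
      qed
      also have "\<dots> = - (?T ^ Suc k * (\<Sum>b<N. [:M a b:] * R b i j))"
        by (simp only: sum_negf sum_distrib_left)
      finally have "G (Suc k) a Y i j - q Y a i j = (G k a Y i j - q Y a i j) - ?T ^ Suc k * (\<Sum>b<N. [:M a b:] * R b i j)"
        unfolding GS by (simp only: diff_conv_add_uminus ac_simps)
      then have 1: "G (Suc k) a Y i j - q Y a i j = ?T ^ Suc k * ?D"
        unfolding E[OF that] by (simp only: right_diff_distrib)
      have "poly ?D 0 = poly (E a i j) 0 - (\<Sum>b<N. M a b * (\<Sum>c<N. L b c * poly (E c i j) 0))"
        using that by (simp add: poly_sum R0)
      also have "(\<Sum>b<N. M a b * (\<Sum>c<N. L b c * poly (E c i j) 0)) = (\<Sum>c<N. (\<Sum>b<N. M a b * L b c) * poly (E c i j) 0)"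
        unfolding sum_distrib_left sum_distrib_right by (subst sum.swap) (simp only: mult.assoc)
      also have "\<dots> = (\<Sum>c<N. if a = c then poly (E c i j) 0 else 0)"
        using that by (intro sum.cong refl) (simp add: M)
      also have "\<dots> = poly (E a i j) 0" using that by simp
      finally have "?T dvd ?D" unfolding dvdT by simp
      then obtain E' where "?D = ?T * E'" by (auto simp: dvd_def)
      with 1 show ?thesis by (simp only: power_Suc mult.assoc mult.left_commute) blast
    qed
    then show ?case by metis
  qed
  \<comment> \<open>The bound must not depend on \<open>Y\<close>, since one truncation has to serve
    all \<open>Y\<close>; the sum over the entries dominates each single bound.\<close>
  have "\<exists>d. \<forall>Y. \<forall>a<N. \<forall>i<n. \<forall>j<n. degree (q Y a i j) \<le> d"
  proof -
    have "\<exists>d. \<forall>x. (\<forall>v. degree (x v) \<le> 1) \<longrightarrow> degree (mp_eval (\<lambda>c. [:c:]) x (Q v)) \<le> d" for v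
      by (rule mp_eval_degree_bound)
    then obtain d where d: "\<And>v x. (\<forall>v. degree (x v) \<le> 1) \<Longrightarrow> degree (mp_eval (\<lambda>c. [:c:]) x (Q v)) \<le> d v" by metis
    have "degree (q Y a i j) \<le> (\<Sum>v<m. d v)" if "a < N" "i < n" "j < n" for Y a i j
    proof -
      have "degree (q Y a i j) \<le> d (flatten_index n a i j)" unfolding q_def unflatten_def by (rule d) simp
      also have "\<dots> \<le> (\<Sum>v<m. d v)"
        using that by (intro member_le_sum) (auto simp: m_def flatten_index_less)
      finally show ?thesis .
    qed
    then show ?thesis by blast
  qed
  then obtain d where d: "\<And>Y a i j. a < N \<Longrightarrow> i < n \<Longrightarrow> j < n \<Longrightarrow> degree (q Y a i j) \<le> d" by blast
  have "\<forall>a<N. \<exists>e. (\<forall>(c, w)\<in>set e. set w \<subseteq> {..<N}) \<and> (\<forall>Y. \<forall>i<n. \<forall>j<n. G d a Y i j = list_value e Y i j)"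
    using G_rep[of _ d] unfolding represented_def by blast
  then obtain e where e: "\<And>a c w. a < N \<Longrightarrow> (c, w) \<in> set (e a) \<Longrightarrow> set w \<subseteq> {..<N}"
    and eG: "\<And>a Y i j. a < N \<Longrightarrow> i < n \<Longrightarrow> j < n \<Longrightarrow> G d a Y i j = list_value (e a) Y i j"
    by (metis (mono_tags, lifting) case_prodD)
  define Q' where "Q' a = word_coeff (filter (\<lambda>(c, w). length w \<le> d) (e a))" for a
  have Q'_nc: "Q' a \<in> ncpoly N" if "a < N" for a
    unfolding Q'_def using e[OF that] by (intro word_coeff_ncpoly) auto
  have Q'_eq: "poly_entry (\<lambda>c. c) n (Q' a) (unflatten Y) i j = poly (q Y a i j) 1" if aij: "a < N" "i < n" "j < n" for Y a i j
  proof -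
    obtain E' where "\<forall>a<N. \<forall>i<n. \<forall>j<n. G d a Y i j - q Y a i j = ?T ^ Suc d * E' a i j"
      using approx[of d Y] by blast
    then obtain E where E: "G d a Y i j - q Y a i j = ?T ^ Suc d * E" using aij by blast
    \<comment> \<open>The error starts in degree \<open>d + 1\<close>, so the coefficients up to
      \<open>d\<close>, which are all those of \<open>q Y\<close>, can be read off from
      \<open>G d\<close>.\<close>
    have co: "coeff (q Y a i j) k = coeff (G d a Y i j) k" if "k \<le> d" for k
    proof -
      have "coeff (?T ^ Suc d * E) k = 0"
      proof -
        have "?T ^ Suc d = Polynomial.monom 1 (Suc d)" by (simp only: monom_altdef smult_1_left)
        then show ?thesis using that by (simp only: coeff_monom_mult) simp
      qed
      then show ?thesis using arg_cong[OF E, of "\<lambda>p. coeff p k"] by simp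
    qed
    have "poly (q Y a i j) 1 = (\<Sum>k\<le>d. coeff (q Y a i j) k)"
      using d[OF aij, of Y] by (simp add: poly_altdef) (auto intro!: sum.mono_neutral_left intro: le_degree)
    also have "\<dots> = (\<Sum>k\<le>d. coeff (list_value (e a) Y i j) k)" by (intro sum.cong) (auto simp: co eG aij)
    also have "\<dots> = (\<Sum>(c, w)\<leftarrow>filter (\<lambda>(c, w). length w \<le> d) (e a). c * word_entry n (unflatten Y) w i j)"
      by (rule sum_coeff_list_value)
    finally show ?thesis by (simp add: Q'_def poly_entry_word_coeff)
  qed
  have "poly_entry (\<lambda>c. c) n (P ! a) (\<lambda>a i j. poly_entry (\<lambda>c. c) n (Q' a) (unflatten Y) i j) i j = Y (flatten_index n a i j)"
    if "a < N" "i < n" "j < n" for Y a i j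
  proof -
    have "poly_entry (\<lambda>c. c) n (P ! a) (\<lambda>a i j. poly_entry (\<lambda>c. c) n (Q' a) (unflatten Y) i j) i j
      = poly_entry (\<lambda>c. c) n (P ! a) (\<lambda>a i j. poly (q Y a i j) 1) i j"
      by (rule poly_entry_cong[OF P_nc[OF that(1)]]) (use that in \<open>auto simp: Q'_eq\<close>)
    also have "\<dots> = poly (poly_entry (\<lambda>c. [:c:]) n (P ! a) (q Y) i j) 1"
      by (subst poly_entry_hom[OF poly_eval_hom]) simp
    finally show ?thesis by (simp add: Pq that)
  qed
  with Q'_nc show ?thesis by blast
qed

end

subsection \<open>Matrices as entry functions\<close>

definition entries :: "complex mat list \<Rightarrow> nat \<Rightarrow> nat \<Rightarrow> nat \<Rightarrow> complex" where
  "entries X a i j = X ! a $$ (i, j)"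

definition of_entries :: "nat \<Rightarrow> nat \<Rightarrow> (nat \<Rightarrow> nat \<Rightarrow> nat \<Rightarrow> complex) \<Rightarrow> complex mat list" where
  "of_entries N n Z = map (\<lambda>a. mat n n (\<lambda>(i, j). Z a i j)) [0..<N]"

lemma of_entries_tup: "of_entries N n Z \<in> tup N n"
  by (simp add: of_entries_def tup_def)

lemma entries_of_entries: "a < N \<Longrightarrow> i < n \<Longrightarrow> j < n \<Longrightarrow> entries (of_entries N n Z) a i j = Z a i j"
  by (simp add: of_entries_def entries_def)

lemma tup_eqI:
  assumes "X \<in> tup N n" "Y \<in> tup N n"
    and "\<And>a i j. a < N \<Longrightarrow> i < n \<Longrightarrow> j < n \<Longrightarrow> entries X a i j = entries Y a i j"
  shows "X = Y"
proof (rule nth_equalityI)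
  show "length X = length Y" using assms(1,2) by (simp add: tup_def)
  fix a assume "a < length X"
  then have a: "a < N" using assms(1) by (simp add: tup_def)
  have "X ! a \<in> carrier_mat n n" "Y ! a \<in> carrier_mat n n" using assms(1,2) a by (auto simp: tup_def)
  then show "X ! a = Y ! a"
    using assms(3)[OF a] by (intro eq_matI) (auto simp: entries_def)
qed

lemma eval_word_entries:
  assumes X: "X \<in> tup N n"
  shows "set w \<subseteq> {..<N} \<Longrightarrow> eval_word n X w \<in> carrier_mat n n \<and>
    (\<forall>i<n. \<forall>j<n. eval_word n X w $$ (i, j) = word_entry n (entries X) w i j)"
proof (induction w)
  case Nil
  then show ?case by (simp add: eval_word_def)
next
  case (Cons a w)
  then have IH: "eval_word n X w \<in> carrier_mat n n" "\<And>i j. i < n \<Longrightarrow> j < n \<Longrightarrow> eval_word n X w $$ (i, j) = word_entry n (entries X) w i j"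
    by auto
  have a: "X ! a \<in> carrier_mat n n" using X Cons.prems by (auto simp: tup_def)
  have e: "eval_word n X (a # w) = X ! a * eval_word n X w" by (simp add: eval_word_def)
  show ?case
    unfolding e using a IH by (auto simp: scalar_prod_def lessThan_atLeast0 simp flip: entries_def intro!: sum.cong)
qed

lemma eval_poly_entries:
  assumes "X \<in> tup N n" "p \<in> ncpoly N" "i < n" "j < n"
  shows "eval_poly n p X $$ (i, j) = poly_entry (\<lambda>c. c) n p (entries X) i j"
proof -
  have "eval_word n X w $$ (i, j) = word_entry n (entries X) w i j" if "p w \<noteq> 0" for w
    using eval_word_entries[OF assms(1) ncpoly_words[OF assms(2) that]] assms(3,4) by blast
  then show ?thesis using assms(3,4) by (simp add: eval_poly_def poly_entry_def)
qed

lemma eval_map_tup: "fpmap N P \<Longrightarrow> eval_map n P X \<in> tup N n"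
  by (simp add: eval_map_def tup_def fpmap_def eval_poly_def)

lemma entries_eval_map:
  assumes "fpmap N P" "X \<in> tup N n" "a < N" "i < n" "j < n"
  shows "entries (eval_map n P X) a i j = poly_entry (\<lambda>c. c) n (P ! a) (entries X) i j"
  using assms eval_poly_entries[OF assms(2), of "P ! a" i j] by (auto simp: entries_def eval_map_def fpmap_def)

lemma DP_tup: "fpmap N P \<Longrightarrow> DP n P X H \<in> tup N n"
  by (simp add: DP_def eval_map_def tup_def fpmap_def upper_right_def)

lemma DP_entries:
  assumes "fpmap N P" "X \<in> tup N n" "H \<in> tup N n" "a < N" "i < n" "j < n"
  shows "entries (DP n P X H) a i j
    = (\<Sum>w | (P ! a) w \<noteq> 0. (P ! a) w * word_corner n (entries X) (entries X) (entries H) w i j)"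
proof -
  let ?B = "map2 (\<lambda>x h. four_block_mat x h (0\<^sub>m n n) x) X H"
  have B: "?B \<in> tup N (2 * n)"
    unfolding tup_def
  proof (intro CollectI conjI allI impI)
    show "length ?B = N" using assms(2,3) by (simp add: tup_def)
    fix b assume b: "b < N"
    then have "X ! b \<in> carrier_mat n n" using assms(2) by (simp add: tup_def)
    then have "four_block_mat (X ! b) (H ! b) (0\<^sub>m n n) (X ! b) \<in> carrier_mat (n + n) (n + n)"
      by (intro four_block_carrier_mat)
    then show "?B ! b \<in> carrier_mat (2 * n) (2 * n)" using assms(2,3) b by (simp add: tup_def mult_2)
  qed
  have Be: "entries ?B b k l = block_entries n (entries X) (entries H) (entries X) b k l" if "b < N" "k < 2 * n" "l < 2 * n" for b k l
    using assms(2,3) that by (auto simp: tup_def entries_def block_entries_def)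
  have P: "P ! a \<in> ncpoly N" using assms by (simp add: fpmap_def)
  have "entries (DP n P X H) a i j = entries (eval_map (2 * n) P ?B) a i (j + n)"
    using assms by (simp add: DP_def entries_def upper_right_def eval_map_def fpmap_def)
  also have "\<dots> = poly_entry (\<lambda>c. c) (2 * n) (P ! a) (entries ?B) i (j + n)"
    by (rule entries_eval_map[OF assms(1) B]) (use assms in auto)
  also have "\<dots> = poly_entry (\<lambda>c. c) (2 * n) (P ! a) (block_entries n (entries X) (entries H) (entries X)) i (j + n)"
    using assms Be by (intro poly_entry_cong[OF P]) auto
  finally show ?thesis using assms by (simp add: poly_entry_blk)
qed

lemma replicate_zero_tup: "replicate N (0\<^sub>m n n) \<in> tup N n"
  by (simp add: tup_def)

lemma DP_zero_iff:
  assumes "fpmap N P" "X \<in> tup N n" "H \<in> tup N n"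
  shows "DP n P X H = replicate N (0\<^sub>m n n) \<longleftrightarrow> (\<forall>a<N. \<forall>i<n. \<forall>j<n.
    (\<Sum>w | (P ! a) w \<noteq> 0. (P ! a) w * word_corner n (entries X) (entries X) (entries H) w i j) = 0)"
proof
  assume "DP n P X H = replicate N (0\<^sub>m n n)"
  then show "\<forall>a<N. \<forall>i<n. \<forall>j<n.
    (\<Sum>w | (P ! a) w \<noteq> 0. (P ! a) w * word_corner n (entries X) (entries X) (entries H) w i j) = 0"
    using DP_entries[OF assms] by (auto simp: entries_def)
next
  assume "\<forall>a<N. \<forall>i<n. \<forall>j<n.
    (\<Sum>w | (P ! a) w \<noteq> 0. (P ! a) w * word_corner n (entries X) (entries X) (entries H) w i j) = 0"
  then show "DP n P X H = replicate N (0\<^sub>m n n)"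
    by (intro tup_eqI[OF DP_tup[OF assms(1)] replicate_zero_tup])
      (simp add: DP_entries[OF assms], simp add: entries_def)
qed

text \<open>At \<open>Z = X \<oplus> Y\<close> the direction \<open>[Z, T]\<close> has derivative
  \<open>[P(Z), T]\<close>, which is zero because \<open>P(X) = P(Y)\<close>. Nonsingularity at size
  \<open>2 * n\<close> gives \<open>[Z, T] = 0\<close>, whose upper right block is
  \<open>X - Y\<close>.\<close>

lemma nonsingular_imp_eq:
  assumes fp: "fpmap N P"
    and ns: "\<And>n X H. n \<ge> 1 \<Longrightarrow> X \<in> tup N n \<Longrightarrow> H \<in> tup N n \<Longrightarrow>
      DP n P X H = replicate N (0\<^sub>m n n) \<Longrightarrow> H = replicate N (0\<^sub>m n n)"
    and n: "n \<ge> 1" and X: "X \<in> tup N n" and Y: "Y \<in> tup N n" and eq: "eval_map n P X = eval_map n P Y"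
  shows "X = Y"
proof -
  define Z where "Z = block_entries n (entries X) (\<lambda>_ _ _. 0) (entries Y)"
  \<comment> \<open>The block matrix with an identity in the upper right corner: it shifts columns
    by \<open>n\<close> in \<open>MT\<close> and rows in \<open>TM\<close>.\<close>
  define T where "T = (\<lambda>k j. if k < n \<and> j = n + k then 1 else (0::complex))"
  have MT: "(\<Sum>k<2 * n. M k * T k j) = (if n \<le> j then M (j - n) else 0)" if "j < 2 * n" for M :: "nat \<Rightarrow> complex" and j
  proof -
    have "(\<Sum>k<2 * n. M k * T k j) = (\<Sum>k<2 * n. if k = j - n then if n \<le> j then M (j - n) else 0 else 0)"
      using that by (intro sum.cong) (auto simp: T_def)
    then show ?thesis using that by auto
  qed
  have TM: "(\<Sum>k<2 * n. T i k * M k) = (if i < n then M (n + i) else 0)" for M :: "nat \<Rightarrow> complex" and i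
  proof -
    have "(\<Sum>k<2 * n. T i k * M k) = (\<Sum>k<2 * n. if k = n + i then if i < n then M (n + i) else 0 else 0)"
      by (intro sum.cong) (auto simp: T_def)
    then show ?thesis by simp
  qed
  define H where "H a i j = (\<Sum>k<2 * n. Z a i k * T k j) - (\<Sum>k<2 * n. T i k * Z a k j)" for a i j
  let ?Z = "of_entries N (2 * n) Z" and ?H = "of_entries N (2 * n) H"
  have P: "P ! a \<in> ncpoly N" if "a < N" for a using fp that by (simp add: fpmap_def)
  have PXY: "poly_entry (\<lambda>c. c) n (P ! a) (entries X) i j = poly_entry (\<lambda>c. c) n (P ! a) (entries Y) i j"
    if "a < N" "i < n" "j < n" for a i j
    using entries_eval_map[OF fp X that] entries_eval_map[OF fp Y that] eq by simp
  have "DP (2 * n) P ?Z ?H = replicate N (0\<^sub>m (2 * n) (2 * n))"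
    unfolding DP_zero_iff[OF fp of_entries_tup of_entries_tup]
  proof (intro allI impI)
    fix a i j assume a: "a < N" and i: "i < 2 * n" and j: "j < 2 * n"
    have word_corner: "word_corner (2 * n) (entries ?Z) (entries ?Z) (entries ?H) w i j
      = (\<Sum>k<2 * n. word_entry (2 * n) Z w i k * T k j) - (\<Sum>k<2 * n. T i k * word_entry (2 * n) Z w k j)"
      if w: "set w \<subseteq> {..<N}" for w
    proof -
      have "word_entry (2 * n) (entries ?Z) w i' j' = word_entry (2 * n) Z w i' j'" if "i' < 2 * n" for i' j'
        by (rule word_entry_cong) (use w that in \<open>auto simp: entries_of_entries\<close>)
      moreover have "word_corner (2 * n) (entries ?Z) (entries ?Z) (entries ?H) w i j
        = (\<Sum>k<2 * n. word_entry (2 * n) (entries ?Z) w i k * T k j) - (\<Sum>k<2 * n. T i k * word_entry (2 * n) (entries ?Z) w k j)"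
      proof (rule word_corner_commutator[OF _ i j])
        fix b i' j' assume *: "b \<in> set w" "i' < 2 * n" "j' < 2 * n"
        then have b: "b < N" using w by auto
        show "entries ?H b i' j' = (\<Sum>k<2 * n. entries ?Z b i' k * T k j') - (\<Sum>k<2 * n. T i' k * entries ?Z b k j')"
          using b * by (simp add: entries_of_entries H_def)
      qed
      ultimately show ?thesis using i by (simp cong: sum.cong_simp)
    qed
    have "(\<Sum>w | (P ! a) w \<noteq> 0. (P ! a) w * word_corner (2 * n) (entries ?Z) (entries ?Z) (entries ?H) w i j)
      = (\<Sum>w | (P ! a) w \<noteq> 0. (P ! a) w * ((\<Sum>k<2 * n. word_entry (2 * n) Z w i k * T k j) - (\<Sum>k<2 * n. T i k * word_entry (2 * n) Z w k j)))"
      using ncpoly_words[OF P[OF a]] by (intro sum.cong refl) (simp add: word_corner)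
    also have "\<dots> = (if n \<le> j then poly_entry (\<lambda>c. c) (2 * n) (P ! a) Z i (j - n) else 0)
        - (if i < n then poly_entry (\<lambda>c. c) (2 * n) (P ! a) Z (n + i) j else 0)"
      unfolding MT[OF j] TM by (simp add: poly_entry_def right_diff_distrib sum_subtractf)
    also have "\<dots> = 0"
      using i j by (auto simp: Z_def poly_entry_blk PXY[OF a])
    finally show "(\<Sum>w | (P ! a) w \<noteq> 0. (P ! a) w * word_corner (2 * n) (entries ?Z) (entries ?Z) (entries ?H) w i j) = 0" .
  qed
  then have H0: "?H = replicate N (0\<^sub>m (2 * n) (2 * n))"
    using n by (intro ns[OF _ of_entries_tup of_entries_tup]) auto
  show ?thesis
  proof (rule tup_eqI[OF X Y])
    fix a i j assume *: "a < N" "i < n" "j < n"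
    have "entries ?H a i (n + j) = 0" unfolding H0 using * by (simp add: entries_def)
    then have "H a i (n + j) = 0" using * by (simp add: entries_of_entries)
    moreover have "H a i (n + j) = entries X a i j - entries Y a i j"
      unfolding H_def TM using * by (subst MT) (auto simp: Z_def block_entries_def)
    ultimately show "entries X a i j = entries Y a i j" by simp
  qed
qed

text \<open>Injectivity compares tuples of possibly different sizes, and bijectivity is split into
  injectivity and surjectivity. Conditions (3) and (4) follow from injectivity through the right
  inverses at each size.\<close>

theorem mainTheorem3:
  fixes N :: nat and P :: "(nat list \<Rightarrow> complex) list"
  assumes "fpmap N P"
  defines "inj_P \<equiv> (\<forall>n m X Y. n \<ge> 1 \<longrightarrow> m \<ge> 1 \<longrightarrow> X \<in> tup N n \<longrightarrow> Y \<in> tup N m \<longrightarrow>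
                         eval_map n P X = eval_map m P Y \<longrightarrow> X = Y)"
      and "surj_P \<equiv> (\<forall>m Y. m \<ge> 1 \<longrightarrow> Y \<in> tup N m \<longrightarrow>
                         (\<exists>n X. n \<ge> 1 \<and> X \<in> tup N n \<and> eval_map n P X = Y))"
  shows
    "((\<forall>n X H. n \<ge> 1 \<longrightarrow> X \<in> tup N n \<longrightarrow> H \<in> tup N n \<longrightarrow>
          DP n P X H = replicate N (0\<^sub>m n n) \<longrightarrow> H = replicate N (0\<^sub>m n n)) \<longleftrightarrow> inj_P)
   \<and> (inj_P \<longleftrightarrow> inj_P \<and> surj_P)
   \<and> (inj_P \<and> surj_P \<longleftrightarrow>
        inj_P \<and> surj_P \<and>
        (\<forall>n \<ge> 1. \<exists>Q. fpmap N Q \<and>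
            (\<forall>Y \<in> tup N n. eval_map n P (eval_map n Q Y) = Y \<and>
                             eval_map n Q (eval_map n P Y) = Y)))"
    (is "(?nonsing \<longleftrightarrow> _) \<and> _ \<and> (_ \<longleftrightarrow> _ \<and> _ \<and> ?inverse)")
proof -
  note fp = assms(1)
  have "inj_P" if ns: ?nonsing
    unfolding inj_P_def
  proof (intro allI impI)
    fix n m :: nat and X Y
    assume n: "n \<ge> 1" "m \<ge> 1" and XY: "X \<in> tup N n" "Y \<in> tup N m" and eq: "eval_map n P X = eval_map m P Y"
    show "X = Y"
    \<comment> \<open>For \<open>N = 0\<close> the empty tuple belongs to every size; otherwise the
      first component of the common value determines the size.\<close>
    proof (cases "N = 0")
      case True
      then show ?thesis using XY by (simp add: tup_def)
    next
      case False
      then have "eval_map n P X ! 0 \<in> carrier_mat n n" "eval_map m P Y ! 0 \<in> carrier_mat m m"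
        using eval_map_tup[OF fp] by (auto simp: tup_def)
      then have "n = m" using eq by auto
      then show ?thesis using nonsingular_imp_eq[OF fp _ n(1)] ns XY eq by blast
    qed
  qed
  moreover have free: "free_inj N P" if injP: inj_P
  proof
    fix n :: nat and X Y :: "nat \<Rightarrow> nat \<Rightarrow> nat \<Rightarrow> complex" and a i j
    assume n: "n \<ge> 1" and eq: "\<And>a i j. a < N \<Longrightarrow> i < n \<Longrightarrow> j < n \<Longrightarrow>
        poly_entry (\<lambda>c. c) n (P ! a) X i j = poly_entry (\<lambda>c. c) n (P ! a) Y i j" and *: "a < N" "i < n" "j < n"
    have ent: "entries (eval_map n P (of_entries N n Z)) a i j = poly_entry (\<lambda>c. c) n (P ! a) Z i j"
      if "a < N" "i < n" "j < n" for Z a i j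
    proof -
      have "P ! a \<in> ncpoly N" using fp that by (simp add: fpmap_def)
      then show ?thesis
        unfolding entries_eval_map[OF fp of_entries_tup that]
        by (rule poly_entry_cong) (use that in \<open>auto simp: entries_of_entries\<close>)
    qed
    have "eval_map n P (of_entries N n X) = eval_map n P (of_entries N n Y)"
      by (rule tup_eqI[OF eval_map_tup[OF fp] eval_map_tup[OF fp]]) (simp add: ent eq)
    then have "of_entries N n X = of_entries N n Y"
      using injP n of_entries_tup unfolding inj_P_def by blast
    then show "X a i j = Y a i j" using * by (metis entries_of_entries)
  qed (rule fp)
  \<comment> \<open>A vanishing derivative means that the corners \<open>H\<close> and 0 over the
    same diagonal have equal images at size \<open>2 * n\<close>.\<close>
  moreover have ?nonsing if injP: inj_P
  proof (intro allI impI)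
    fix n X H
    assume n: "n \<ge> (1::nat)" and XH: "X \<in> tup N n" "H \<in> tup N n" and D: "DP n P X H = replicate N (0\<^sub>m n n)"
    interpret free_inj N P by (rule free[OF injP])
    note D0 = D[unfolded DP_zero_iff[OF fp XH]]
    show "H = replicate N (0\<^sub>m n n)"
    proof (rule tup_eqI[OF XH(2) replicate_zero_tup])
      fix a i j assume *: "a < N" "i < n" "j < n"
      have "poly_entry (\<lambda>c. c) (2 * n) (P ! b) (block_entries n (entries X) (entries H) (entries X)) k l
        = poly_entry (\<lambda>c. c) (2 * n) (P ! b) (block_entries n (entries X) (\<lambda>_ _ _. 0) (entries X)) k l"
        if "b < N" "k < 2 * n" "l < 2 * n" for b k l
      proof -
        have "k < n \<Longrightarrow> \<not> l < n \<Longrightarrow> l - n < n" using that by simp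
        then show ?thesis using D0 that by (simp add: poly_entry_blk word_corner_0)
      qed
      from inj[OF _ this, of a i "n + j"] n *
      have "entries H a i j = 0" by (simp add: block_entries_def)
      then show "entries H a i j = entries (replicate N (0\<^sub>m n n)) a i j" using * by (simp add: entries_def)
    qed
  qed
  moreover have inverse: ?inverse if injP: inj_P
  proof (intro allI impI)
    fix n :: nat assume n: "n \<ge> 1"
    interpret free_inj N P by (rule free[OF injP])
    interpret free_inj_level N P n by unfold_locales (rule n)
    obtain Q where Qnc: "\<And>a. a < N \<Longrightarrow> Q a \<in> ncpoly N" and Q: "\<And>Y a i j. a < N \<Longrightarrow> i < n \<Longrightarrow> j < n \<Longrightarrow>
       poly_entry (\<lambda>c. c) n (P ! a) (\<lambda>a i j. poly_entry (\<lambda>c. c) n (Q a) (unflatten Y) i j) i j = Y (flatten_index n a i j)"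
      using nc_level_inverse by blast
    define Ql where "Ql = map Q [0..<N]"
    have fpQ: "fpmap N Ql" using Qnc by (auto simp: Ql_def fpmap_def)
    have right: "eval_map n P (eval_map n Ql Y) = Y" if Y: "Y \<in> tup N n" for Y
    proof (rule tup_eqI[OF eval_map_tup[OF fp] Y])
      fix a i j assume *: "a < N" "i < n" "j < n"
      define y where "y v = entries Y (v div n div n) (v div n mod n) (v mod n)" for v
      have y: "unflatten y b k l = entries Y b k l" if "k < n" "l < n" for b k l
        using that by (simp add: unflatten_def y_def decode_enc)
      have "entries (eval_map n Ql Y) b k l = poly_entry (\<lambda>c. c) n (Q b) (unflatten y) k l" if "b < N" "k < n" "l < n" for b k l
      proof -
        have "poly_entry (\<lambda>c. c) n (Q b) (entries Y) k l = poly_entry (\<lambda>c. c) n (Q b) (unflatten y) k l"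
          by (rule poly_entry_cong[OF Qnc]) (use that y in auto)
        moreover have "Ql ! b = Q b" using that by (simp add: Ql_def)
        ultimately show ?thesis using entries_eval_map[OF fpQ Y that] by simp
      qed
      then have "entries (eval_map n P (eval_map n Ql Y)) a i j
        = poly_entry (\<lambda>c. c) n (P ! a) (\<lambda>a i j. poly_entry (\<lambda>c. c) n (Q a) (unflatten y) i j) i j"
        unfolding entries_eval_map[OF fp eval_map_tup[OF fpQ] *] by (intro poly_entry_cong[OF P_nc] *)
      also have "\<dots> = entries Y a i j" using * y[of i j a] by (simp add: Q unflatten_def)
      finally show "entries (eval_map n P (eval_map n Ql Y)) a i j = entries Y a i j" .
    qed
    \<comment> \<open>The right inverse gives \<open>P(Q(P(Y))) = P(Y)\<close>, and injectivity
      cancels the outer \<open>P\<close>.\<close>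
    have "eval_map n Ql (eval_map n P Y) = Y" if Y: "Y \<in> tup N n" for Y
      using injP n eval_map_tup[OF fpQ] Y right[OF eval_map_tup[OF fp, of n Y]] unfolding inj_P_def by blast
    with right fpQ show "\<exists>Q. fpmap N Q \<and> (\<forall>Y \<in> tup N n. eval_map n P (eval_map n Q Y) = Y \<and>
                             eval_map n Q (eval_map n P Y) = Y)" by blast
  qed
  moreover have surj_P if injP: inj_P
    unfolding surj_P_def using inverse[OF injP] eval_map_tup by blast
  ultimately show ?thesis by blast
qed

end
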